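(* Let $G$ be a finite group, and let $G'=[G,G]$ be its commutator subgroup. Then, for every integer $m\geq 1$, $$|G/G'|\ \bigm|\ |\mathrm{H}^{2m}(G,\mathbb{Z})| = |\mathrm{H}_{2m-1}(G,\mathbb{Z})|,$$ that is, the groups $\mathrm{H}^{2m}(G,\mathbb{Z})$ and $\mathrm{H}_{2m-1}(G,\mathbb{Z})$ have the same order, and $|G/G'|$ divides this order.
   Context: Here $\mathbb{Z}$ denotes the trivial $\mathbb{Z}G$-module. Integral group cohomology is $\mathrm{H}^n(G,\mathbb{Z})=\operatorname{Ext}^n_{\mathbb{Z}G}(\mathbb{Z},\mathbb{Z})$ and integral group homology is $\mathrm{H}_n(G,\mathbb{Z})=\operatorname{Tor}^{\mathbb{Z}G}_n(\mathbb{Z},\mathbb{Z})$, with trivial coefficients on both sides. For a finite group $G$ and $n\geq 1$ these are finite abelian groups, and $|\cdot|$ denotes the order (cardinality). Modules are right modules. *)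

theory Defs
  imports "HOL-Algebra.Module" "HOL-Algebra.AbelCoset" "HOL-Algebra.Free_Abelian_Groups"
    "HOL-Library.Countable_Set"
begin

section \<open>One-sided modules over a ring\<close>

text \<open>The locale \<^locale>\<open>module\<close> of HOL-Algebra is restricted to commutative rings.  Both sided
  variants below use its record type.  For a right module the term \<open>a \<odot>\<^bsub>M\<^esub> x\<close> stands for
  the product of \<open>x\<close> by \<open>a\<close> on the right, usually written \<open>x a\<close>.  The fields \<open>mult\<close> and \<open>one\<close>
  of a module record are never used.\<close>

locale left_module = R?: ring R + M?: abelian_group M
  for R :: "('r, 'c) ring_scheme" (structure) and M :: "('r, 'm, 'd) module_scheme" (structure) +
  assumes smult_closed:
      "\<lbrakk>a \<in> carrier R; x \<in> carrier M\<rbrakk> \<Longrightarrow> a \<odot>\<^bsub>M\<^esub> x \<in> carrier M"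
    and smult_l_distr:
      "\<lbrakk>a \<in> carrier R; b \<in> carrier R; x \<in> carrier M\<rbrakk> \<Longrightarrow>
        (a \<oplus>\<^bsub>R\<^esub> b) \<odot>\<^bsub>M\<^esub> x = a \<odot>\<^bsub>M\<^esub> x \<oplus>\<^bsub>M\<^esub> b \<odot>\<^bsub>M\<^esub> x"
    and smult_r_distr:
      "\<lbrakk>a \<in> carrier R; x \<in> carrier M; y \<in> carrier M\<rbrakk> \<Longrightarrow>
        a \<odot>\<^bsub>M\<^esub> (x \<oplus>\<^bsub>M\<^esub> y) = a \<odot>\<^bsub>M\<^esub> x \<oplus>\<^bsub>M\<^esub> a \<odot>\<^bsub>M\<^esub> y"
    and smult_assoc:
      "\<lbrakk>a \<in> carrier R; b \<in> carrier R; x \<in> carrier M\<rbrakk> \<Longrightarrow>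
        (a \<otimes>\<^bsub>R\<^esub> b) \<odot>\<^bsub>M\<^esub> x = a \<odot>\<^bsub>M\<^esub> (b \<odot>\<^bsub>M\<^esub> x)"
    and smult_one:
      "x \<in> carrier M \<Longrightarrow> \<one>\<^bsub>R\<^esub> \<odot>\<^bsub>M\<^esub> x = x"

locale right_module = R?: ring R + M?: abelian_group M
  for R :: "('r, 'c) ring_scheme" (structure) and M :: "('r, 'm, 'd) module_scheme" (structure) +
  assumes smult_closed:
      "\<lbrakk>a \<in> carrier R; x \<in> carrier M\<rbrakk> \<Longrightarrow> a \<odot>\<^bsub>M\<^esub> x \<in> carrier M"
    and smult_l_distr:
      "\<lbrakk>a \<in> carrier R; b \<in> carrier R; x \<in> carrier M\<rbrakk> \<Longrightarrow>
        (a \<oplus>\<^bsub>R\<^esub> b) \<odot>\<^bsub>M\<^esub> x = a \<odot>\<^bsub>M\<^esub> x \<oplus>\<^bsub>M\<^esub> b \<odot>\<^bsub>M\<^esub> x"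
    and smult_r_distr:
      "\<lbrakk>a \<in> carrier R; x \<in> carrier M; y \<in> carrier M\<rbrakk> \<Longrightarrow>
        a \<odot>\<^bsub>M\<^esub> (x \<oplus>\<^bsub>M\<^esub> y) = a \<odot>\<^bsub>M\<^esub> x \<oplus>\<^bsub>M\<^esub> a \<odot>\<^bsub>M\<^esub> y"
    and smult_assoc:
      "\<lbrakk>a \<in> carrier R; b \<in> carrier R; x \<in> carrier M\<rbrakk> \<Longrightarrow>
        (a \<otimes>\<^bsub>R\<^esub> b) \<odot>\<^bsub>M\<^esub> x = b \<odot>\<^bsub>M\<^esub> (a \<odot>\<^bsub>M\<^esub> x)"
    and smult_one:
      "x \<in> carrier M \<Longrightarrow> \<one>\<^bsub>R\<^esub> \<odot>\<^bsub>M\<^esub> x = x"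

text \<open>Homomorphisms are extensional, so that equality of homomorphisms is equality on the
  carrier.  The same formula serves for left and for right modules.\<close>

definition mod_hom ::
  "('r, 'c) ring_scheme \<Rightarrow> ('r, 'm) module \<Rightarrow> ('r, 'n) module \<Rightarrow> ('m \<Rightarrow> 'n) set" where
  "mod_hom R M N =
    {f \<in> hom (add_monoid M) (add_monoid N) \<inter> extensional (carrier M).
      \<forall>a \<in> carrier R. \<forall>x \<in> carrier M. f (a \<odot>\<^bsub>M\<^esub> x) = a \<odot>\<^bsub>N\<^esub> f x}"

definition free_right_module :: "('r, 'c) ring_scheme \<Rightarrow> 'x set \<Rightarrow> ('r, 'x \<Rightarrow> 'r) module" where
  "free_right_module R X =
    \<lparr>carrier = {f. range f \<subseteq> carrier R \<and> finite {x. f x \<noteq> \<zero>\<^bsub>R\<^esub>} \<and> {x. f x \<noteq> \<zero>\<^bsub>R\<^esub>} \<subseteq> X},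
     mult = undefined, one = undefined,
     ring.zero = (\<lambda>x. \<zero>\<^bsub>R\<^esub>), add = (\<lambda>f g x. f x \<oplus>\<^bsub>R\<^esub> g x),
     smult = (\<lambda>a f x. f x \<otimes>\<^bsub>R\<^esub> a)\<rparr>"

text \<open>Projective means: direct summand of a free module.  Taking the basis \<open>X\<close> inside the type
  of the elements of \<open>P\<close> loses nothing, since a direct summand \<open>P\<close> of any free module is also a
  direct summand of the free module on the set \<open>carrier P\<close>.\<close>

definition projective_right_module :: "('r, 'c) ring_scheme \<Rightarrow> ('r, 'm) module \<Rightarrow> bool" where
  "projective_right_module R P \<longleftrightarrow> right_module R P \<and>
    (\<exists>(X :: 'm set) i p.
      i \<in> mod_hom R P (free_right_module R X) \<and> p \<in> mod_hom R (free_right_module R X) P \<and>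
      (\<forall>x \<in> carrier P. p (i x) = x))"

text \<open>The sequence \<open>\<cdots> \<rightarrow> P 2 \<rightarrow> P 1 \<rightarrow> P 0 \<rightarrow> M \<rightarrow> 0\<close> with \<open>d n : P (Suc n) \<rightarrow> P n\<close> and
  \<open>e : P 0 \<rightarrow> M\<close> is exact.\<close>

definition projective_resolution ::
  "('r, 'c) ring_scheme \<Rightarrow> ('r, 'a) module \<Rightarrow> (nat \<Rightarrow> ('r, 'm) module) \<Rightarrow>
    (nat \<Rightarrow> 'm \<Rightarrow> 'm) \<Rightarrow> ('m \<Rightarrow> 'a) \<Rightarrow> bool" where
  "projective_resolution R M P d e \<longleftrightarrow> right_module R M \<and>
    (\<forall>n. projective_right_module R (P n)) \<and>
    (\<forall>n. d n \<in> mod_hom R (P (Suc n)) (P n)) \<and>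
    e \<in> mod_hom R (P 0) M \<and>
    e ` carrier (P 0) = carrier M \<and>
    d 0 ` carrier (P (Suc 0)) = a_kernel (P 0) M e \<and>
    (\<forall>n. d (Suc n) ` carrier (P (Suc (Suc n))) = a_kernel (P (Suc n)) (P n) (d n))"

section \<open>Ext and Tor\<close>

text \<open>Homology at the middle term of \<open>A \<rightarrow> B \<rightarrow> C\<close>, with maps \<open>f\<close> and \<open>g\<close>.\<close>

definition homology_at ::
  "'a monoid \<Rightarrow> ('a \<Rightarrow> 'b) \<Rightarrow> 'b monoid \<Rightarrow> ('b \<Rightarrow> 'c) \<Rightarrow> 'c monoid \<Rightarrow> 'b set monoid" where
  "homology_at A f B g C = (B\<lparr>carrier := kernel B C g\<rparr>) Mod (f ` carrier A)"

definition hom_group ::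
  "('r, 'c) ring_scheme \<Rightarrow> ('r, 'm) module \<Rightarrow> ('r, 'n) module \<Rightarrow> ('m \<Rightarrow> 'n) monoid" where
  "hom_group R M N =
    \<lparr>carrier = mod_hom R M N,
     mult = (\<lambda>f g. \<lambda>x\<in>carrier M. f x \<oplus>\<^bsub>N\<^esub> g x),
     one = (\<lambda>x\<in>carrier M. \<zero>\<^bsub>N\<^esub>)\<rparr>"

text \<open>\<open>Ext\<^sup>n\<^sub>R(M, N)\<close>, computed from a projective resolution \<open>(P, d)\<close> of \<open>M\<close>.\<close>

fun Ext ::
  "('r, 'c) ring_scheme \<Rightarrow> (nat \<Rightarrow> ('r, 'm) module) \<Rightarrow> (nat \<Rightarrow> 'm \<Rightarrow> 'm) \<Rightarrow>
    ('r, 'n) module \<Rightarrow> nat \<Rightarrow> ('m \<Rightarrow> 'n) set monoid" where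
  "Ext R P d N 0 =
    (hom_group R (P 0) N)\<lparr>carrier := kernel (hom_group R (P 0) N) (hom_group R (P (Suc 0)) N)
      (\<lambda>f. compose (carrier (P (Suc 0))) f (d 0))\<rparr> Mod {\<one>\<^bsub>hom_group R (P 0) N\<^esub>}"
| "Ext R P d N (Suc n) =
    homology_at
      (hom_group R (P n) N) (\<lambda>f. compose (carrier (P (Suc n))) f (d n))
      (hom_group R (P (Suc n)) N) (\<lambda>f. compose (carrier (P (Suc (Suc n)))) f (d (Suc n)))
      (hom_group R (P (Suc (Suc n))) N)"

text \<open>The tensor product of a right module \<open>M\<close> and a left module \<open>N\<close>: the free abelian group on
  \<open>carrier M \<times> carrier N\<close> modulo the subgroup generated by the usual relations.\<close>

definition tensor_relations ::
  "('r, 'c) ring_scheme \<Rightarrow> ('r, 'm) module \<Rightarrow> ('r, 'n) module \<Rightarrow> ('m \<times> 'n \<Rightarrow>\<^sub>0 int) set" where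
  "tensor_relations R M N = generate (free_Abelian_group (carrier M \<times> carrier N))
    ({frag_of (x \<oplus>\<^bsub>M\<^esub> x', y) - frag_of (x, y) - frag_of (x', y) | x x' y.
        x \<in> carrier M \<and> x' \<in> carrier M \<and> y \<in> carrier N} \<union>
     {frag_of (x, y \<oplus>\<^bsub>N\<^esub> y') - frag_of (x, y) - frag_of (x, y') | x y y'.
        x \<in> carrier M \<and> y \<in> carrier N \<and> y' \<in> carrier N} \<union>
     {frag_of (a \<odot>\<^bsub>M\<^esub> x, y) - frag_of (x, a \<odot>\<^bsub>N\<^esub> y) | a x y.
        a \<in> carrier R \<and> x \<in> carrier M \<and> y \<in> carrier N})"

definition tensor ::
  "('r, 'c) ring_scheme \<Rightarrow> ('r, 'm) module \<Rightarrow> ('r, 'n) module \<Rightarrow> ('m \<times> 'n \<Rightarrow>\<^sub>0 int) set monoid" where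
  "tensor R M N = free_Abelian_group (carrier M \<times> carrier N) Mod tensor_relations R M N"

text \<open>For a homomorphism \<open>f : M \<rightarrow> M'\<close>, the map from \<open>M \<otimes> N\<close> to \<open>M' \<otimes> N\<close> sending
  \<open>x \<otimes> y\<close> to \<open>f x \<otimes> y\<close>: an element of \<open>M \<otimes> N\<close> is a coset \<open>C\<close>, and all its members have images in
  the same coset.\<close>

definition tensor_map ::
  "('r, 'c) ring_scheme \<Rightarrow> ('r, 'm) module \<Rightarrow> ('r, 'm') module \<Rightarrow> ('r, 'n) module \<Rightarrow> ('m \<Rightarrow> 'm') \<Rightarrow>
    ('m \<times> 'n \<Rightarrow>\<^sub>0 int) set \<Rightarrow> ('m' \<times> 'n \<Rightarrow>\<^sub>0 int) set" where
  "tensor_map R M M' N f C = the_elem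
    ((\<lambda>c. tensor_relations R M' N #>\<^bsub>free_Abelian_group (carrier M' \<times> carrier N)\<^esub>
        frag_extend (\<lambda>(x, y). frag_of (f x, y)) c) ` C)"

text \<open>\<open>Tor\<^sub>n\<close> of a right module \<open>M\<close> and a left module \<open>N\<close>, computed from a projective
  resolution \<open>(P, d)\<close> of \<open>M\<close>.\<close>

fun Tor ::
  "('r, 'c) ring_scheme \<Rightarrow> (nat \<Rightarrow> ('r, 'm) module) \<Rightarrow> (nat \<Rightarrow> 'm \<Rightarrow> 'm) \<Rightarrow>
    ('r, 'n) module \<Rightarrow> nat \<Rightarrow> ('m \<times> 'n \<Rightarrow>\<^sub>0 int) set set monoid" where
  "Tor R P d N 0 =
    tensor R (P 0) N Mod (tensor_map R (P (Suc 0)) (P 0) N (d 0) ` carrier (tensor R (P (Suc 0)) N))"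
| "Tor R P d N (Suc n) =
    homology_at
      (tensor R (P (Suc (Suc n))) N) (tensor_map R (P (Suc (Suc n))) (P (Suc n)) N (d (Suc n)))
      (tensor R (P (Suc n)) N) (tensor_map R (P (Suc n)) (P n) N (d n))
      (tensor R (P n) N)"

section \<open>Integral group cohomology and homology\<close>

definition group_ring :: "('g, 'c) monoid_scheme \<Rightarrow> ('g \<Rightarrow> int) ring" where
  "group_ring G =
    \<lparr>carrier = {a. finite {g. a g \<noteq> 0} \<and> {g. a g \<noteq> 0} \<subseteq> carrier G},
     mult = (\<lambda>a b x. if x \<in> carrier G
       then \<Sum>g | a g \<noteq> 0. a g * b (inv\<^bsub>G\<^esub> g \<otimes>\<^bsub>G\<^esub> x) else 0),
     one = (\<lambda>x. if x = \<one>\<^bsub>G\<^esub> then 1 else 0),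
     ring.zero = (\<lambda>x. 0), add = (\<lambda>a b x. a x + b x)\<rparr>"

text \<open>The group ring acts through the augmentation, that is, every group element acts as the
  identity.  This is both a left and a right module.\<close>

definition trivial_module :: "('g, 'c) monoid_scheme \<Rightarrow> ('g \<Rightarrow> int, int) module" where
  "trivial_module G =
    \<lparr>carrier = UNIV, mult = undefined, one = undefined, ring.zero = 0, add = (+),
     smult = (\<lambda>a k. (\<Sum>g | a g \<noteq> 0. a g) * k)\<rparr>"

text \<open>In the next two definitions \<open>(P, d)\<close> is meant to be a projective resolution of the
  trivial right module over the group ring.\<close>

definition group_cohomology ::
  "('g, 'c) monoid_scheme \<Rightarrow> (nat \<Rightarrow> ('g \<Rightarrow> int, 'm) module) \<Rightarrow> (nat \<Rightarrow> 'm \<Rightarrow> 'm) \<Rightarrow> nat \<Rightarrow>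
    ('m \<Rightarrow> int) set monoid" where
  "group_cohomology G P d n = Ext (group_ring G) P d (trivial_module G) n"

definition group_homology ::
  "('g, 'c) monoid_scheme \<Rightarrow> (nat \<Rightarrow> ('g \<Rightarrow> int, 'm) module) \<Rightarrow> (nat \<Rightarrow> 'm \<Rightarrow> 'm) \<Rightarrow> nat \<Rightarrow>
    ('m \<times> int \<Rightarrow>\<^sub>0 int) set set monoid" where
  "group_homology G P d n = Tor (group_ring G) P d (trivial_module G) n"

section \<open>Existence of projective resolutions\<close>

subsection \<open>The group ring is a ring, and the trivial module is a module\<close>

lemma ring_group_ring:
  fixes G (structure)
  assumes "group G" shows "ring (group_ring G)"
proof -
  interpret group G by fact
  let ?R = "group_ring G"
  let ?S = "\<lambda>a :: 'a \<Rightarrow> int. {g. a g \<noteq> 0}"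
  have mem: "a \<in> carrier ?R \<longleftrightarrow> finite (?S a) \<and> ?S a \<subseteq> carrier G" for a
    by (simp add: group_ring_def)
  have mul: "(a \<otimes>\<^bsub>?R\<^esub> b) x = (if x \<in> carrier G then \<Sum>g\<in>T. a g * b (inv g \<otimes> x) else 0)"
    if "finite T" "?S a \<subseteq> T" for a b x T
    using that by (auto simp: group_ring_def intro!: sum.mono_neutral_left)
  have mul_S: "?S (a \<otimes>\<^bsub>?R\<^esub> b) \<subseteq> (\<lambda>(g, h). g \<otimes> h) ` (?S a \<times> ?S b)"
    if a: "a \<in> carrier ?R" and b: "b \<in> carrier ?R" for a b
  proof
    fix x assume x: "x \<in> ?S (a \<otimes>\<^bsub>?R\<^esub> b)"
    have fa: "finite (?S a)" using a mem by auto
    from x have xG: "x \<in> carrier G" and "(\<Sum>g\<in>?S a. a g * b (inv g \<otimes> x)) \<noteq> 0"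
      using mul[OF fa order_refl, of b x] by (auto split: if_splits)
    then obtain g where g: "g \<in> ?S a" "a g * b (inv g \<otimes> x) \<noteq> 0"
      by (meson sum.neutral)
    then have "g \<in> carrier G" using a mem by auto
    then have "x = g \<otimes> (inv g \<otimes> x)" using xG by (simp add: m_assoc[symmetric])
    then show "x \<in> (\<lambda>(g, h). g \<otimes> h) ` (?S a \<times> ?S b)"
      using g by (auto intro!: image_eqI[of _ _ "(g, inv g \<otimes> x)"])
  qed
  have mulc: "a \<otimes>\<^bsub>?R\<^esub> b \<in> carrier ?R" if "a \<in> carrier ?R" "b \<in> carrier ?R" for a b
  proof -
    have "finite ((\<lambda>(g, h). g \<otimes> h) ` (?S a \<times> ?S b))"
      using that mem by auto
    moreover have "(\<lambda>(g, h). g \<otimes> h) ` (?S a \<times> ?S b) \<subseteq> carrier G"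
      using that mem by auto
    ultimately show ?thesis using mul_S[OF that] unfolding mem by (meson finite_subset order_trans)
  qed
  have onec: "\<one>\<^bsub>?R\<^esub> \<in> carrier ?R"
    by (auto simp: group_ring_def)
  have addc: "a \<oplus>\<^bsub>?R\<^esub> b \<in> carrier ?R" if "a \<in> carrier ?R" "b \<in> carrier ?R" for a b
  proof -
    have "?S (\<lambda>x. a x + b x) \<subseteq> ?S a \<union> ?S b" by auto
    then show ?thesis using that
      by (auto simp: group_ring_def intro: finite_subset[of _ "?S a \<union> ?S b"])
  qed
  have abel: "abelian_group ?R"
  proof (rule abelian_groupI)
    fix a assume "a \<in> carrier ?R"
    then show "\<exists>b\<in>carrier ?R. b \<oplus>\<^bsub>?R\<^esub> a = \<zero>\<^bsub>?R\<^esub>"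
      by (intro bexI[of _ "\<lambda>x. - a x"]) (auto simp: group_ring_def)
  qed (use addc in \<open>auto simp: group_ring_def add.assoc add.commute\<close>)
  have assoc: "(a \<otimes>\<^bsub>?R\<^esub> b) \<otimes>\<^bsub>?R\<^esub> c = a \<otimes>\<^bsub>?R\<^esub> (b \<otimes>\<^bsub>?R\<^esub> c)"
    if abc: "a \<in> carrier ?R" "b \<in> carrier ?R" "c \<in> carrier ?R" for a b c
  proof
    fix x
    let ?T = "(\<lambda>(g, h). g \<otimes> h) ` (?S a \<times> ?S b)"
    have fin: "finite (?S a)" "finite (?S b)" "finite ?T" using abc mem by auto
    have sub: "?S a \<subseteq> carrier G" "?S b \<subseteq> carrier G" "?T \<subseteq> carrier G" using abc mem by auto
    show "((a \<otimes>\<^bsub>?R\<^esub> b) \<otimes>\<^bsub>?R\<^esub> c) x = (a \<otimes>\<^bsub>?R\<^esub> (b \<otimes>\<^bsub>?R\<^esub> c)) x"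
    proof (cases "x \<in> carrier G")
      case False
      then show ?thesis by (simp add: group_ring_def)
    next
      case x: True
      have "((a \<otimes>\<^bsub>?R\<^esub> b) \<otimes>\<^bsub>?R\<^esub> c) x = (\<Sum>t\<in>?T. (a \<otimes>\<^bsub>?R\<^esub> b) t * c (inv t \<otimes> x))"
        using mul[OF fin(3) mul_S[OF abc(1,2)]] x by simp
      also have "\<dots> = (\<Sum>t\<in>?T. \<Sum>g\<in>?S a. a g * b (inv g \<otimes> t) * c (inv t \<otimes> x))"
        by (rule sum.cong) (use sub in \<open>auto simp: mul[OF fin(1) order_refl] sum_distrib_right\<close>)
      also have "\<dots> = (\<Sum>g\<in>?S a. \<Sum>t\<in>?T. a g * b (inv g \<otimes> t) * c (inv t \<otimes> x))"
        by (rule sum.swap)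
      also have "\<dots> = (\<Sum>g\<in>?S a. a g * (b \<otimes>\<^bsub>?R\<^esub> c) (inv g \<otimes> x))"
      proof (rule sum.cong[OF refl])
        fix g assume g: "g \<in> ?S a"
        then have gG: "g \<in> carrier G" using sub by auto
        have inj: "inj_on ((\<otimes>) g) (?S b)"
          proof (rule inj_onI)
            fix h k assume "h \<in> ?S b" "k \<in> ?S b" and eq: "g \<otimes> h = g \<otimes> k"
            then have "h \<in> carrier G" "k \<in> carrier G" using sub(2) by blast+
            then show "h = k" using Units_l_cancel[of g h k] gG eq by (simp add: Units_eq)
          qed
        have "(\<Sum>t\<in>?T. a g * b (inv g \<otimes> t) * c (inv t \<otimes> x))
          = (\<Sum>t\<in>(\<otimes>) g ` ?S b. a g * b (inv g \<otimes> t) * c (inv t \<otimes> x))"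
        proof (rule sum.mono_neutral_right[OF fin(3)])
          show "(\<otimes>) g ` ?S b \<subseteq> ?T" using g by auto
          show "\<forall>t\<in>?T - (\<otimes>) g ` ?S b. a g * b (inv g \<otimes> t) * c (inv t \<otimes> x) = 0"
          proof
            fix t assume t: "t \<in> ?T - (\<otimes>) g ` ?S b"
            then have "t \<in> carrier G" using sub by auto
            then have "g \<otimes> (inv g \<otimes> t) = t" using gG by (simp add: m_assoc[symmetric])
            then have "inv g \<otimes> t \<notin> ?S b" using t imageI[of "inv g \<otimes> t" "?S b" "(\<otimes>) g"] by auto
            then show "a g * b (inv g \<otimes> t) * c (inv t \<otimes> x) = 0" by simp
          qed
        qed
        also have "\<dots> = (\<Sum>h\<in>?S b. a g * b (inv g \<otimes> (g \<otimes> h)) * c (inv (g \<otimes> h) \<otimes> x))"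
          by (simp add: sum.reindex[OF inj])
        also have "\<dots> = (\<Sum>h\<in>?S b. a g * (b h * c (inv h \<otimes> (inv g \<otimes> x))))"
        proof (rule sum.cong[OF refl])
          fix h assume "h \<in> ?S b"
          then have h: "h \<in> carrier G" using sub by auto
          have 1: "inv g \<otimes> (g \<otimes> h) = h" using gG h by (simp add: m_assoc[symmetric])
          have 2: "inv (g \<otimes> h) \<otimes> x = inv h \<otimes> (inv g \<otimes> x)"
            using gG h x by (simp add: inv_mult_group m_assoc)
          show "a g * b (inv g \<otimes> (g \<otimes> h)) * c (inv (g \<otimes> h) \<otimes> x)
            = a g * (b h * c (inv h \<otimes> (inv g \<otimes> x)))"
            unfolding 1 2 by simp
        qed
        also have "\<dots> = a g * (b \<otimes>\<^bsub>?R\<^esub> c) (inv g \<otimes> x)"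
          using gG x by (simp add: mul[OF fin(2) order_refl] sum_distrib_left)
        finally show "(\<Sum>t\<in>?T. a g * b (inv g \<otimes> t) * c (inv t \<otimes> x))
          = a g * (b \<otimes>\<^bsub>?R\<^esub> c) (inv g \<otimes> x)" .
      qed
      also have "\<dots> = (a \<otimes>\<^bsub>?R\<^esub> (b \<otimes>\<^bsub>?R\<^esub> c)) x"
        using x by (simp add: mul[OF fin(1) order_refl])
      finally show ?thesis .
    qed
  qed
  have onel: "\<one>\<^bsub>?R\<^esub> \<otimes>\<^bsub>?R\<^esub> a = a" if "a \<in> carrier ?R" for a
  proof
    fix x
    have "?S \<one>\<^bsub>?R\<^esub> \<subseteq> {\<one>}" by (auto simp: group_ring_def)
    from mul[OF _ this, of a x] show "(\<one>\<^bsub>?R\<^esub> \<otimes>\<^bsub>?R\<^esub> a) x = a x"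
      using that unfolding mem by (auto simp: group_ring_def split: if_splits)
  qed
  have oner: "a \<otimes>\<^bsub>?R\<^esub> \<one>\<^bsub>?R\<^esub> = a" if a: "a \<in> carrier ?R" for a
  proof
    fix x
    show "(a \<otimes>\<^bsub>?R\<^esub> \<one>\<^bsub>?R\<^esub>) x = a x"
    proof (cases "x \<in> carrier G")
      case False
      then have "a x = 0" using a mem by auto
      with False show ?thesis by (simp add: group_ring_def)
    next
      case x: True
      have fin: "finite (?S a)" "?S a \<subseteq> carrier G" using a mem by auto
      have *: "inv g \<otimes> x = \<one> \<longleftrightarrow> g = x" if "g \<in> carrier G" for g
        
      proof
        assume "inv g \<otimes> x = \<one>"
        then have "g \<otimes> (inv g \<otimes> x) = g" using that by simp
        then show "g = x" using that x by (simp add: m_assoc[symmetric])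
      qed (use that in simp)
      have "(a \<otimes>\<^bsub>?R\<^esub> \<one>\<^bsub>?R\<^esub>) x = (\<Sum>g\<in>?S a. a g * (if inv g \<otimes> x = \<one> then 1 else 0))"
        using x by (simp add: group_ring_def)
      also have "\<dots> = (\<Sum>g\<in>?S a. if g = x then a g else 0)"
        by (rule sum.cong) (use fin * in auto)
      also have "\<dots> = a x" using fin by (simp add: sum.delta)
      finally show ?thesis .
    qed
  qed
  show ?thesis
  proof (rule ringI[OF abel])
    show "Group.monoid ?R" by (rule monoidI) (auto intro: mulc onec assoc onel oner)
  next
    fix a b c assume abc: "a \<in> carrier ?R" "b \<in> carrier ?R" "c \<in> carrier ?R"
    have fin: "finite (?S a \<union> ?S b)" using abc mem by auto
    have "?S (a \<oplus>\<^bsub>?R\<^esub> b) \<subseteq> ?S a \<union> ?S b" by (auto simp: group_ring_def)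
    then show "(a \<oplus>\<^bsub>?R\<^esub> b) \<otimes>\<^bsub>?R\<^esub> c = a \<otimes>\<^bsub>?R\<^esub> c \<oplus>\<^bsub>?R\<^esub> b \<otimes>\<^bsub>?R\<^esub> c"
      using mul[OF fin, of a c] mul[OF fin, of b c] mul[OF fin, of "a \<oplus>\<^bsub>?R\<^esub> b" c]
      by (intro ext) (auto simp: group_ring_def distrib_right sum.distrib)
    have "finite (?S c)" using abc mem by auto
    from mul[OF this order_refl]
    show "c \<otimes>\<^bsub>?R\<^esub> (a \<oplus>\<^bsub>?R\<^esub> b) = c \<otimes>\<^bsub>?R\<^esub> a \<oplus>\<^bsub>?R\<^esub> c \<otimes>\<^bsub>?R\<^esub> b"
      by (intro ext) (auto simp: group_ring_def distrib_left sum.distrib)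
  qed
qed

lemma augmentation_add:
  assumes "a \<in> carrier (group_ring G)" "b \<in> carrier (group_ring G)"
  shows "(\<Sum>g | (a \<oplus>\<^bsub>group_ring G\<^esub> b) g \<noteq> 0. (a \<oplus>\<^bsub>group_ring G\<^esub> b) g)
    = (\<Sum>g | a g \<noteq> 0. a g) + (\<Sum>g | b g \<noteq> 0. b g)"
proof -
  let ?T = "{g. a g \<noteq> 0} \<union> {g. b g \<noteq> 0}"
  have fin: "finite ?T" using assms by (auto simp: group_ring_def)
  have *: "(\<Sum>g | f g \<noteq> 0. f g) = sum f ?T" if "{g. f g \<noteq> 0} \<subseteq> ?T" for f :: "'a \<Rightarrow> int"
    by (rule sum.mono_neutral_left[OF fin that]) auto
  show ?thesis by (subst (1 2 3) *) (auto simp: group_ring_def sum.distrib)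
qed

lemma augmentation_mult:
  fixes G (structure)
  assumes "group G" and a: "a \<in> carrier (group_ring G)" and b: "b \<in> carrier (group_ring G)"
  shows "(\<Sum>g | (a \<otimes>\<^bsub>group_ring G\<^esub> b) g \<noteq> 0. (a \<otimes>\<^bsub>group_ring G\<^esub> b) g)
    = (\<Sum>g | a g \<noteq> 0. a g) * (\<Sum>g | b g \<noteq> 0. b g)"
proof -
  interpret group G by fact
  let ?S = "\<lambda>a :: 'a \<Rightarrow> int. {g. a g \<noteq> 0}"
  let ?T = "(\<lambda>(g, h). g \<otimes> h) ` (?S a \<times> ?S b)"
  let ?ab = "a \<otimes>\<^bsub>group_ring G\<^esub> b"
  have fin: "finite (?S a)" "finite (?S b)" "finite ?T"
    and sub: "?S a \<subseteq> carrier G" "?S b \<subseteq> carrier G" "?T \<subseteq> carrier G"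
    using a b by (auto simp: group_ring_def)
  have ab: "?ab x = (\<Sum>g\<in>?S a. a g * b (inv g \<otimes> x))" if "x \<in> carrier G" for x
    using that by (simp add: group_ring_def)
  have S: "?S ?ab \<subseteq> ?T"
  proof
    fix x assume x: "x \<in> ?S ?ab"
    then have xG: "x \<in> carrier G" by (auto simp: group_ring_def split: if_splits)
    with x ab have "(\<Sum>g\<in>?S a. a g * b (inv g \<otimes> x)) \<noteq> 0" by auto
    then obtain g where g: "g \<in> ?S a" "a g * b (inv g \<otimes> x) \<noteq> 0"
      by (meson sum.neutral)
    then have "g \<in> carrier G" using sub by auto
    then have "x = g \<otimes> (inv g \<otimes> x)" using xG by (simp add: m_assoc[symmetric])
    then show "x \<in> ?T"
      using g by (auto intro!: image_eqI[of _ _ "(g, inv g \<otimes> x)"])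
  qed
  have "(\<Sum>g\<in>?S ?ab. ?ab g) = (\<Sum>t\<in>?T. ?ab t)"
    by (rule sum.mono_neutral_left[OF fin(3) S]) auto
  also have "\<dots> = (\<Sum>t\<in>?T. \<Sum>g\<in>?S a. a g * b (inv g \<otimes> t))"
    by (rule sum.cong) (use ab sub in auto)
  also have "\<dots> = (\<Sum>g\<in>?S a. \<Sum>t\<in>?T. a g * b (inv g \<otimes> t))" by (rule sum.swap)
  also have "\<dots> = (\<Sum>g\<in>?S a. a g * (\<Sum>h\<in>?S b. b h))"
  proof (rule sum.cong[OF refl])
    fix g assume g: "g \<in> ?S a"
    then have gG: "g \<in> carrier G" using sub by auto
    have inj: "inj_on ((\<otimes>) g) (?S b)"
          proof (rule inj_onI)
            fix h k assume "h \<in> ?S b" "k \<in> ?S b" and eq: "g \<otimes> h = g \<otimes> k"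
            then have "h \<in> carrier G" "k \<in> carrier G" using sub(2) by blast+
            then show "h = k" using Units_l_cancel[of g h k] gG eq by (simp add: Units_eq)
          qed
    have "(\<Sum>t\<in>?T. a g * b (inv g \<otimes> t)) = (\<Sum>t\<in>(\<otimes>) g ` ?S b. a g * b (inv g \<otimes> t))"
    proof (rule sum.mono_neutral_right[OF fin(3)])
      show "(\<otimes>) g ` ?S b \<subseteq> ?T" using g by auto
      show "\<forall>t\<in>?T - (\<otimes>) g ` ?S b. a g * b (inv g \<otimes> t) = 0"
      proof
        fix t assume t: "t \<in> ?T - (\<otimes>) g ` ?S b"
        then have "t \<in> carrier G" using sub by auto
        then have "g \<otimes> (inv g \<otimes> t) = t" using gG by (simp add: m_assoc[symmetric])
        then have "inv g \<otimes> t \<notin> ?S b" using t imageI[of "inv g \<otimes> t" "?S b" "(\<otimes>) g"] by auto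
        then show "a g * b (inv g \<otimes> t) = 0" by simp
      qed
    qed
    also have "\<dots> = (\<Sum>h\<in>?S b. a g * b (inv g \<otimes> (g \<otimes> h)))"
      by (simp add: sum.reindex[OF inj])
    also have "\<dots> = (\<Sum>h\<in>?S b. a g * b h)"
    proof (rule sum.cong[OF refl])
      fix h assume "h \<in> ?S b"
      then have h: "h \<in> carrier G" using sub by auto
      have 1: "inv g \<otimes> (g \<otimes> h) = h" using gG h by (simp add: m_assoc[symmetric])
      show "a g * b (inv g \<otimes> (g \<otimes> h)) = a g * b h" unfolding 1 by simp
    qed
    finally show "(\<Sum>t\<in>?T. a g * b (inv g \<otimes> t)) = a g * (\<Sum>h\<in>?S b. b h)"
      by (simp add: sum_distrib_left)
  qed
  finally show ?thesis by (simp add: sum_distrib_right)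
qed

lemma augmentation_one: "(\<Sum>g | \<one>\<^bsub>group_ring G\<^esub> g \<noteq> 0. \<one>\<^bsub>group_ring G\<^esub> g) = 1"
  by (simp add: group_ring_def)

lemma abelian_group_trivial_module: "abelian_group (trivial_module G)"
proof (rule abelian_groupI)
  fix x assume "x \<in> carrier (trivial_module G)"
  show "\<exists>y\<in>carrier (trivial_module G). y \<oplus>\<^bsub>trivial_module G\<^esub> x = \<zero>\<^bsub>trivial_module G\<^esub>"
    by (intro bexI[of _ "- x"]) (auto simp: trivial_module_def)
qed (auto simp: trivial_module_def)

lemma trivial_module_simps:
  "carrier (trivial_module G) = UNIV" "x \<oplus>\<^bsub>trivial_module G\<^esub> y = x + y"
  "a \<odot>\<^bsub>trivial_module G\<^esub> x = (\<Sum>g | a g \<noteq> 0. a g) * x"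
  by (simp_all add: trivial_module_def)

lemma
  assumes "group G"
  shows left_module_trivial_module: "left_module (group_ring G) (trivial_module G)"
    and right_module_trivial_module: "right_module (group_ring G) (trivial_module G)"
  by (auto intro!: left_module.intro right_module.intro left_module_axioms.intro
      right_module_axioms.intro ring_group_ring abelian_group_trivial_module assms
      simp: trivial_module_simps augmentation_add augmentation_mult[OF assms] augmentation_one
        algebra_simps)

subsection \<open>Resolution by free modules of countable rank\<close>

lemma free_right_module_simps:
  "f \<in> carrier (free_right_module R X) \<longleftrightarrow>
    range f \<subseteq> carrier R \<and> finite {x. f x \<noteq> \<zero>\<^bsub>R\<^esub>} \<and> {x. f x \<noteq> \<zero>\<^bsub>R\<^esub>} \<subseteq> X"
  "\<zero>\<^bsub>free_right_module R X\<^esub> = (\<lambda>x. \<zero>\<^bsub>R\<^esub>)"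
  "f \<oplus>\<^bsub>free_right_module R X\<^esub> g = (\<lambda>x. f x \<oplus>\<^bsub>R\<^esub> g x)"
  "a \<odot>\<^bsub>free_right_module R X\<^esub> f = (\<lambda>x. f x \<otimes>\<^bsub>R\<^esub> a)"
  by (simp_all add: free_right_module_def)

lemma right_module_free_right_module:
  assumes "ring R" shows "right_module R (free_right_module R X)"
proof -
  interpret ring R by fact
  let ?F = "free_right_module R X"
  have mem: "f x \<in> carrier R" if "f \<in> carrier ?F" for f x
    using that by (auto simp: free_right_module_simps)
  have add: "f \<oplus>\<^bsub>?F\<^esub> g \<in> carrier ?F" if fg: "f \<in> carrier ?F" "g \<in> carrier ?F" for f g
  proof -
    have "{x. f x \<oplus>\<^bsub>R\<^esub> g x \<noteq> \<zero>\<^bsub>R\<^esub>} \<subseteq> {x. f x \<noteq> \<zero>\<^bsub>R\<^esub>} \<union> {x. g x \<noteq> \<zero>\<^bsub>R\<^esub>}"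
      by auto
    moreover have "finite ({x. f x \<noteq> \<zero>\<^bsub>R\<^esub>} \<union> {x. g x \<noteq> \<zero>\<^bsub>R\<^esub>})"
      "{x. f x \<noteq> \<zero>\<^bsub>R\<^esub>} \<union> {x. g x \<noteq> \<zero>\<^bsub>R\<^esub>} \<subseteq> X"
      using fg by (auto simp: free_right_module_simps)
    ultimately have "finite {x. f x \<oplus>\<^bsub>R\<^esub> g x \<noteq> \<zero>\<^bsub>R\<^esub>}" "{x. f x \<oplus>\<^bsub>R\<^esub> g x \<noteq> \<zero>\<^bsub>R\<^esub>} \<subseteq> X"
      by (meson finite_subset order_trans)+
    then show ?thesis using fg mem by (auto simp: free_right_module_simps)
  qed
  have smult: "a \<odot>\<^bsub>?F\<^esub> f \<in> carrier ?F" if "a \<in> carrier R" "f \<in> carrier ?F" for a f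
  proof -
    have sub: "{x. f x \<otimes>\<^bsub>R\<^esub> a \<noteq> \<zero>\<^bsub>R\<^esub>} \<subseteq> {x. f x \<noteq> \<zero>\<^bsub>R\<^esub>}"
      using that by auto
    moreover have "finite {x. f x \<noteq> \<zero>\<^bsub>R\<^esub>}" "{x. f x \<noteq> \<zero>\<^bsub>R\<^esub>} \<subseteq> X"
      using that by (auto simp: free_right_module_simps)
    ultimately have "finite {x. f x \<otimes>\<^bsub>R\<^esub> a \<noteq> \<zero>\<^bsub>R\<^esub>}" "{x. f x \<otimes>\<^bsub>R\<^esub> a \<noteq> \<zero>\<^bsub>R\<^esub>} \<subseteq> X"
      by (meson finite_subset order_trans)+
    then show ?thesis using that mem by (auto simp: free_right_module_simps)
  qed
  have "abelian_group ?F"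
  proof (rule abelian_groupI)
    fix f assume f: "f \<in> carrier ?F"
    have "(\<lambda>x. \<ominus>\<^bsub>R\<^esub> f x) \<in> carrier ?F"
    proof -
      have "{x. \<ominus>\<^bsub>R\<^esub> f x \<noteq> \<zero>\<^bsub>R\<^esub>} \<subseteq> {x. f x \<noteq> \<zero>\<^bsub>R\<^esub>}" by auto
      moreover have "finite {x. f x \<noteq> \<zero>\<^bsub>R\<^esub>}" "{x. f x \<noteq> \<zero>\<^bsub>R\<^esub>} \<subseteq> X"
        using f by (auto simp: free_right_module_simps)
      ultimately have "finite {x. \<ominus>\<^bsub>R\<^esub> f x \<noteq> \<zero>\<^bsub>R\<^esub>}" "{x. \<ominus>\<^bsub>R\<^esub> f x \<noteq> \<zero>\<^bsub>R\<^esub>} \<subseteq> X"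
        by (meson finite_subset order_trans)+
      then show ?thesis using f mem by (auto simp: free_right_module_simps)
    qed
    then show "\<exists>g\<in>carrier ?F. g \<oplus>\<^bsub>?F\<^esub> f = \<zero>\<^bsub>?F\<^esub>"
      using mem[OF f] by (intro bexI[of _ "\<lambda>x. \<ominus>\<^bsub>R\<^esub> f x"]) (auto simp: free_right_module_simps l_neg)
  next
    show "\<zero>\<^bsub>?F\<^esub> \<in> carrier ?F" by (auto simp: free_right_module_simps)
  next
    show "f \<oplus>\<^bsub>?F\<^esub> g = g \<oplus>\<^bsub>?F\<^esub> f" if "f \<in> carrier ?F" "g \<in> carrier ?F" for f g
      using that mem by (auto simp: free_right_module_simps(2-) a_comm)
  qed (use add mem in \<open>auto simp: free_right_module_simps(2-) a_assoc\<close>)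
  then show ?thesis
    by (intro right_module.intro right_module_axioms.intro assms)
      (use smult mem in \<open>auto simp: free_right_module_simps(2-) l_distr r_distr m_assoc\<close>)
qed

context right_module begin

lemma smult_zero_r: "a \<in> carrier R \<Longrightarrow> a \<odot>\<^bsub>M\<^esub> \<zero>\<^bsub>M\<^esub> = \<zero>\<^bsub>M\<^esub>"
  by (metis M.add.r_cancel_one' M.zero_closed M.l_zero smult_closed smult_r_distr)

lemma smult_zero_l: "x \<in> carrier M \<Longrightarrow> \<zero>\<^bsub>R\<^esub> \<odot>\<^bsub>M\<^esub> x = \<zero>\<^bsub>M\<^esub>"
  by (metis M.add.r_cancel_one' R.zero_closed R.l_zero smult_closed smult_l_distr)

lemma smult_finsum:
  assumes "finite A" "a \<in> carrier R" "f \<in> A \<rightarrow> carrier M"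
  shows "a \<odot>\<^bsub>M\<^esub> finsum M f A = finsum M (\<lambda>i. a \<odot>\<^bsub>M\<^esub> f i) A"
  using assms by (induction A) (auto simp: smult_zero_r smult_r_distr smult_closed Pi_iff)

end

text \<open>The linear extension of a map \<open>b\<close> on the basis.\<close>

definition lin :: "('r, 'c) ring_scheme \<Rightarrow> ('r, 'm) module \<Rightarrow> ('x \<Rightarrow> 'm) \<Rightarrow> ('x \<Rightarrow> 'r) \<Rightarrow> 'm" where
  "lin R M b = (\<lambda>f\<in>carrier (free_right_module R UNIV).
    finsum M (\<lambda>i. f i \<odot>\<^bsub>M\<^esub> b i) {i. f i \<noteq> \<zero>\<^bsub>R\<^esub>})"

lemma mod_homD:
  assumes "h \<in> mod_hom R M N"
  shows "x \<in> carrier M \<Longrightarrow> h x \<in> carrier N"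
    and "x \<in> carrier M \<Longrightarrow> y \<in> carrier M \<Longrightarrow> h (x \<oplus>\<^bsub>M\<^esub> y) = h x \<oplus>\<^bsub>N\<^esub> h y"
    and "a \<in> carrier R \<Longrightarrow> x \<in> carrier M \<Longrightarrow> h (a \<odot>\<^bsub>M\<^esub> x) = a \<odot>\<^bsub>N\<^esub> h x"
  using assms by (auto simp: mod_hom_def hom_def)

lemma mod_hom_zero:
  assumes "right_module R M" "right_module R N" "h \<in> mod_hom R M N"
  shows "h \<zero>\<^bsub>M\<^esub> = \<zero>\<^bsub>N\<^esub>"
proof -
  interpret M: right_module R M by fact
  interpret N: right_module R N by fact
  show ?thesis
    by (metis M.M.zero_closed M.R.zero_closed M.smult_zero_l N.smult_zero_l assms(3) mod_homD(1,3))
qed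

lemma mod_hom_finsum:
  assumes "right_module R M" "right_module R N" "h \<in> mod_hom R M N"
    and "finite A" "f \<in> A \<rightarrow> carrier M"
  shows "h (finsum M f A) = finsum N (\<lambda>i. h (f i)) A"
proof -
  interpret M: right_module R M by fact
  interpret N: right_module R N by fact
  show ?thesis using assms(4,5)
  proof induction
    case empty
    then show ?case by (simp add: mod_hom_zero[OF assms(1-3)])
  next
    case (insert i A)
    then show ?case by (auto simp: mod_homD[OF assms(3)] Pi_iff)
  qed
qed

lemma lin_superset:
  assumes "right_module R M" "\<And>i. b i \<in> carrier M" "f \<in> carrier (free_right_module R UNIV)"
    "finite T" "{i. f i \<noteq> \<zero>\<^bsub>R\<^esub>} \<subseteq> T"
  shows "lin R M b f = finsum M (\<lambda>i. f i \<odot>\<^bsub>M\<^esub> b i) T"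
proof -
  interpret right_module R M by fact
  have f: "f i \<in> carrier R" for i using assms(3) by (auto simp: free_right_module_simps)
  have "finsum M (\<lambda>i. f i \<odot>\<^bsub>M\<^esub> b i) {i. f i \<noteq> \<zero>\<^bsub>R\<^esub>} = finsum M (\<lambda>i. f i \<odot>\<^bsub>M\<^esub> b i) T"
    by (rule M.add.finprod_mono_neutral_cong_left)
      (use assms f in \<open>auto simp: smult_zero_l smult_closed\<close>)
  then show ?thesis using assms(3) by (simp add: lin_def)
qed

lemma lin_hom:
  fixes b :: "'x \<Rightarrow> 'm"
  assumes "right_module R M" "\<And>i. b i \<in> carrier M"
  shows "lin R M b \<in> mod_hom R (free_right_module R UNIV) M"
proof -
  interpret right_module R M by fact
  interpret F: right_module R "free_right_module R (UNIV :: 'x set)"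
    by (rule right_module_free_right_module[OF R.ring_axioms])
  let ?F = "free_right_module R (UNIV :: 'x set)"
  have mem: "f i \<in> carrier R" if "f \<in> carrier ?F" for f i
    using that by (auto simp: free_right_module_simps)
  have fin: "finite {i. f i \<noteq> \<zero>\<^bsub>R\<^esub>}" if "f \<in> carrier ?F" for f
    using that by (auto simp: free_right_module_simps)
  note sup = lin_superset[where b=b, OF assms]
  have "lin R M b f \<in> carrier M" if f: "f \<in> carrier ?F" for f
    using mem[OF f] by (subst sup[OF f fin[OF f] order_refl]) (auto intro!: M.finsum_closed smult_closed assms)
  moreover have "lin R M b (f \<oplus>\<^bsub>?F\<^esub> g) = lin R M b f \<oplus>\<^bsub>M\<^esub> lin R M b g"
    if f: "f \<in> carrier ?F" and g: "g \<in> carrier ?F" for f g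
  proof -
    let ?T = "{i. f i \<noteq> \<zero>\<^bsub>R\<^esub>} \<union> {i. g i \<noteq> \<zero>\<^bsub>R\<^esub>}"
    have T: "finite ?T" using f g fin by auto
    have "{i. (f \<oplus>\<^bsub>?F\<^esub> g) i \<noteq> \<zero>\<^bsub>R\<^esub>} \<subseteq> ?T" by (auto simp: free_right_module_simps)
    then have "lin R M b (f \<oplus>\<^bsub>?F\<^esub> g) = finsum M (\<lambda>i. (f \<oplus>\<^bsub>?F\<^esub> g) i \<odot>\<^bsub>M\<^esub> b i) ?T"
      using f g T by (intro sup) auto
    also have "\<dots> = finsum M (\<lambda>i. f i \<odot>\<^bsub>M\<^esub> b i \<oplus>\<^bsub>M\<^esub> g i \<odot>\<^bsub>M\<^esub> b i) ?T"
      using mem f g assms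
      by (intro M.finsum_cong') (auto simp: free_right_module_simps(2-) smult_l_distr smult_closed)
    also have "\<dots> = finsum M (\<lambda>i. f i \<odot>\<^bsub>M\<^esub> b i) ?T \<oplus>\<^bsub>M\<^esub> finsum M (\<lambda>i. g i \<odot>\<^bsub>M\<^esub> b i) ?T"
      using mem f g assms by (intro M.finsum_addf) (auto intro!: smult_closed)
    also have "\<dots> = lin R M b f \<oplus>\<^bsub>M\<^esub> lin R M b g"
      using f g T by (auto simp: sup[of _ ?T])
    finally show ?thesis .
  qed
  moreover have "lin R M b (a \<odot>\<^bsub>?F\<^esub> f) = a \<odot>\<^bsub>M\<^esub> lin R M b f"
    if a: "a \<in> carrier R" and f: "f \<in> carrier ?F" for a f
  proof -
    let ?T = "{i. f i \<noteq> \<zero>\<^bsub>R\<^esub>}"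
    have "{i. (a \<odot>\<^bsub>?F\<^esub> f) i \<noteq> \<zero>\<^bsub>R\<^esub>} \<subseteq> ?T" using a by (auto simp: free_right_module_simps)
    then have "lin R M b (a \<odot>\<^bsub>?F\<^esub> f) = finsum M (\<lambda>i. (a \<odot>\<^bsub>?F\<^esub> f) i \<odot>\<^bsub>M\<^esub> b i) ?T"
      using a f fin[OF f] by (intro sup F.smult_closed) auto
    also have "\<dots> = finsum M (\<lambda>i. a \<odot>\<^bsub>M\<^esub> (f i \<odot>\<^bsub>M\<^esub> b i)) ?T"
      using mem f a assms
      by (intro M.finsum_cong') (auto simp: free_right_module_simps(2-) smult_assoc intro!: smult_closed)
    also have "\<dots> = a \<odot>\<^bsub>M\<^esub> lin R M b f"
      using mem f a assms fin[OF f]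
      by (subst smult_finsum[symmetric]) (auto simp: sup[OF f fin[OF f] order_refl] intro!: smult_closed)
    finally show ?thesis .
  qed
  ultimately show ?thesis by (auto simp: mod_hom_def hom_def) (auto simp: lin_def)
qed

definition unit_vec :: "('r, 'c) ring_scheme \<Rightarrow> 'x \<Rightarrow> 'x \<Rightarrow> 'r" where
  "unit_vec R i = (\<lambda>j. if j = i then \<one>\<^bsub>R\<^esub> else \<zero>\<^bsub>R\<^esub>)"

lemma unit_vec_closed:
  assumes "ring R"
  shows "unit_vec R i \<in> carrier (free_right_module R UNIV)"
proof -
  interpret ring R by fact
  show ?thesis by (auto simp: free_right_module_simps unit_vec_def)
qed

lemma lin_unit_vec:
  assumes "right_module R M" "\<And>i. b i \<in> carrier M"
  shows "lin R M b (unit_vec R i) = b i"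
proof -
  interpret right_module R M by fact
  have "lin R M b (unit_vec R i) = finsum M (\<lambda>j. unit_vec R i j \<odot>\<^bsub>M\<^esub> b j) {i}"
    by (rule lin_superset[OF assms unit_vec_closed[OF R.ring_axioms]]) (auto simp: unit_vec_def)
  then show ?thesis using assms(2)[of i] by (simp add: unit_vec_def smult_one)
qed

lemma free_expansion:
  fixes f :: "'x \<Rightarrow> 'r"
  assumes "ring R" and f: "f \<in> carrier (free_right_module R UNIV)"
  shows "lin R (free_right_module R UNIV) (unit_vec R) f = f"
proof
  fix y :: 'x
  interpret ring R by fact
  let ?F = "free_right_module R (UNIV :: 'x set)"
  interpret F: right_module R ?F
    by (rule right_module_free_right_module[OF ring_axioms])
  have mem: "f i \<in> carrier R" for i using f by (auto simp: free_right_module_simps)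
  have eval: "finsum ?F g A y = finsum R (\<lambda>i. g i y) A" if "finite A" "g \<in> A \<rightarrow> carrier ?F" for g and A :: "'x set"
    using that
  proof induction
    case empty
    then show ?case by (simp add: free_right_module_simps(2-))
  next
    case (insert i A)
    then have "g j y \<in> carrier R" if "j \<in> insert i A" for j
      using that by (auto simp: free_right_module_simps(1) Pi_iff image_subset_iff)
    with insert show ?case by (auto simp: free_right_module_simps(2-) Pi_iff)
  qed
  let ?T = "insert y {i. f i \<noteq> \<zero>\<^bsub>R\<^esub>}"
  have T: "finite ?T" using f by (auto simp: free_right_module_simps)
  note uc = unit_vec_closed[OF assms(1)]
  have "lin R ?F (unit_vec R) f y = finsum ?F (\<lambda>i. f i \<odot>\<^bsub>?F\<^esub> unit_vec R i) ?T y"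
    by (subst lin_superset[OF F.right_module_axioms uc f T]) auto
  also have "\<dots> = finsum R (\<lambda>i. (f i \<odot>\<^bsub>?F\<^esub> unit_vec R i) y) ?T"
    by (rule eval[OF T]) (auto intro!: F.smult_closed uc mem)
  also have "\<dots> = finsum R (\<lambda>i. if y = i then f i else \<zero>\<^bsub>R\<^esub>) ?T"
    by (rule finsum_cong') (use mem in \<open>auto simp: free_right_module_simps(2-) unit_vec_def\<close>)
  also have "\<dots> = f y"
    by (rule add.finprod_singleton) (use mem T in auto)
  finally show "lin R ?F (unit_vec R) f y = f y" .
qed

lemma projective_free_right_module:
  assumes "ring R"
  shows "projective_right_module R (free_right_module R (UNIV :: 'x set))"
proof -
  interpret ring R by fact
  let ?F = "free_right_module R (UNIV :: 'x set)"
  let ?E = "free_right_module R (UNIV :: ('x \<Rightarrow> 'a) set)"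
  have F: "right_module R ?F" and E: "right_module R ?E"
    by (rule right_module_free_right_module[OF ring_axioms])+
  interpret F: right_module R ?F by fact
  let ?i = "lin R ?E (\<lambda>x. unit_vec R (unit_vec R x))"
  let ?p = "lin R ?F (\<lambda>f. if f \<in> carrier ?F then f else \<zero>\<^bsub>?F\<^esub>)"
  note uc = unit_vec_closed[OF ring_axioms]
  have i: "?i \<in> mod_hom R ?F ?E" by (rule lin_hom[OF E uc])
  have p: "?p \<in> mod_hom R ?E ?F" by (rule lin_hom[OF F]) auto
  have "?p (?i f) = f" if f: "f \<in> carrier ?F" for f
  proof -
    let ?T = "{i. f i \<noteq> \<zero>\<^bsub>R\<^esub>}"
    have mem: "f i \<in> carrier R" for i using f by (auto simp: free_right_module_simps)
    have T: "finite ?T" using f by (auto simp: free_right_module_simps)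
    have "?p (?i f) = ?p (finsum ?E (\<lambda>x. f x \<odot>\<^bsub>?E\<^esub> unit_vec R (unit_vec R x)) ?T)"
      by (subst lin_superset[OF E uc f T order_refl]) auto
    also have "\<dots> = finsum ?F (\<lambda>x. ?p (f x \<odot>\<^bsub>?E\<^esub> unit_vec R (unit_vec R x))) ?T"
      by (rule mod_hom_finsum[OF E F p T]) (auto intro!: right_module.smult_closed[OF E] uc mem)
    also have "\<dots> = finsum ?F (\<lambda>x. f x \<odot>\<^bsub>?F\<^esub> unit_vec R x) ?T"
    proof (rule F.M.finsum_cong')
      fix x
      have "?p (unit_vec R (unit_vec R x)) = unit_vec R x"
        by (subst lin_unit_vec[OF F]) (auto simp: uc)
      then show "?p (f x \<odot>\<^bsub>?E\<^esub> unit_vec R (unit_vec R x)) = f x \<odot>\<^bsub>?F\<^esub> unit_vec R x"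
        using mod_homD(3)[OF p mem uc] by simp
    qed (auto intro!: F.smult_closed uc mem)
    also have "\<dots> = lin R ?F (unit_vec R) f"
      by (rule lin_superset[OF F uc f T order_refl, symmetric])
    finally show ?thesis using free_expansion[OF ring_axioms f] by simp
  qed
  with i p F show ?thesis unfolding projective_right_module_def by blast
qed

lemma lin_image:
  assumes "right_module R M" "range b = K" "K \<subseteq> carrier M"
    and K: "\<zero>\<^bsub>M\<^esub> \<in> K" "\<And>x y. x \<in> K \<Longrightarrow> y \<in> K \<Longrightarrow> x \<oplus>\<^bsub>M\<^esub> y \<in> K"
      "\<And>a x. a \<in> carrier R \<Longrightarrow> x \<in> K \<Longrightarrow> a \<odot>\<^bsub>M\<^esub> x \<in> K"
  shows "lin R M b ` carrier (free_right_module R UNIV) = K"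
proof -
  interpret right_module R M by fact
  have b: "b i \<in> carrier M" for i using assms by auto
  have fin: "finsum M g A \<in> K" if "finite A" "g \<in> A \<rightarrow> K" for g A
    using that
  proof induction
    case (insert i A)
    then have "g \<in> A \<rightarrow> carrier M" "g i \<in> carrier M" using assms(3) by auto
    with insert K(2) show ?case by auto
  qed (use K in auto)
  show ?thesis
  proof (intro equalityI subsetI)
    fix x assume "x \<in> K"
    then obtain i where "x = b i" using assms(2) by auto
    moreover have "lin R M b (unit_vec R i) = b i"
      by (rule lin_unit_vec[OF assms(1) b])
    moreover have "lin R M b (unit_vec R i) \<in> lin R M b ` carrier (free_right_module R UNIV)"
      by (rule imageI) (rule unit_vec_closed[OF R.ring_axioms])
    ultimately show "x \<in> lin R M b ` carrier (free_right_module R UNIV)"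
      by (simp only:)
  next
    fix x assume "x \<in> lin R M b ` carrier (free_right_module R UNIV)"
    then obtain f where f: "f \<in> carrier (free_right_module R UNIV)" "x = lin R M b f" by auto
    then have x: "x = finsum M (\<lambda>i. f i \<odot>\<^bsub>M\<^esub> b i) {i. f i \<noteq> \<zero>\<^bsub>R\<^esub>}"
      by (simp add: lin_def)
    have "f i \<in> carrier R" "b i \<in> K" for i
      using f(1) assms(2) by (auto simp: free_right_module_simps(1))
    moreover have "finite {i. f i \<noteq> \<zero>\<^bsub>R\<^esub>}"
      using f(1) by (simp add: free_right_module_simps(1))
    ultimately show "x \<in> K"
      unfolding x by (intro fin) (simp_all add: K(3))
  qed
qed

lemma countable_free_right_module:
  assumes "countable (carrier R)"
  shows "countable (carrier (free_right_module R (UNIV :: nat set)))"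
proof (rule countable_subset)
  let ?h = "\<lambda>l i. if i < length l then l ! i else \<zero>\<^bsub>R\<^esub>"
  show "carrier (free_right_module R UNIV) \<subseteq> ?h ` lists (carrier R)"
  proof
    fix f :: "nat \<Rightarrow> 'a" assume f: "f \<in> carrier (free_right_module R UNIV)"
    then have "finite {i. f i \<noteq> \<zero>\<^bsub>R\<^esub>}" by (auto simp: free_right_module_simps)
    then obtain n where "\<forall>i\<in>{i. f i \<noteq> \<zero>\<^bsub>R\<^esub>}. i < n" using finite_nat_set_iff_bounded by blast
    then have "f = ?h (map f [0..<n])" by (auto simp: fun_eq_iff)
    moreover have "map f [0..<n] \<in> lists (carrier R)" using f by (auto simp: free_right_module_simps image_subset_iff)
    ultimately show "f \<in> ?h ` lists (carrier R)" by blast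
  qed
qed (use assms in auto)

lemma a_kernel_submodule:
  assumes M: "right_module R M" and N: "right_module R N" and h: "h \<in> mod_hom R M N"
  shows "\<zero>\<^bsub>M\<^esub> \<in> a_kernel M N h"
    and "\<lbrakk>x \<in> a_kernel M N h; y \<in> a_kernel M N h\<rbrakk> \<Longrightarrow> x \<oplus>\<^bsub>M\<^esub> y \<in> a_kernel M N h"
    and "\<lbrakk>a \<in> carrier R; x \<in> a_kernel M N h\<rbrakk> \<Longrightarrow> a \<odot>\<^bsub>M\<^esub> x \<in> a_kernel M N h"
proof -
  interpret M: right_module R M by fact
  interpret N: right_module R N by fact
  show "\<zero>\<^bsub>M\<^esub> \<in> a_kernel M N h"
    by (simp add: a_kernel_def kernel_def mod_hom_zero[OF assms])
  show "\<lbrakk>x \<in> a_kernel M N h; y \<in> a_kernel M N h\<rbrakk> \<Longrightarrow> x \<oplus>\<^bsub>M\<^esub> y \<in> a_kernel M N h"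
    by (simp add: a_kernel_def kernel_def mod_homD[OF h])
  show "\<lbrakk>a \<in> carrier R; x \<in> a_kernel M N h\<rbrakk> \<Longrightarrow> a \<odot>\<^bsub>M\<^esub> x \<in> a_kernel M N h"
    by (simp add: a_kernel_def kernel_def mod_homD[OF h] M.smult_closed N.smult_zero_r)
qed

theorem ex_projective_resolution:
  fixes R :: "('r, 'c) ring_scheme"
  assumes M: "right_module R M" and R: "countable (carrier R)" "countable (carrier M)"
  obtains P :: "nat \<Rightarrow> ('r, nat \<Rightarrow> 'r) module" and d e where "projective_resolution R M P d e"
proof -
  interpret right_module R M by fact
  define F where "F = free_right_module R (UNIV :: nat set)"
  have F: "right_module R F" unfolding F_def by (rule right_module_free_right_module[OF R.ring_axioms])
  have PF: "projective_right_module R F"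
    unfolding F_def by (rule projective_free_right_module[OF R.ring_axioms])
  have cF: "countable (carrier F)" unfolding F_def by (rule countable_free_right_module[OF R(1)])
  have cov: "lin R N (from_nat_into K) \<in> mod_hom R F N" "lin R N (from_nat_into K) ` carrier F = K"
    if N: "right_module R N" and K: "K \<subseteq> carrier N" "countable K" "\<zero>\<^bsub>N\<^esub> \<in> K"
      "\<And>x y. x \<in> K \<Longrightarrow> y \<in> K \<Longrightarrow> x \<oplus>\<^bsub>N\<^esub> y \<in> K"
      "\<And>a x. a \<in> carrier R \<Longrightarrow> x \<in> K \<Longrightarrow> a \<odot>\<^bsub>N\<^esub> x \<in> K"
    for N :: "('r, 'n) module" and K
  proof -
    have r: "range (from_nat_into K) = K" using K(2,3) by (intro range_from_nat_into) auto
    show "lin R N (from_nat_into K) ` carrier F = K"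
      unfolding F_def by (rule lin_image[OF N r K(1,3,4,5)])
    show "lin R N (from_nat_into K) \<in> mod_hom R F N"
      unfolding F_def using r K(1) by (intro lin_hom[OF N]) blast
  qed
  have ker: "lin R F (from_nat_into (a_kernel F N h)) \<in> mod_hom R F F"
      "lin R F (from_nat_into (a_kernel F N h)) ` carrier F = a_kernel F N h"
    if N: "right_module R N" and h: "h \<in> mod_hom R F N" for N :: "('r, 'n) module" and h
  proof -
    have "a_kernel F N h \<subseteq> carrier F" by (auto simp: a_kernel_def kernel_def)
    note K = this countable_subset[OF this cF] a_kernel_submodule[OF F N h]
    show "lin R F (from_nat_into (a_kernel F N h)) \<in> mod_hom R F F"
      by (rule cov(1)[OF F K])
    show "lin R F (from_nat_into (a_kernel F N h)) ` carrier F = a_kernel F N h"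
      by (rule cov(2)[OF F K])
  qed
  define e where "e = lin R M (from_nat_into (carrier M))"
  note covM = cov[OF M order_refl R(2)]
  have e: "e \<in> mod_hom R F M" "e ` carrier F = carrier M"
    unfolding e_def
    by (rule covM, simp, simp, simp add: smult_closed)+
  define d where "d = rec_nat (lin R F (from_nat_into (a_kernel F M e)))
    (\<lambda>_ h. lin R F (from_nat_into (a_kernel F F h)))"
  have d: "d n \<in> mod_hom R F F" for n
  proof (induction n)
    case 0
    show ?case using ker(1)[OF M e(1)] by (simp add: d_def)
  next
    case (Suc n)
    show ?case using ker(1)[OF F Suc] by (simp add: d_def)
  qed
  have d0: "d 0 ` carrier F = a_kernel F M e" using ker(2)[OF M e(1)] by (simp add: d_def)
  have dS: "d (Suc n) ` carrier F = a_kernel F F (d n)" for n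
    using ker(2)[OF F d[of n]] unfolding d_def by simp
  have "projective_resolution R M (\<lambda>_. F) d e"
    unfolding projective_resolution_def by (intro conjI allI M PF d e d0 dS)
  then show thesis by (rule that)
qed

text \<open>For a finite group the trivial module has a projective resolution, already with all modules
  carried by the following type.\<close>

corollary ex_projective_resolution_trivial_module:
  fixes G :: "('g, 'c) monoid_scheme"
  assumes G: "group G" "finite (carrier G)"
  obtains P :: "nat \<Rightarrow> ('g \<Rightarrow> int, nat \<Rightarrow> 'g \<Rightarrow> int) module" and d e
  where "projective_resolution (group_ring G) (trivial_module G) P d e"
proof -
  obtain xs where xs: "set xs = carrier G"
    using finite_list[OF G(2)] by blast
  have "inj_on (\<lambda>a. map a xs) (carrier (group_ring G))"
  proof (rule inj_onI)
    fix a b assume ab: "a \<in> carrier (group_ring G)" "b \<in> carrier (group_ring G)"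
      and "map a xs = map b xs"
    then have eq: "a x = b x" if "x \<in> carrier G" for x using that xs by simp
    show "a = b"
    proof
      fix x
      have "a x = 0" "b x = 0" if "x \<notin> carrier G" using ab that by (auto simp: group_ring_def)
      with eq show "a x = b x" by (cases "x \<in> carrier G") simp_all
    qed
  qed
  then have "countable (carrier (group_ring G))"
    by (rule countable_image_inj_on[rotated]) (rule countableI_type)
  moreover have "countable (carrier (trivial_module G))"
    by (rule countableI_type)
  ultimately show thesis
    using ex_projective_resolution[OF right_module_trivial_module[OF G(1)]] that by metis
qed

end

theory Submission
  imports Defs "HOL-Algebra.Multiplicative_Group" "Jordan_Normal_Form.Determinant"
begin

hide_const (open) Polynomial.order Modules.module Matrix.unit_vec

text \<open>Homology and cohomology may be computed from the bar resolution.  There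
  \<open>H\<^sup>2\<^sup>m\<close> is the torsion of the cokernel of the integral coboundary matrix \<open>B\<close> in
  degree \<open>2 m - 1\<close>, and \<open>H\<^sub>2\<^sub>m\<^sub>-\<^sub>1\<close> is that of its transpose.  A diagonal form \<open>U B V\<close> with
  nonzero entries \<open>\<delta>\<^sub>1, \<dots>, \<delta>\<^sub>\<rho>\<close> shows that both have order \<open>\<bar>\<delta>\<^sub>1 \<cdots> \<delta>\<^sub>\<rho>\<bar>\<close>.

  The matrix \<open>B\<close> is the value at the trivial character of a matrix over the group ring, whose value
  at a linear character \<open>\<chi>\<close> is the coboundary matrix with twisted coefficients.  The twisted complex is
  exact for nontrivial \<open>\<chi>\<close>, whereas the untwisted rational one has homology of rank one in degree
  \<open>0\<close>; hence the rank in an odd degree drops to \<open>\<rho> - 1\<close> for nontrivial \<open>\<chi>\<close>.  So the leading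
  \<open>\<rho> \<times> \<rho>\<close> minor of \<open>U B V\<close>, regarded as an element of the integral group ring of \<open>G/G'\<close>, vanishes
  at all nontrivial characters.  It is therefore an integral multiple of the norm element, and its
  value \<open>\<delta>\<^sub>1 \<cdots> \<delta>\<^sub>\<rho>\<close> at the trivial character is a multiple of \<open>|G/G'|\<close>.\<close>

section \<open>Comparison of projective resolutions\<close>

text \<open>Exactness and ranks both come from one averaged contraction. Prepending a fixed group
  element to a list contracts the complex but breaks equivariance; summing over all group elements
  restores it at the price of a factor |G|. This gives, for every character, a homotopy between |G|
  and 0 in positive degrees. Hence cohomology there is killed by |G| and is all torsion, and |G|
  times the rank of a coboundary is the trace of its product with the homotopy matrix. Traces of the
  homotopy identity form a recursion over the degrees that depends on the character only through its
  initial term, |G| minus the sum of the character values. So the traces for a nontrivial and for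
  the trivial character differ by |G|, with a sign alternating with the degree; the rank drops in
  odd degrees. The matrices U and V are integral, chosen at the trivial character and kept fixed
  while the character varies; this keeps the minor an integral combination of character values. Ext
  and Tor refer to arbitrary resolutions on arbitrary types. As orders are compared, bijections
  between sets of classes are transported along chain maps.\<close>

lemma mod_hom_eqI:
  assumes "f \<in> mod_hom R M N" "g \<in> mod_hom R M N" "\<And>x. x \<in> carrier M \<Longrightarrow> f x = g x"
  shows "f = g"
  using assms by (intro extensionalityI[of f "carrier M" g]) (auto simp: mod_hom_def)

lemma mod_homI:
  assumes "\<And>x. x \<in> carrier M \<Longrightarrow> f x \<in> carrier N"
    and "\<And>x y. x \<in> carrier M \<Longrightarrow> y \<in> carrier M \<Longrightarrow> f (x \<oplus>\<^bsub>M\<^esub> y) = f x \<oplus>\<^bsub>N\<^esub> f y"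
    and "\<And>a x. a \<in> carrier R \<Longrightarrow> x \<in> carrier M \<Longrightarrow> f (a \<odot>\<^bsub>M\<^esub> x) = a \<odot>\<^bsub>N\<^esub> f x"
    and "f \<in> extensional (carrier M)"
  shows "f \<in> mod_hom R M N"
  using assms by (auto simp: mod_hom_def hom_def)

lemma mod_hom_restrictI:
  assumes "right_module R M"
    and "\<And>x. x \<in> carrier M \<Longrightarrow> f x \<in> carrier N"
    and "\<And>x y. x \<in> carrier M \<Longrightarrow> y \<in> carrier M \<Longrightarrow> f (x \<oplus>\<^bsub>M\<^esub> y) = f x \<oplus>\<^bsub>N\<^esub> f y"
    and "\<And>a x. a \<in> carrier R \<Longrightarrow> x \<in> carrier M \<Longrightarrow> f (a \<odot>\<^bsub>M\<^esub> x) = a \<odot>\<^bsub>N\<^esub> f x"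
  shows "restrict f (carrier M) \<in> mod_hom R M N"
proof -
  interpret right_module R M by fact
  show ?thesis using assms(2-) by (intro mod_homI) (auto simp: smult_closed)
qed

lemma mod_hom_compose:
  assumes "right_module R M" "f \<in> mod_hom R M N" "g \<in> mod_hom R N L"
  shows "compose (carrier M) g f \<in> mod_hom R M L"
  unfolding compose_def
  by (rule mod_hom_restrictI) (simp_all add: assms(1) mod_homD[OF assms(2)] mod_homD[OF assms(3)])

lemma mod_hom_minus:
  assumes "right_module R M" "right_module R N" "h \<in> mod_hom R M N" "x \<in> carrier M" "y \<in> carrier M"
  shows "h (x \<ominus>\<^bsub>M\<^esub> y) = h x \<ominus>\<^bsub>N\<^esub> h y"
proof -
  interpret M: right_module R M by fact
  interpret N: right_module R N by fact
  note h = mod_homD[OF assms(3)]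
  have "h (x \<ominus>\<^bsub>M\<^esub> y) \<oplus>\<^bsub>N\<^esub> h y = h x"
    using assms(4,5) by (simp add: h(2)[symmetric] M.minus_eq M.a_assoc M.l_neg)
  then show ?thesis
    using assms(4,5) h(1) by (metis M.M.minus_closed N.M.add.inv_solve_right N.M.minus_eq)
qed

lemma (in right_module) smult_minus:
  assumes "a \<in> carrier R" "x \<in> carrier M" "y \<in> carrier M"
  shows "a \<odot>\<^bsub>M\<^esub> (x \<ominus>\<^bsub>M\<^esub> y) = a \<odot>\<^bsub>M\<^esub> x \<ominus>\<^bsub>M\<^esub> a \<odot>\<^bsub>M\<^esub> y"
proof -
  have "a \<odot>\<^bsub>M\<^esub> (x \<ominus>\<^bsub>M\<^esub> y) \<oplus>\<^bsub>M\<^esub> a \<odot>\<^bsub>M\<^esub> y = a \<odot>\<^bsub>M\<^esub> x"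
    using assms by (simp add: smult_r_distr[symmetric] M.minus_eq M.a_assoc M.l_neg)
  then show ?thesis
    using assms smult_closed by (metis M.minus_closed M.add.inv_solve_right M.minus_eq)
qed

lemma (in abelian_group) minus_add_distrib:
  assumes "x \<in> carrier G" "y \<in> carrier G" "u \<in> carrier G" "v \<in> carrier G"
  shows "(x \<oplus> y) \<ominus> (u \<oplus> v) = (x \<ominus> u) \<oplus> (y \<ominus> v)"
  using assms by (simp add: minus_eq minus_add a_ac)

lemma (in abelian_group) minus_add_cancel:
  assumes "x \<in> carrier G" "y \<in> carrier G"
  shows "(x \<ominus> y) \<oplus> y = x" "y \<oplus> (x \<ominus> y) = x" "x \<oplus> y \<ominus> y = x"
proof -
  show "(x \<ominus> y) \<oplus> y = x" and "x \<oplus> y \<ominus> y = x"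
    using assms by (simp_all add: minus_eq a_assoc l_neg r_neg)
  then show "y \<oplus> (x \<ominus> y) = x"
    using assms by (simp add: a_comm)
qed

lemma mod_hom_diff:
  assumes "right_module R M" "right_module R N" "f \<in> mod_hom R M N" "g \<in> mod_hom R M N"
  shows "(\<lambda>x\<in>carrier M. f x \<ominus>\<^bsub>N\<^esub> g x) \<in> mod_hom R M N"
proof -
  interpret N: right_module R N by fact
  note fg = mod_homD[OF assms(3)] mod_homD[OF assms(4)]
  show ?thesis
    by (rule mod_hom_restrictI[OF assms(1)]) (simp_all add: fg N.M.minus_add_distrib N.smult_minus)
qed

lemma mod_hom_free_eqI:
  fixes f g :: "('x \<Rightarrow> 'r) \<Rightarrow> 'm"
  assumes "right_module R M"
    and f: "f \<in> mod_hom R (free_right_module R UNIV) M"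
    and g: "g \<in> mod_hom R (free_right_module R UNIV) M"
    and eq: "\<And>y. f (unit_vec R y) = g (unit_vec R y)"
  shows "f = g"
proof (rule mod_hom_eqI[OF f g])
  interpret M: right_module R M by fact
  let ?F = "free_right_module R (UNIV :: 'x set)"
  have F: "right_module R ?F" by (rule right_module_free_right_module[OF M.R.ring_axioms])
  interpret F: right_module R ?F by fact
  fix x assume x: "x \<in> carrier ?F"
  note uc = unit_vec_closed[OF M.R.ring_axioms]
  let ?T = "{i. x i \<noteq> \<zero>\<^bsub>R\<^esub>}"
  have T: "finite ?T" and mem: "\<And>i. x i \<in> carrier R"
    using x by (auto simp: free_right_module_simps)
  have ex: "x = finsum ?F (\<lambda>i. x i \<odot>\<^bsub>?F\<^esub> unit_vec R i) ?T"
    using free_expansion[OF M.R.ring_axioms x] lin_superset[OF F uc x T order_refl] by simp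
  have *: "h x = finsum M (\<lambda>i. x i \<odot>\<^bsub>M\<^esub> h (unit_vec R i)) ?T"
    if h: "h \<in> mod_hom R ?F M" for h
  proof -
    have "h x = finsum M (\<lambda>i. h (x i \<odot>\<^bsub>?F\<^esub> unit_vec R i)) ?T"
      by (subst ex, rule mod_hom_finsum[OF F assms(1) h T])
        (auto intro!: F.smult_closed uc mem)
    also have "\<dots> = finsum M (\<lambda>i. x i \<odot>\<^bsub>M\<^esub> h (unit_vec R i)) ?T"
      by (rule M.M.finsum_cong')
        (auto simp: mod_homD(3)[OF h mem uc] intro!: M.smult_closed mem mod_homD(1)[OF h] uc)
    finally show ?thesis .
  qed
  show "f x = g x" unfolding *[OF f] *[OF g] eq ..
qed

text \<open>Linear extensions are defined on the free module over a whole type, so the basis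
  \<open>X\<close> is enlarged to \<open>UNIV\<close>: the section \<open>i\<close> stays as it is,
  and the retraction first sets the coordinates outside \<open>X\<close> to zero
  (\<open>?r\<close>).\<close>

lemma projective_summand_UNIV:
  fixes P :: "('r, 'p) module"
  assumes "projective_right_module R P"
  shows "\<exists>i \<in> mod_hom R P (free_right_module R (UNIV :: 'p set)).
    \<exists>p \<in> mod_hom R (free_right_module R (UNIV :: 'p set)) P. \<forall>x \<in> carrier P. p (i x) = x"
proof -
  from assms obtain X :: "'p set" and i p where P: "right_module R P"
    and i: "i \<in> mod_hom R P (free_right_module R X)"
    and p: "p \<in> mod_hom R (free_right_module R X) P"
    and pi: "\<And>x. x \<in> carrier P \<Longrightarrow> p (i x) = x"
    unfolding projective_right_module_def by blast
  interpret P: right_module R P by fact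
  let ?F = "free_right_module R (UNIV :: 'p set)" and ?E = "free_right_module R X"
  let ?r = "\<lambda>f x. if x \<in> X then f x else \<zero>\<^bsub>R\<^esub>"
  have F: "right_module R ?F" by (rule right_module_free_right_module[OF P.R.ring_axioms])
  have sub: "carrier ?E \<subseteq> carrier ?F" by (auto simp: free_right_module_simps)
  have r: "?r f \<in> carrier ?E" if "f \<in> carrier ?F" for f
    using that by (auto simp: free_right_module_simps elim!: rev_finite_subset)
  have r_id: "?r f = f" if "f \<in> carrier ?E" for f
    using that by (auto simp: free_right_module_simps fun_eq_iff subset_iff) metis
  have "i \<in> mod_hom R P ?F"
    using i sub by (auto simp: mod_hom_def hom_def free_right_module_simps(2-))
  moreover have "(\<lambda>f\<in>carrier ?F. p (?r f)) \<in> mod_hom R ?F P"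
  proof (rule mod_hom_restrictI[OF F])
    fix f g assume fg: "f \<in> carrier ?F" "g \<in> carrier ?F"
    show "p (?r (f \<oplus>\<^bsub>?F\<^esub> g)) = p (?r f) \<oplus>\<^bsub>P\<^esub> p (?r g)"
      unfolding mod_homD(2)[OF p r r, OF fg, symmetric]
      by (rule arg_cong[of _ _ p]) (auto simp: free_right_module_simps(2-))
  next
    fix a f assume af: "a \<in> carrier R" "f \<in> carrier ?F"
    show "p (?r (a \<odot>\<^bsub>?F\<^esub> f)) = a \<odot>\<^bsub>P\<^esub> p (?r f)"
      unfolding mod_homD(3)[OF p af(1) r[OF af(2)], symmetric]
      by (rule arg_cong[of _ _ p]) (use af in \<open>auto simp: free_right_module_simps(2-)\<close>)
  qed (rule mod_homD(1)[OF p r])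
  moreover have "(\<lambda>f\<in>carrier ?F. p (?r f)) (i x) = x" if "x \<in> carrier P" for x
  proof -
    have "i x \<in> carrier ?E" by (rule mod_homD(1)[OF i that])
    then have "(\<lambda>f\<in>carrier ?F. p (?r f)) (i x) = p (i x)"
      using sub r_id[of "i x"] by auto
    then show ?thesis using pi[OF that] by simp
  qed
  ultimately show ?thesis by blast
qed

text \<open>The hypothesis is a containment of images, as exactness provides it. Preimages under
  \<open>k\<close> are chosen for the values of \<open>h\<close> after \<open>p\<close> on the basis
  vectors and extended linearly; composing with the section \<open>i\<close> gives the lift on
  \<open>P\<close>.\<close>

lemma projective_lift:
  fixes P :: "('r, 'p) module"
  assumes P: "projective_right_module R P" and M: "right_module R M" and N: "right_module R N"
    and k: "k \<in> mod_hom R M N" and h: "h \<in> mod_hom R P N" and im: "h ` carrier P \<subseteq> k ` carrier M"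
  shows "\<exists>l \<in> mod_hom R P M. \<forall>x \<in> carrier P. k (l x) = h x"
proof -
  have P': "right_module R P" using P by (simp add: projective_right_module_def)
  interpret P: right_module R P by fact
  interpret N: right_module R N by fact
  let ?F = "free_right_module R (UNIV :: 'p set)"
  obtain i p where i: "i \<in> mod_hom R P ?F" and p: "p \<in> mod_hom R ?F P"
    and pi: "\<And>x. x \<in> carrier P \<Longrightarrow> p (i x) = x"
    using projective_summand_UNIV[OF P] by blast
  have F: "right_module R ?F" by (rule right_module_free_right_module[OF P.R.ring_axioms])
  note uc = unit_vec_closed[OF P.R.ring_axioms]
  have "\<exists>m. m \<in> carrier M \<and> k m = h (p (unit_vec R y))" for y
    using im mod_homD(1)[OF p uc, of y] by (metis image_eqI image_iff subsetD)
  then obtain b where b: "\<And>y. b y \<in> carrier M" "\<And>y. k (b y) = h (p (unit_vec R y))"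
    by metis
  have lin: "lin R M b \<in> mod_hom R ?F M" by (rule lin_hom[OF M b(1)])
  have "compose (carrier ?F) k (lin R M b) = compose (carrier ?F) h p"
    by (rule mod_hom_free_eqI[OF N mod_hom_compose[OF F lin k] mod_hom_compose[OF F p h]])
      (simp add: compose_eq uc lin_unit_vec[OF M b(1)] b(2))
  then have *: "k (lin R M b f) = h (p f)" if "f \<in> carrier ?F" for f
    using that by (metis compose_eq)
  show ?thesis
  proof (intro bexI ballI)
    show "compose (carrier P) (lin R M b) i \<in> mod_hom R P M"
      by (rule mod_hom_compose[OF P' i lin])
    show "k (compose (carrier P) (lin R M b) i x) = h x" if "x \<in> carrier P" for x
      using that *[OF mod_homD(1)[OF i that]] pi by (simp add: compose_eq)
  qed
qed

lemma projective_resolutionD: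
  assumes "projective_resolution R M P d e"
  shows "right_module R M" "projective_right_module R (P n)" "right_module R (P n)"
    "d n \<in> mod_hom R (P (Suc n)) (P n)" "e \<in> mod_hom R (P 0) M" "e ` carrier (P 0) = carrier M"
    "d 0 ` carrier (P (Suc 0)) = {x \<in> carrier (P 0). e x = \<zero>\<^bsub>M\<^esub>}"
    "d (Suc n) ` carrier (P (Suc (Suc n))) = {x \<in> carrier (P (Suc n)). d n x = \<zero>\<^bsub>P n\<^esub>}"
  using assms unfolding projective_resolution_def projective_right_module_def
  by (simp_all add: a_kernel_def kernel_def)

lemma projective_resolution_zero:
  assumes "projective_resolution R M P d e"
  shows "x \<in> carrier (P (Suc 0)) \<Longrightarrow> e (d 0 x) = \<zero>\<^bsub>M\<^esub>"
    "x \<in> carrier (P (Suc (Suc n))) \<Longrightarrow> d n (d (Suc n) x) = \<zero>\<^bsub>P n\<^esub>"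
  using projective_resolutionD(7,8)[OF assms] by blast+

text \<open>The augmentations are included, so between resolutions of one module this is a lift of
  the identity of that module. That makes any two such maps homotopic.\<close>

definition chain_map ::
  "('r, 'c) ring_scheme \<Rightarrow> (nat \<Rightarrow> ('r, 'p) module) \<Rightarrow> (nat \<Rightarrow> 'p \<Rightarrow> 'p) \<Rightarrow> ('p \<Rightarrow> 'a) \<Rightarrow>
    (nat \<Rightarrow> ('r, 'q) module) \<Rightarrow> (nat \<Rightarrow> 'q \<Rightarrow> 'q) \<Rightarrow> ('q \<Rightarrow> 'a) \<Rightarrow> (nat \<Rightarrow> 'p \<Rightarrow> 'q) \<Rightarrow> bool" where
  "chain_map R P d e Q d' e' f \<longleftrightarrow> (\<forall>n. f n \<in> mod_hom R (P n) (Q n)) \<and>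
    (\<forall>x \<in> carrier (P 0). e' (f 0 x) = e x) \<and>
    (\<forall>n. \<forall>x \<in> carrier (P (Suc n)). d' n (f (Suc n) x) = f n (d n x))"

lemma ex_chain_map:
  assumes P: "projective_resolution R M P d e" and Q: "projective_resolution R M Q d' e'"
  obtains f where "chain_map R P d e Q d' e' f"
proof -
  note PD = projective_resolutionD[OF P] and QD = projective_resolutionD[OF Q]
  \<comment> \<open>The last clause keeps the recursion going: it says that \<open>g\<close> after
    \<open>d n\<close> can be lifted through \<open>d' n\<close>, which yields the next map.\<close>
  define I where "I n g \<longleftrightarrow> g \<in> mod_hom R (P n) (Q n) \<and>
    (n = 0 \<longrightarrow> (\<forall>x \<in> carrier (P 0). e' (g x) = e x)) \<and>
    (\<forall>x \<in> carrier (P (Suc n)). g (d n x) \<in> d' n ` carrier (Q (Suc n)))" for n g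
  have "\<exists>f. \<forall>n. I n (f n) \<and> (\<forall>x \<in> carrier (P (Suc n)). d' n (f (Suc n) x) = f n (d n x))"
  proof (rule dependent_nat_choice)
    obtain g where g: "g \<in> mod_hom R (P 0) (Q 0)" "\<And>x. x \<in> carrier (P 0) \<Longrightarrow> e' (g x) = e x"
      using projective_lift[OF PD(2) QD(3) QD(1) QD(5) PD(5)] PD(6)[THEN equalityD1] QD(6) by auto
    have "g (d 0 x) \<in> d' 0 ` carrier (Q (Suc 0))" if "x \<in> carrier (P (Suc 0))" for x
      unfolding QD(7) using that mod_homD(1)[OF PD(4), of x 0] mod_homD(1)[OF g(1)] g(2)
        projective_resolution_zero(1)[OF P, of x] by simp
    with g have "I 0 g" by (simp add: I_def)
    then show "\<exists>g. I 0 g" by blast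
  next
    fix g n assume "I n g"
    then have g: "g \<in> mod_hom R (P n) (Q n)"
      and im: "\<And>x. x \<in> carrier (P (Suc n)) \<Longrightarrow> g (d n x) \<in> d' n ` carrier (Q (Suc n))"
      by (auto simp: I_def)
    have "compose (carrier (P (Suc n))) g (d n) \<in> mod_hom R (P (Suc n)) (Q n)"
      by (rule mod_hom_compose[OF PD(3) PD(4) g])
    from projective_lift[OF PD(2) QD(3) QD(3) QD(4) this] im
    have "\<exists>l \<in> mod_hom R (P (Suc n)) (Q (Suc n)). \<forall>x \<in> carrier (P (Suc n)).
      d' n (l x) = compose (carrier (P (Suc n))) g (d n) x"
      by (simp add: compose_eq image_subset_iff)
    then obtain l where l: "l \<in> mod_hom R (P (Suc n)) (Q (Suc n))"
      "\<And>x. x \<in> carrier (P (Suc n)) \<Longrightarrow> d' n (l x) = g (d n x)"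
      by (auto simp: compose_eq)
    have "l (d (Suc n) x) \<in> d' (Suc n) ` carrier (Q (Suc (Suc n)))"
      if "x \<in> carrier (P (Suc (Suc n)))" for x
      unfolding QD(8) using that mod_homD(1)[OF PD(4)] mod_homD(1)[OF l(1)] l(2)
        projective_resolution_zero(2)[OF P] mod_hom_zero[OF PD(3) QD(3) g] by simp
    with l show "\<exists>l. I (Suc n) l \<and> (\<forall>x \<in> carrier (P (Suc n)). d' n (l x) = g (d n x))"
      by (auto simp: I_def)
  qed
  then obtain f where f: "\<forall>n. I n (f n) \<and> (\<forall>x \<in> carrier (P (Suc n)). d' n (f (Suc n) x) = f n (d n x))" ..
  have "chain_map R P d e Q d' e' f"
    unfolding chain_map_def
  proof (intro conjI allI)
    show "f n \<in> mod_hom R (P n) (Q n)" for n using f unfolding I_def by blast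
    show "\<forall>x \<in> carrier (P 0). e' (f 0 x) = e x" using f unfolding I_def by blast
    show "\<forall>x \<in> carrier (P (Suc n)). d' n (f (Suc n) x) = f n (d n x)" for n using f by blast
  qed
  then show thesis by (rule that)
qed

lemma chain_map_compose:
  assumes "\<And>n. right_module R (P n)" "\<And>n. d n \<in> mod_hom R (P (Suc n)) (P n)"
    and f: "chain_map R P d e Q d' e' f" and g: "chain_map R Q d' e' L d'' e'' g"
  shows "chain_map R P d e L d'' e'' (\<lambda>n. compose (carrier (P n)) (g n) (f n))"
proof -
  have f1: "f n \<in> mod_hom R (P n) (Q n)" and g1: "g n \<in> mod_hom R (Q n) (L n)" for n
    using f g by (simp_all add: chain_map_def)
  have f2: "\<And>n x. x \<in> carrier (P (Suc n)) \<Longrightarrow> d' n (f (Suc n) x) = f n (d n x)"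
      "\<And>x. x \<in> carrier (P 0) \<Longrightarrow> e' (f 0 x) = e x"
    using f by (auto simp: chain_map_def)
  have g2: "\<And>n x. x \<in> carrier (Q (Suc n)) \<Longrightarrow> d'' n (g (Suc n) x) = g n (d' n x)"
      "\<And>x. x \<in> carrier (Q 0) \<Longrightarrow> e'' (g 0 x) = e' x"
    using g by (auto simp: chain_map_def)
  show ?thesis
    unfolding chain_map_def
  proof (intro conjI allI ballI)
    fix n x assume x: "x \<in> carrier (P (Suc n))"
    show "d'' n (compose (carrier (P (Suc n))) (g (Suc n)) (f (Suc n)) x)
      = compose (carrier (P n)) (g n) (f n) (d n x)"
      using g2(1)[OF mod_homD(1)[OF f1 x]] f2(1)[OF x] mod_homD(1)[OF assms(2) x] x
      by (simp add: compose_eq)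
  next
    fix x assume x: "x \<in> carrier (P 0)"
    show "e'' (compose (carrier (P 0)) (g 0) (f 0) x) = e x"
      using g2(2)[OF mod_homD(1)[OF f1 x]] f2(2)[OF x] x by (simp add: compose_eq)
  qed (rule mod_hom_compose[OF assms(1) f1 g1])
qed

lemma chain_map_id:
  assumes "\<And>n. right_module R (P n)" "\<And>n. d n \<in> mod_hom R (P (Suc n)) (P n)"
  shows "chain_map R P d e P d e (\<lambda>n. \<lambda>x\<in>carrier (P n). x)"
  unfolding chain_map_def
proof (intro conjI allI ballI)
  show "restrict (\<lambda>x. x) (carrier (P n)) \<in> mod_hom R (P n) (P n)" for n
    by (rule mod_hom_restrictI[OF assms(1)]) simp_all
qed (simp_all add: mod_homD(1)[OF assms(2)])

text \<open>With \<open>h\<close> the difference of the two maps, \<open>h - s d\<close> takes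
  values in cycles, hence in boundaries by exactness of \<open>Q\<close>, and lifts to the next
  \<open>s\<close>. The conclusion is stated in positive degrees, those of the groups to be
  compared.\<close>

lemma chain_map_homotopy:
  assumes P: "projective_resolution R M P d e" and Q: "projective_resolution R M Q d' e'"
    and f: "chain_map R P d e Q d' e' f" and g: "chain_map R P d e Q d' e' g"
  obtains s where "\<And>n. s n \<in> mod_hom R (P n) (Q (Suc n))"
    "\<And>n x. x \<in> carrier (P (Suc n)) \<Longrightarrow>
      f (Suc n) x \<ominus>\<^bsub>Q (Suc n)\<^esub> g (Suc n) x = d' (Suc n) (s (Suc n) x) \<oplus>\<^bsub>Q (Suc n)\<^esub> s n (d n x)"
proof -
  note PD = projective_resolutionD[OF P] and QD = projective_resolutionD[OF Q]
  have f1: "f n \<in> mod_hom R (P n) (Q n)" and g1: "g n \<in> mod_hom R (P n) (Q n)" for n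
    using f g by (simp_all add: chain_map_def)
  have f2: "\<And>n x. x \<in> carrier (P (Suc n)) \<Longrightarrow> d' n (f (Suc n) x) = f n (d n x)"
    and g2: "\<And>n x. x \<in> carrier (P (Suc n)) \<Longrightarrow> d' n (g (Suc n) x) = g n (d n x)"
    using f g by (simp_all add: chain_map_def)
  define h where "h n = (\<lambda>x\<in>carrier (P n). f n x \<ominus>\<^bsub>Q n\<^esub> g n x)" for n
  have h1: "h n \<in> mod_hom R (P n) (Q n)" for n
    unfolding h_def by (rule mod_hom_diff[OF PD(3) QD(3) f1 g1])
  have h2: "d' n (h (Suc n) x) = h n (d n x)" if "x \<in> carrier (P (Suc n))" for n x
    using that by (simp add: h_def mod_hom_minus[OF QD(3) QD(3) QD(4)] mod_homD(1)[OF f1] mod_homD(1)[OF g1]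
        f2 g2 mod_homD(1)[OF PD(4)])
  \<comment> \<open>The second clause makes \<open>h (Suc n)\<close> minus \<open>s\<close> after
    \<open>d n\<close> a cycle, since \<open>d' n\<close> turns \<open>h (Suc n) x\<close> into
    \<open>h n (d n x)\<close>.\<close>
  define I where "I n s \<longleftrightarrow> s \<in> mod_hom R (P n) (Q (Suc n)) \<and>
    (\<forall>x \<in> carrier (P (Suc n)). d' n (s (d n x)) = h n (d n x))" for n s
  have "\<exists>s. \<forall>n. I n (s n) \<and>
    (\<forall>x \<in> carrier (P (Suc n)). h (Suc n) x = d' (Suc n) (s (Suc n) x) \<oplus>\<^bsub>Q (Suc n)\<^esub> s n (d n x))"
  proof (rule dependent_nat_choice)
    interpret M: right_module R M by (rule QD(1))
    \<comment> \<open>Both maps commute with the augmentations, so \<open>e'\<close> kills their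
      difference in degree 0.\<close>
    have "h 0 x \<in> d' 0 ` carrier (Q (Suc 0))" if "x \<in> carrier (P 0)" for x
    proof -
      have "e' (h 0 x) = e' (f 0 x) \<ominus>\<^bsub>M\<^esub> e' (g 0 x)"
        using that by (simp add: h_def mod_hom_minus[OF QD(3) QD(1) QD(5)] mod_homD(1)[OF f1] mod_homD(1)[OF g1])
      also have "\<dots> = \<zero>\<^bsub>M\<^esub>"
        using that f g mod_homD(1)[OF PD(5)] by (simp add: chain_map_def M.M.minus_eq M.M.r_neg)
      finally show ?thesis using that mod_homD(1)[OF h1] by (simp add: QD(7))
    qed
    then obtain s where "s \<in> mod_hom R (P 0) (Q (Suc 0))" "\<And>x. x \<in> carrier (P 0) \<Longrightarrow> d' 0 (s x) = h 0 x"
      using projective_lift[OF PD(2) QD(3) QD(3) QD(4) h1] by blast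
    then have "I 0 s" using mod_homD(1)[OF PD(4)] by (simp add: I_def)
    then show "\<exists>s. I 0 s" by blast
  next
    fix s n assume "I n s"
    then have s: "s \<in> mod_hom R (P n) (Q (Suc n))"
      and ds: "\<And>x. x \<in> carrier (P (Suc n)) \<Longrightarrow> d' n (s (d n x)) = h n (d n x)"
      by (auto simp: I_def)
    interpret Qn: right_module R "Q n" by (rule QD(3))
    interpret Q: right_module R "Q (Suc n)" by (rule QD(3))
    let ?c = "compose (carrier (P (Suc n))) s (d n)"
    have c: "?c \<in> mod_hom R (P (Suc n)) (Q (Suc n))" by (rule mod_hom_compose[OF PD(3) PD(4) s])
    let ?k = "\<lambda>x\<in>carrier (P (Suc n)). h (Suc n) x \<ominus>\<^bsub>Q (Suc n)\<^esub> ?c x"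
    have k: "?k \<in> mod_hom R (P (Suc n)) (Q (Suc n))" by (rule mod_hom_diff[OF PD(3) QD(3) h1 c])
    have "d' n (?k x) = \<zero>\<^bsub>Q n\<^esub>" if x: "x \<in> carrier (P (Suc n))" for x
    proof -
      have "d' n (?k x) = d' n (h (Suc n) x) \<ominus>\<^bsub>Q n\<^esub> d' n (?c x)"
        using x by (simp add: mod_hom_minus[OF QD(3) QD(3) QD(4) mod_homD(1)[OF h1] mod_homD(1)[OF c]])
      also have "\<dots> = \<zero>\<^bsub>Q n\<^esub>"
        using x mod_homD(1)[OF h1 mod_homD(1)[OF PD(4) x]]
        by (simp add: h2 ds compose_eq Qn.M.minus_eq Qn.M.r_neg)
      finally show ?thesis .
    qed
    then have "?k ` carrier (P (Suc n)) \<subseteq> d' (Suc n) ` carrier (Q (Suc (Suc n)))"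
      unfolding QD(8) using mod_homD(1)[OF k] by blast
    then obtain l where l: "l \<in> mod_hom R (P (Suc n)) (Q (Suc (Suc n)))"
      "\<And>x. x \<in> carrier (P (Suc n)) \<Longrightarrow> d' (Suc n) (l x) = ?k x"
      using projective_lift[OF PD(2) QD(3) QD(3) QD(4) k] by blast
    have hl: "h (Suc n) x = d' (Suc n) (l x) \<oplus>\<^bsub>Q (Suc n)\<^esub> s (d n x)" if "x \<in> carrier (P (Suc n))" for x
      using that by (simp add: l(2) compose_eq Q.M.minus_add_cancel mod_homD(1)[OF h1] mod_homD(1)[OF s]
          mod_homD(1)[OF PD(4)])
    have "d' (Suc n) (l (d (Suc n) x)) = h (Suc n) (d (Suc n) x)" if "x \<in> carrier (P (Suc (Suc n)))" for x
      using that mod_homD(1)[OF QD(4) mod_homD(1)[OF l(1) mod_homD(1)[OF PD(4) that]]]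
      by (simp add: hl mod_homD(1)[OF PD(4)] projective_resolution_zero(2)[OF P]
          mod_hom_zero[OF PD(3) QD(3) s])
    with l(1) hl show "\<exists>l. I (Suc n) l \<and> (\<forall>x \<in> carrier (P (Suc n)).
      h (Suc n) x = d' (Suc n) (l x) \<oplus>\<^bsub>Q (Suc n)\<^esub> s (d n x))"
      unfolding I_def by blast
  qed
  then obtain s where *: "\<forall>n. I n (s n) \<and> (\<forall>x \<in> carrier (P (Suc n)).
    h (Suc n) x = d' (Suc n) (s (Suc n) x) \<oplus>\<^bsub>Q (Suc n)\<^esub> s n (d n x))" ..
  have s: "I n (s n)" "x \<in> carrier (P (Suc n)) \<Longrightarrow>
    h (Suc n) x = d' (Suc n) (s (Suc n) x) \<oplus>\<^bsub>Q (Suc n)\<^esub> s n (d n x)" for n x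
    using * by blast+
  show thesis
  proof (rule that)
    show "s n \<in> mod_hom R (P n) (Q (Suc n))" for n using s(1) by (simp add: I_def)
    show "f (Suc n) x \<ominus>\<^bsub>Q (Suc n)\<^esub> g (Suc n) x = d' (Suc n) (s (Suc n) x) \<oplus>\<^bsub>Q (Suc n)\<^esub> s n (d n x)"
      if "x \<in> carrier (P (Suc n))" for n x
      using s(2)[OF that] that by (simp add: h_def)
  qed
qed

section \<open>Ext and Tor as sets of classes\<close>

text \<open>The maps \<open>phi\<close> and \<open>psi\<close> respect the relations and are inverse
  to each other up to them, which is exactly what homotopy inverse chain maps provide on cocycles
  and on cycles.\<close>

lemma bij_betw_quotients:
  assumes E: "equiv K E" and E': "equiv K' E'"
    and phi: "\<And>x. x \<in> K \<Longrightarrow> phi x \<in> K'" "\<And>x y. (x, y) \<in> E \<Longrightarrow> (phi x, phi y) \<in> E'"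
    and psi: "\<And>x. x \<in> K' \<Longrightarrow> psi x \<in> K" "\<And>x y. (x, y) \<in> E' \<Longrightarrow> (psi x, psi y) \<in> E"
    and inv: "\<And>x. x \<in> K \<Longrightarrow> (x, psi (phi x)) \<in> E" "\<And>x. x \<in> K' \<Longrightarrow> (x, phi (psi x)) \<in> E'"
  shows "bij_betw (\<lambda>X. E' `` (phi ` X)) (K // E) (K' // E')"
proof (rule bij_betw_byWitness[where f' = "\<lambda>X. E `` (psi ` X)"])
  have 1: "E' `` (phi ` (E `` {x})) = E' `` {phi x}" if "x \<in> K" for x
  proof -
    have "(x, x) \<in> E" using E that by (meson equivE refl_onD)
    then show ?thesis using phi(2) E' by (auto simp: Image_iff) (meson equivE transE)
  qed
  have 2: "E `` (psi ` (E' `` {x})) = E `` {psi x}" if "x \<in> K'" for x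
  proof -
    have "(x, x) \<in> E'" using E' that by (meson equivE refl_onD)
    then show ?thesis using psi(2) E by (auto simp: Image_iff) (meson equivE transE)
  qed
  show "\<forall>X \<in> K // E. E `` (psi ` (E' `` (phi ` X))) = X"
    by (auto simp: quotient_def 1 2 phi inv(1) equiv_class_eq[OF E, symmetric])
  show "\<forall>X \<in> K' // E'. E' `` (phi ` (E `` (psi ` X))) = X"
    by (auto simp: quotient_def 1 2 psi inv(2) equiv_class_eq[OF E', symmetric])
  show "(\<lambda>X. E' `` (phi ` X)) ` (K // E) \<subseteq> K' // E'"
    by (auto elim!: quotientE simp: 1 intro!: quotientI phi)
  show "(\<lambda>X. E `` (psi ` X)) ` (K' // E') \<subseteq> K // E"
    by (auto elim!: quotientE simp: 2 intro!: quotientI psi)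
qed

text \<open>The cosets of the image inside the kernel are rewritten as classes of a relation, the
  form expected by \<open>bij_betw_quotients\<close>. The closure hypothesis keeps each coset within
  the kernel.\<close>

lemma carrier_homology_at:
  assumes "\<And>a x. a \<in> carrier A \<Longrightarrow> x \<in> kernel B C g \<Longrightarrow> f a \<otimes>\<^bsub>B\<^esub> x \<in> kernel B C g"
  shows "carrier (homology_at A f B g C) = kernel B C g //
    {(x, y). x \<in> kernel B C g \<and> y \<in> kernel B C g \<and> (\<exists>a \<in> carrier A. y = f a \<otimes>\<^bsub>B\<^esub> x)}"
  (is "_ = ?K // ?E")
proof -
  have "f ` carrier A #>\<^bsub>B\<lparr>carrier := ?K\<rparr>\<^esub> x = ?E `` {x}" if "x \<in> ?K" for x
    using that assms[OF _ that] by (auto simp: r_coset_def)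
  then show ?thesis
    by (simp add: homology_at_def FactGroup_def RCOSETS_def quotient_def)
qed

section \<open>Cohomology as classes of cocycles\<close>

definition cocycles :: "('g, 'c) monoid_scheme \<Rightarrow> (nat \<Rightarrow> ('g \<Rightarrow> int, 'p) module) \<Rightarrow> (nat \<Rightarrow> 'p \<Rightarrow> 'p) \<Rightarrow>
    nat \<Rightarrow> ('p \<Rightarrow> int) set" where
  "cocycles G P d n = {f \<in> mod_hom (group_ring G) (P n) (trivial_module G).
    \<forall>x \<in> carrier (P (Suc n)). f (d n x) = 0}"

text \<open>The index \<open>n\<close> is the degree of the cochain \<open>g\<close>; the relation
  itself lives one degree higher. The coboundary is added on the left to match the cosets of the
  quotient group.\<close>

definition cohomologous :: "('g, 'c) monoid_scheme \<Rightarrow> (nat \<Rightarrow> ('g \<Rightarrow> int, 'p) module) \<Rightarrow> (nat \<Rightarrow> 'p \<Rightarrow> 'p) \<Rightarrow>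
    nat \<Rightarrow> (('p \<Rightarrow> int) \<times> ('p \<Rightarrow> int)) set" where
  "cohomologous G P d n = {(f, f'). f \<in> cocycles G P d (Suc n) \<and> f' \<in> cocycles G P d (Suc n) \<and>
    (\<exists>g \<in> mod_hom (group_ring G) (P n) (trivial_module G).
      \<forall>x \<in> carrier (P (Suc n)). f' x = g (d n x) + f x)}"

lemma mod_hom_intI:
  fixes f :: "'p \<Rightarrow> int"
  assumes "right_module (group_ring G) M"
    and "\<And>x y. x \<in> carrier M \<Longrightarrow> y \<in> carrier M \<Longrightarrow> f (x \<oplus>\<^bsub>M\<^esub> y) = f x + f y"
    and "\<And>a x. a \<in> carrier (group_ring G) \<Longrightarrow> x \<in> carrier M \<Longrightarrow>
      f (a \<odot>\<^bsub>M\<^esub> x) = (\<Sum>g | a g \<noteq> 0. a g) * f x"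
  shows "restrict f (carrier M) \<in> mod_hom (group_ring G) M (trivial_module G)"
  by (rule mod_hom_restrictI[OF assms(1)]) (simp_all add: trivial_module_simps assms(2,3))

lemma mod_hom_intD:
  assumes "f \<in> mod_hom (group_ring G) M (trivial_module G)"
  shows "x \<in> carrier M \<Longrightarrow> y \<in> carrier M \<Longrightarrow> f (x \<oplus>\<^bsub>M\<^esub> y) = f x + f y"
    and "a \<in> carrier (group_ring G) \<Longrightarrow> x \<in> carrier M \<Longrightarrow>
      f (a \<odot>\<^bsub>M\<^esub> x) = (\<Sum>g | a g \<noteq> 0. a g) * f x"
  using mod_homD(2,3)[OF assms] by (simp_all add: trivial_module_simps)

lemma mod_hom_int_add:
  fixes f g :: "'p \<Rightarrow> int"
  assumes "right_module (group_ring G) M" "f \<in> mod_hom (group_ring G) M (trivial_module G)"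
    "g \<in> mod_hom (group_ring G) M (trivial_module G)"
  shows "(\<lambda>x\<in>carrier M. f x + g x) \<in> mod_hom (group_ring G) M (trivial_module G)"
    and "(\<lambda>x\<in>carrier M. - f x) \<in> mod_hom (group_ring G) M (trivial_module G)"
  by (rule mod_hom_intI[OF assms(1)];
      simp add: mod_hom_intD[OF assms(2)] mod_hom_intD[OF assms(3)] algebra_simps)+

context
  fixes G :: "('g, 'c) monoid_scheme" and P :: "nat \<Rightarrow> ('g \<Rightarrow> int, 'p) module"
    and d :: "nat \<Rightarrow> 'p \<Rightarrow> 'p"
  assumes P: "\<And>n. right_module (group_ring G) (P n)"
    and d: "\<And>n. d n \<in> mod_hom (group_ring G) (P (Suc n)) (P n)"
    and dd: "\<forall>n. \<forall>x \<in> carrier (P (Suc (Suc n))). d n (d (Suc n) x) = \<zero>\<^bsub>P n\<^esub>"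
begin

lemma mod_hom_int_zero:
  assumes "f \<in> mod_hom (group_ring G) (P n) (trivial_module G)"
  shows "f \<zero>\<^bsub>P n\<^esub> = 0"
proof -
  interpret right_module "group_ring G" "P n" by (rule P)
  show ?thesis using mod_hom_intD(1)[OF assms M.zero_closed M.zero_closed] by simp
qed

lemma carrier_group_cohomology:
  "carrier (group_cohomology G P d (Suc n)) = cocycles G P d (Suc n) // cohomologous G P d n"
proof -
  let ?T = "trivial_module G" and ?H = "\<lambda>n. hom_group (group_ring G) (P n) (trivial_module G)"
  let ?c = "\<lambda>n f. compose (carrier (P (Suc n))) f (d n)"
  have z: "?c (Suc n) f = (\<lambda>x\<in>carrier (P (Suc (Suc n))). 0) \<longleftrightarrow>
    (\<forall>x \<in> carrier (P (Suc (Suc n))). f (d (Suc n) x) = 0)" for f :: "'p \<Rightarrow> int"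
    by (auto simp: compose_def restrict_def fun_eq_iff)
  have K: "kernel (?H (Suc n)) (?H (Suc (Suc n))) (?c (Suc n)) = cocycles G P d (Suc n)"
    by (simp add: kernel_def cocycles_def hom_group_def z trivial_module_def)
  have mult: "f \<otimes>\<^bsub>?H n\<^esub> g = (\<lambda>x\<in>carrier (P n). f x + g x)" for f g n
    by (simp add: hom_group_def trivial_module_def)
  have carr: "carrier (?H n) = mod_hom (group_ring G) (P n) ?T" for n
    by (simp add: hom_group_def)
  have cl: "?c n g \<otimes>\<^bsub>?H (Suc n)\<^esub> f \<in> cocycles G P d (Suc n)"
    if g: "g \<in> mod_hom (group_ring G) (P n) ?T" and f: "f \<in> cocycles G P d (Suc n)" for g f
  proof -
    have "?c n g \<in> mod_hom (group_ring G) (P (Suc n)) ?T" by (rule mod_hom_compose[OF P d g])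
    then show ?thesis
      using f unfolding mult cocycles_def
      by (simp add: mod_hom_int_add(1)[OF P] mod_homD(1)[OF d] compose_eq dd mod_hom_int_zero[OF g])
  qed
  \<comment> \<open>Cocycles are extensional, so equality of functions amounts to equality on the
    carrier.\<close>
  have eq: "f' = ?c n g \<otimes>\<^bsub>?H (Suc n)\<^esub> f \<longleftrightarrow> (\<forall>x \<in> carrier (P (Suc n)). f' x = g (d n x) + f x)"
    if "f' \<in> cocycles G P d (Suc n)" for f f' g
    using that unfolding mult cocycles_def mod_hom_def
    by (auto simp: compose_eq extensional_def fun_eq_iff)
  have "carrier (group_cohomology G P d (Suc n)) = cocycles G P d (Suc n) //
    {(x, y). x \<in> cocycles G P d (Suc n) \<and> y \<in> cocycles G P d (Suc n) \<and>
      (\<exists>a \<in> carrier (?H n). y = ?c n a \<otimes>\<^bsub>?H (Suc n)\<^esub> x)}"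
    unfolding group_cohomology_def Ext.simps K[symmetric]
    by (rule carrier_homology_at) (use cl in \<open>simp add: K carr\<close>)
  also have "{(x, y). x \<in> cocycles G P d (Suc n) \<and> y \<in> cocycles G P d (Suc n) \<and>
      (\<exists>a \<in> carrier (?H n). y = ?c n a \<otimes>\<^bsub>?H (Suc n)\<^esub> x)} = cohomologous G P d n"
    by (simp add: cohomologous_def carr eq cong: conj_cong)
  finally show ?thesis .
qed

lemma equiv_cohomologous: "equiv (cocycles G P d (Suc n)) (cohomologous G P d n)"
proof (rule equivI)
  show "refl_on (cocycles G P d (Suc n)) (cohomologous G P d n)"
  proof (rule refl_onI)
    fix f assume f: "f \<in> cocycles G P d (Suc n)"
    have "(\<lambda>x\<in>carrier (P n). 0) \<in> mod_hom (group_ring G) (P n) (trivial_module G)"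
      by (rule mod_hom_intI[OF P]) auto
    then show "(f, f) \<in> cohomologous G P d n"
      using f mod_homD(1)[OF d] unfolding cohomologous_def
      by (auto intro!: bexI[of _ "\<lambda>x\<in>carrier (P n). 0"])
  qed
  show "sym (cohomologous G P d n)"
  proof (rule symI)
    fix f f' assume "(f, f') \<in> cohomologous G P d n"
    then obtain g where g: "f \<in> cocycles G P d (Suc n)" "f' \<in> cocycles G P d (Suc n)"
      "g \<in> mod_hom (group_ring G) (P n) (trivial_module G)"
      "\<And>x. x \<in> carrier (P (Suc n)) \<Longrightarrow> f' x = g (d n x) + f x"
      by (auto simp: cohomologous_def)
    show "(f', f) \<in> cohomologous G P d n"
      unfolding cohomologous_def
      using g mod_homD(1)[OF d] mod_hom_int_add(2)[OF P g(3) g(3)]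
      by (auto intro!: bexI[of _ "\<lambda>x\<in>carrier (P n). - g x"])
  qed
  show "trans (cohomologous G P d n)"
  proof (rule transI)
    fix f f' f'' assume "(f, f') \<in> cohomologous G P d n" "(f', f'') \<in> cohomologous G P d n"
    then obtain g g' where g: "f \<in> cocycles G P d (Suc n)" "f'' \<in> cocycles G P d (Suc n)"
      "g \<in> mod_hom (group_ring G) (P n) (trivial_module G)"
      "g' \<in> mod_hom (group_ring G) (P n) (trivial_module G)"
      "\<And>x. x \<in> carrier (P (Suc n)) \<Longrightarrow> f' x = g (d n x) + f x"
      "\<And>x. x \<in> carrier (P (Suc n)) \<Longrightarrow> f'' x = g' (d n x) + f' x"
      by (auto simp: cohomologous_def)
    show "(f, f'') \<in> cohomologous G P d n"
      unfolding cohomologous_def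
      using g mod_homD(1)[OF d] mod_hom_int_add(1)[OF P g(3) g(4)]
      by (auto intro!: bexI[of _ "\<lambda>x\<in>carrier (P n). g x + g' x"])
  qed
qed (auto simp: cohomologous_def)

end

lemma chain_mapD:
  assumes "chain_map R P d e Q d' e' u"
  shows "u n \<in> mod_hom R (P n) (Q n)" "x \<in> carrier (P (Suc n)) \<Longrightarrow> d' n (u (Suc n) x) = u n (d n x)"
  using assms unfolding chain_map_def by blast+

lemma chain_map_pullback:
  fixes G :: "('g, 'c) monoid_scheme"
  assumes P: "projective_resolution (group_ring G) (trivial_module G) P d e"
    and Q: "projective_resolution (group_ring G) (trivial_module G) Q d' e'"
    and u: "chain_map (group_ring G) P d e Q d' e' u"
  shows "f \<in> cocycles G Q d' n \<Longrightarrow> compose (carrier (P n)) f (u n) \<in> cocycles G P d n"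
    and "(f, f') \<in> cohomologous G Q d' n \<Longrightarrow>
      (compose (carrier (P (Suc n))) f (u (Suc n)), compose (carrier (P (Suc n))) f' (u (Suc n)))
      \<in> cohomologous G P d n"
proof -
  note PD = projective_resolutionD[OF P] and QD = projective_resolutionD[OF Q]
  note uD = chain_mapD[OF u]
  show 1: "compose (carrier (P n)) f (u n) \<in> cocycles G P d n" if f: "f \<in> cocycles G Q d' n" for f n
  proof -
    from f have f1: "f \<in> mod_hom (group_ring G) (Q n) (trivial_module G)"
      and f2: "\<And>x. x \<in> carrier (Q (Suc n)) \<Longrightarrow> f (d' n x) = 0"
      by (auto simp: cocycles_def)
    have "f (u n (d n x)) = 0" if "x \<in> carrier (P (Suc n))" for x
      using f2[OF mod_homD(1)[OF uD(1) that]] uD(2)[OF that] by simp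
    then show ?thesis
      using mod_hom_compose[OF PD(3) uD(1) f1] mod_homD(1)[OF PD(4)]
      by (simp add: cocycles_def compose_eq)
  qed
  assume ff: "(f, f') \<in> cohomologous G Q d' n"
  then obtain g where g: "g \<in> mod_hom (group_ring G) (Q n) (trivial_module G)"
    "\<And>x. x \<in> carrier (Q (Suc n)) \<Longrightarrow> f' x = g (d' n x) + f x"
    by (auto simp: cohomologous_def)
  have "\<forall>x \<in> carrier (P (Suc n)). compose (carrier (P (Suc n))) f' (u (Suc n)) x
    = compose (carrier (P n)) g (u n) (d n x) + compose (carrier (P (Suc n))) f (u (Suc n)) x"
    using g(2) uD(2) mod_homD(1)[OF uD(1)] mod_homD(1)[OF PD(4)] by (simp add: compose_eq)
  then show "(compose (carrier (P (Suc n))) f (u (Suc n)), compose (carrier (P (Suc n))) f' (u (Suc n)))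
      \<in> cohomologous G P d n"
    using ff 1 mod_hom_compose[OF PD(3) uD(1) g(1)] unfolding cohomologous_def by blast
qed

text \<open>Both \<open>v\<close> after \<open>u\<close> and the identity lift the identity of
  \<open>M\<close>, hence are homotopic. The term \<open>x\<close> stands on the right-hand side so
  that additive maps can be applied without subtraction.\<close>

lemma chain_homotopy_inverse:
  assumes P: "projective_resolution R M P d e" and Q: "projective_resolution R M Q d' e'"
    and u: "chain_map R P d e Q d' e' u" and v: "chain_map R Q d' e' P d e v"
  shows "\<exists>s. (\<forall>n. s n \<in> mod_hom R (P n) (P (Suc n))) \<and> (\<forall>n. \<forall>x \<in> carrier (P (Suc n)).
    v (Suc n) (u (Suc n) x) = d (Suc n) (s (Suc n) x) \<oplus>\<^bsub>P (Suc n)\<^esub> s n (d n x) \<oplus>\<^bsub>P (Suc n)\<^esub> x)"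
proof -
  note PD = projective_resolutionD[OF P] and QD = projective_resolutionD[OF Q]
  note uD = chain_mapD[OF u] and vD = chain_mapD[OF v]
  obtain s where s: "\<And>n. s n \<in> mod_hom R (P n) (P (Suc n))"
    "\<And>n x. x \<in> carrier (P (Suc n)) \<Longrightarrow>
      compose (carrier (P (Suc n))) (v (Suc n)) (u (Suc n)) x \<ominus>\<^bsub>P (Suc n)\<^esub> (\<lambda>x\<in>carrier (P (Suc n)). x) x
        = d (Suc n) (s (Suc n) x) \<oplus>\<^bsub>P (Suc n)\<^esub> s n (d n x)"
    by (rule chain_map_homotopy[OF P P chain_map_compose[where P = P and d = d, OF PD(3) PD(4) u v]
          chain_map_id[where P = P and d = d, OF PD(3) PD(4)]])
      blast
  have "v (Suc n) (u (Suc n) x) = d (Suc n) (s (Suc n) x) \<oplus>\<^bsub>P (Suc n)\<^esub> s n (d n x) \<oplus>\<^bsub>P (Suc n)\<^esub> x"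
    if x: "x \<in> carrier (P (Suc n))" for n x
  proof -
    interpret Pn: right_module R "P (Suc n)" by (rule PD(3))
    have "v (Suc n) (u (Suc n) x) \<in> carrier (P (Suc n))"
      using x mod_homD(1)[OF vD(1)] mod_homD(1)[OF uD(1)] by blast
    then show ?thesis
      using s(2)[OF x, symmetric] x by (simp add: compose_eq Pn.M.minus_add_cancel)
  qed
  with s(1) show ?thesis by blast
qed

lemma bij_betw_group_cohomology:
  fixes G :: "('g, 'c) monoid_scheme"
  assumes P: "projective_resolution (group_ring G) (trivial_module G) P d e"
    and Q: "projective_resolution (group_ring G) (trivial_module G) Q d' e'"
  shows "\<exists>h. bij_betw h (carrier (group_cohomology G P d (Suc n))) (carrier (group_cohomology G Q d' (Suc n)))"
proof -
  let ?R = "group_ring G" and ?T = "trivial_module G"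
  obtain u where u: "chain_map ?R P d e Q d' e' u" by (rule ex_chain_map[OF P Q])
  obtain v where v: "chain_map ?R Q d' e' P d e v" by (rule ex_chain_map[OF Q P])
  have inv: "(f, compose (carrier (P (Suc n))) (compose (carrier (Q (Suc n))) f (v (Suc n))) (u (Suc n)))
      \<in> cohomologous G P d n"
    if P: "projective_resolution ?R ?T P d e" and Q: "projective_resolution ?R ?T Q d' e'"
      and u: "chain_map ?R P d e Q d' e' u" and v: "chain_map ?R Q d' e' P d e v"
      and f: "f \<in> cocycles G P d (Suc n)"
    for P :: "nat \<Rightarrow> ('g \<Rightarrow> int, 'u) module" and d e and Q :: "nat \<Rightarrow> ('g \<Rightarrow> int, 'v) module"
      and d' e' u v f
  proof -
    note PD = projective_resolutionD[OF P] and QD = projective_resolutionD[OF Q]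
    note uD = chain_mapD[OF u] and vD = chain_mapD[OF v]
    from f have f1: "f \<in> mod_hom ?R (P (Suc n)) ?T"
      and f2: "\<And>x. x \<in> carrier (P (Suc (Suc n))) \<Longrightarrow> f (d (Suc n) x) = 0"
      by (auto simp: cocycles_def)
    obtain s where s: "\<And>n. s n \<in> mod_hom ?R (P n) (P (Suc n))"
      "\<And>n x. x \<in> carrier (P (Suc n)) \<Longrightarrow>
        v (Suc n) (u (Suc n) x) = d (Suc n) (s (Suc n) x) \<oplus>\<^bsub>P (Suc n)\<^esub> s n (d n x) \<oplus>\<^bsub>P (Suc n)\<^esub> x"
      using chain_homotopy_inverse[OF P Q u v] by blast
    interpret Pn: right_module ?R "P (Suc n)" by (rule PD(3))
    \<comment> \<open>The cocycle \<open>f\<close> kills the homotopy term in the image of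
      \<open>d (Suc n)\<close>; what remains beside \<open>f x\<close> is the coboundary of
      \<open>f\<close> after \<open>s n\<close>.\<close>
    have "f (v (Suc n) (u (Suc n) x)) = f (s n (d n x)) + f x" if x: "x \<in> carrier (P (Suc n))" for x
    proof -
      have "d (Suc n) (s (Suc n) x) \<in> carrier (P (Suc n))" "s n (d n x) \<in> carrier (P (Suc n))"
        using x mod_homD(1)[OF s(1)] mod_homD(1)[OF PD(4)] by blast+
      then show ?thesis
        using x mod_homD(1)[OF s(1)] by (simp add: s(2) mod_hom_intD(1)[OF f1] f2)
    qed
    then have "\<forall>x \<in> carrier (P (Suc n)).
      compose (carrier (P (Suc n))) (compose (carrier (Q (Suc n))) f (v (Suc n))) (u (Suc n)) x
      = compose (carrier (P n)) f (s n) (d n x) + f x"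
      using mod_homD(1)[OF uD(1)] mod_homD(1)[OF PD(4)] by (simp add: compose_eq)
    then show ?thesis
      using f chain_map_pullback(1)[OF P Q u chain_map_pullback(1)[OF Q P v f]]
        mod_hom_compose[OF PD(3) s(1) f1]
      unfolding cohomologous_def by blast
  qed
  have PZ: "\<forall>n. \<forall>x \<in> carrier (P (Suc (Suc n))). d n (d (Suc n) x) = \<zero>\<^bsub>P n\<^esub>"
    and QZ: "\<forall>n. \<forall>x \<in> carrier (Q (Suc (Suc n))). d' n (d' (Suc n) x) = \<zero>\<^bsub>Q n\<^esub>"
    using projective_resolution_zero(2)[OF P] projective_resolution_zero(2)[OF Q] by blast+
  note PD = projective_resolutionD[OF P] and QD = projective_resolutionD[OF Q]
  note P' = carrier_group_cohomology[where P = P and d = d, OF PD(3,4) PZ]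
    equiv_cohomologous[where P = P and d = d, OF PD(3,4) PZ]
  note Q' = carrier_group_cohomology[where P = Q and d = d', OF QD(3,4) QZ]
    equiv_cohomologous[where P = Q and d = d', OF QD(3,4) QZ]
  show ?thesis
    unfolding P'(1) Q'(1)
    by (rule exI, rule bij_betw_quotients[where phi = "\<lambda>f. compose (carrier (Q (Suc n))) f (v (Suc n))"
        and psi = "\<lambda>f. compose (carrier (P (Suc n))) f (u (Suc n))", OF P'(2) Q'(2)])
      (erule chain_map_pullback[OF Q P v] chain_map_pullback[OF P Q u] inv[OF P Q u v] inv[OF Q P v u])+
qed

section \<open>Tensor products with the trivial module\<close>

inductive_set tensor_generators ::
  "('r, 'c) ring_scheme \<Rightarrow> ('r, 'm) module \<Rightarrow> ('r, 'n) module \<Rightarrow> ('m \<times> 'n \<Rightarrow>\<^sub>0 int) set"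
  for R M N where
  left: "\<lbrakk>x \<in> carrier M; x' \<in> carrier M; y \<in> carrier N\<rbrakk> \<Longrightarrow>
    frag_of (x \<oplus>\<^bsub>M\<^esub> x', y) - frag_of (x, y) - frag_of (x', y) \<in> tensor_generators R M N"
| right: "\<lbrakk>x \<in> carrier M; y \<in> carrier N; y' \<in> carrier N\<rbrakk> \<Longrightarrow>
    frag_of (x, y \<oplus>\<^bsub>N\<^esub> y') - frag_of (x, y) - frag_of (x, y') \<in> tensor_generators R M N"
| balanced: "\<lbrakk>a \<in> carrier R; x \<in> carrier M; y \<in> carrier N\<rbrakk> \<Longrightarrow>
    frag_of (a \<odot>\<^bsub>M\<^esub> x, y) - frag_of (x, a \<odot>\<^bsub>N\<^esub> y) \<in> tensor_generators R M N"

lemma tensor_relations_eq: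
  "tensor_relations R M N = generate (free_Abelian_group (carrier M \<times> carrier N)) (tensor_generators R M N)"
proof -
  have "tensor_generators R M N =
    {frag_of (x \<oplus>\<^bsub>M\<^esub> x', y) - frag_of (x, y) - frag_of (x', y) | x x' y.
        x \<in> carrier M \<and> x' \<in> carrier M \<and> y \<in> carrier N} \<union>
    {frag_of (x, y \<oplus>\<^bsub>N\<^esub> y') - frag_of (x, y) - frag_of (x, y') | x y y'.
        x \<in> carrier M \<and> y \<in> carrier N \<and> y' \<in> carrier N} \<union>
    {frag_of (a \<odot>\<^bsub>M\<^esub> x, y) - frag_of (x, a \<odot>\<^bsub>N\<^esub> y) | a x y.
        a \<in> carrier R \<and> x \<in> carrier M \<and> y \<in> carrier N}"
    unfolding set_eq_iff Un_iff mem_Collect_eq tensor_generators.simps by (simp only: disj_assoc simp_thms)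
  then show ?thesis by (simp add: tensor_relations_def)
qed

lemma tensor_generators_closed:
  assumes "right_module R M" and "left_module R N"
  shows "tensor_generators R M N \<subseteq> carrier (free_Abelian_group (carrier M \<times> carrier N))"
proof
  interpret M: right_module R M by fact
  interpret N: left_module R N by fact
  let ?F = "free_Abelian_group (carrier M \<times> carrier N)"
  have diff: "a - b \<in> carrier ?F" if "a \<in> carrier ?F" "b \<in> carrier ?F" for a b
    using keys_diff[of a b] that by auto
  have of: "frag_of (x, y) \<in> carrier ?F" if "x \<in> carrier M" "y \<in> carrier N" for x y
    using that by simp
  fix h assume "h \<in> tensor_generators R M N"
  then show "h \<in> carrier ?F"
    by cases (simp_all del: carrier_free_Abelian_group_iff add: diff of M.smult_closed N.smult_closed)
qed

text \<open>Additive statements about relations reduce to the three kinds of generators. The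
  \<open>minus\<close> case stems from the inverses in \<open>generate\<close>, which are negatives
  because the keys of generators lie in the carrier.\<close>

lemma tensor_relations_induct [consumes 3, case_names zero left right balanced add minus]:
  assumes "right_module R M" and "left_module R N" and c: "c \<in> tensor_relations R M N"
    and "Q 0"
    and "\<And>x x' y. x \<in> carrier M \<Longrightarrow> x' \<in> carrier M \<Longrightarrow> y \<in> carrier N \<Longrightarrow>
      Q (frag_of (x \<oplus>\<^bsub>M\<^esub> x', y) - frag_of (x, y) - frag_of (x', y))"
    and "\<And>x y y'. x \<in> carrier M \<Longrightarrow> y \<in> carrier N \<Longrightarrow> y' \<in> carrier N \<Longrightarrow>
      Q (frag_of (x, y \<oplus>\<^bsub>N\<^esub> y') - frag_of (x, y) - frag_of (x, y'))"
    and "\<And>a x y. a \<in> carrier R \<Longrightarrow> x \<in> carrier M \<Longrightarrow> y \<in> carrier N \<Longrightarrow>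
      Q (frag_of (a \<odot>\<^bsub>M\<^esub> x, y) - frag_of (x, a \<odot>\<^bsub>N\<^esub> y))"
    and add: "\<And>a b. Q a \<Longrightarrow> Q b \<Longrightarrow> Q (a + b)" and minus: "\<And>a. Q a \<Longrightarrow> Q (- a)"
  shows "Q c"
proof -
  have gen: "Q h" if "h \<in> tensor_generators R M N" for h
    using that by cases (simp_all add: assms(5-7))
  show ?thesis
    using c unfolding tensor_relations_eq
  proof (induction rule: generate.induct)
    case (inv h)
    then have "Poly_Mapping.keys h \<subseteq> carrier M \<times> carrier N"
      using subsetD[OF tensor_generators_closed[OF assms(1,2)], of h] by simp
    then show ?case using minus gen inv by simp
  qed (use assms(4) add gen in auto)
qed

lemma tensor_relations_subgroup:
  assumes "right_module R M" and "left_module R N"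
  shows "subgroup (tensor_relations R M N) (free_Abelian_group (carrier M \<times> carrier N))"
  unfolding tensor_relations_eq
  by (rule group.generate_is_subgroup[OF group_free_Abelian_group tensor_generators_closed[OF assms]])

text \<open>Tensoring with the trivial module identifies the product of x by a with the augmentation
  of a times x. The result is the group of coinvariants of \<open>M\<close>, and all its elements
  are of the form x tensor 1.\<close>

locale coinvariants =
  fixes G :: "('g, 'c) monoid_scheme" and M :: "('g \<Rightarrow> int, 'm) module"
  assumes G: "group G" and M: "right_module (group_ring G) M"
begin

sublocale right_module "group_ring G" M by (rule M)

abbreviation "T \<equiv> trivial_module G"
abbreviation "F \<equiv> free_Abelian_group (carrier M \<times> carrier T)"
abbreviation "relations \<equiv> tensor_relations (group_ring G) M T"

lemmas left_T = left_module_trivial_module[OF G]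
lemmas subgroup_relations = tensor_relations_subgroup[OF M left_T]

lemma carrier_T [simp]: "carrier T = UNIV" by (simp add: trivial_module_def)

lemma relations_0: "0 \<in> relations"
  and relations_add: "c \<in> relations \<Longrightarrow> c' \<in> relations \<Longrightarrow> c + c' \<in> relations"
  using subgroup.one_closed[OF subgroup_relations] subgroup.m_closed[OF subgroup_relations] by simp_all

lemma relations_keys: "c \<in> relations \<Longrightarrow> Poly_Mapping.keys c \<subseteq> carrier M \<times> UNIV"
  using subgroup.subset[OF subgroup_relations] by (auto simp del: carrier_free_Abelian_group_iff)
    (auto dest!: subsetD)

lemma relations_minus: "c \<in> relations \<Longrightarrow> - c \<in> relations"
  using subgroup.m_inv_closed[OF subgroup_relations] relations_keys by simp

lemma relations_diff: "c \<in> relations \<Longrightarrow> c' \<in> relations \<Longrightarrow> c - c' \<in> relations"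
  using relations_add[of c "- c'"] relations_minus by simp

lemma relations_left: "x \<in> carrier M \<Longrightarrow> x' \<in> carrier M \<Longrightarrow>
    frag_of (x \<oplus>\<^bsub>M\<^esub> x', k) - frag_of (x, k) - frag_of (x', k) \<in> relations"
  and relations_right: "x \<in> carrier M \<Longrightarrow>
    frag_of (x, k + k') - frag_of (x, k) - frag_of (x, k') \<in> relations"
  and relations_balanced: "a \<in> carrier (group_ring G) \<Longrightarrow> x \<in> carrier M \<Longrightarrow>
    frag_of (a \<odot>\<^bsub>M\<^esub> x, k) - frag_of (x, (\<Sum>g | a g \<noteq> 0. a g) * k) \<in> relations"
proof -
  note gen = generate.incl[of _ "tensor_generators (group_ring G) M T" F, folded tensor_relations_eq]
  show "x \<in> carrier M \<Longrightarrow> x' \<in> carrier M \<Longrightarrow>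
    frag_of (x \<oplus>\<^bsub>M\<^esub> x', k) - frag_of (x, k) - frag_of (x', k) \<in> relations"
    by (rule gen, rule tensor_generators.left) auto
  show "x \<in> carrier M \<Longrightarrow> frag_of (x, k + k') - frag_of (x, k) - frag_of (x, k') \<in> relations"
    using gen[OF tensor_generators.right[of x M k T k' "group_ring G"]] by (simp add: trivial_module_simps)
  show "a \<in> carrier (group_ring G) \<Longrightarrow> x \<in> carrier M \<Longrightarrow>
    frag_of (a \<odot>\<^bsub>M\<^esub> x, k) - frag_of (x, (\<Sum>g | a g \<noteq> 0. a g) * k) \<in> relations"
    using gen[OF tensor_generators.balanced[of a "group_ring G" x M k T]] by (simp add: trivial_module_simps)
qed

definition pure :: "'m \<Rightarrow> ('m \<times> int \<Rightarrow>\<^sub>0 int) set" where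
  "pure x = relations #>\<^bsub>F\<^esub> frag_of (x, 1)"

lemma coset_eq_iff:
  assumes "Poly_Mapping.keys c \<subseteq> carrier M \<times> UNIV" "Poly_Mapping.keys c' \<subseteq> carrier M \<times> UNIV"
  shows "relations #>\<^bsub>F\<^esub> c = relations #>\<^bsub>F\<^esub> c' \<longleftrightarrow> c - c' \<in> relations"
proof
  assume "relations #>\<^bsub>F\<^esub> c = relations #>\<^bsub>F\<^esub> c'"
  moreover have "c \<in> relations #>\<^bsub>F\<^esub> c" using relations_0 by (force simp: r_coset_def)
  ultimately obtain r where "r \<in> relations" "c = r + c'" by (auto simp: r_coset_def)
  then show "c - c' \<in> relations" by simp
next
  assume cc: "c - c' \<in> relations"
  show "relations #>\<^bsub>F\<^esub> c = relations #>\<^bsub>F\<^esub> c'"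
  proof (intro equalityI subsetI)
    fix b assume "b \<in> relations #>\<^bsub>F\<^esub> c"
    then obtain r where "r \<in> relations" "b = r + c" by (auto simp: r_coset_def)
    then show "b \<in> relations #>\<^bsub>F\<^esub> c'"
      using relations_add[OF _ cc] by (auto simp: r_coset_def intro!: bexI[of _ "r + (c - c')"])
  next
    fix b assume "b \<in> relations #>\<^bsub>F\<^esub> c'"
    then obtain r where "r \<in> relations" "b = r + c'" by (auto simp: r_coset_def)
    then show "b \<in> relations #>\<^bsub>F\<^esub> c"
      using relations_diff[OF _ cc] by (auto simp: r_coset_def intro!: bexI[of _ "r - (c - c')"])
  qed
qed

lemma pure_eq_iff:
  assumes "x \<in> carrier M" "y \<in> carrier M"
  shows "pure x = pure y \<longleftrightarrow> frag_of (x, 1) - frag_of (y, 1) \<in> relations"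
  unfolding pure_def by (rule coset_eq_iff) (use assms in auto)

lemma frag_of_zero: "frag_of (\<zero>\<^bsub>M\<^esub>, k) \<in> relations"
proof -
  have "- frag_of (\<zero>\<^bsub>M\<^esub>, k) \<in> relations"
    using relations_left[of "\<zero>\<^bsub>M\<^esub>" "\<zero>\<^bsub>M\<^esub>" k] by simp
  then show ?thesis using relations_minus by fastforce
qed

text \<open>The tensor of x and k equals that of k x and 1, and differences of such tensors collapse
  by additivity, so a single element of \<open>M\<close> represents each class.\<close>

lemma carrier_tensor: "carrier (tensor (group_ring G) M T) = pure ` carrier M"
proof -
  have ex: "\<exists>x \<in> carrier M. c - frag_of (x, 1) \<in> relations" if "Poly_Mapping.keys c \<subseteq> carrier M \<times> UNIV" for c
    using that
  proof (induction rule: frag_induction)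
    case zero
    show ?case using relations_minus[OF frag_of_zero[of 1]] by (intro bexI[of _ "\<zero>\<^bsub>M\<^esub>"]) auto
  next
    case (one p)
    obtain x k where p: "p = (x, k)" "x \<in> carrier M" using one by auto
    \<comment> \<open>The integer k as an element of the group ring: it has augmentation k and moves
      k to the left factor.\<close>
    let ?a = "\<lambda>g. if g = \<one>\<^bsub>G\<^esub> then k else 0 :: int"
    have a: "?a \<in> carrier (group_ring G)" using G by (auto simp: group_ring_def group.is_monoid monoid.one_closed)
    have "{g. ?a g \<noteq> 0} = (if k = 0 then {} else {\<one>\<^bsub>G\<^esub>})" by auto
    then have "(\<Sum>g | ?a g \<noteq> 0. ?a g) = k" by simp
    then have "frag_of (?a \<odot>\<^bsub>M\<^esub> x, 1) - frag_of (x, k) \<in> relations"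
      using relations_balanced[OF a p(2), of 1] by simp
    then have "frag_of p - frag_of (?a \<odot>\<^bsub>M\<^esub> x, 1) \<in> relations"
      using relations_minus p by fastforce
    then show ?case using smult_closed[OF a p(2)] by blast
  next
    case (diff c c')
    then obtain x y where xy: "x \<in> carrier M" "c - frag_of (x, 1) \<in> relations"
      "y \<in> carrier M" "c' - frag_of (y, 1) \<in> relations" by blast
    have "frag_of (x, 1) - frag_of (x \<ominus>\<^bsub>M\<^esub> y, 1) - frag_of (y, 1) \<in> relations"
      using relations_left[of "x \<ominus>\<^bsub>M\<^esub> y" y 1] xy by (simp add: M.minus_add_cancel)
    from relations_add[OF relations_diff[OF xy(2,4)] this]
    have "c - c' - frag_of (x \<ominus>\<^bsub>M\<^esub> y, 1) \<in> relations" by (simp add: algebra_simps)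
    then show ?case using xy by blast
  qed
  have ex': "\<exists>x \<in> carrier M. relations #>\<^bsub>F\<^esub> c = pure x"
    if c: "Poly_Mapping.keys c \<subseteq> carrier M \<times> UNIV" for c
  proof -
    obtain x where x: "x \<in> carrier M" "c - frag_of (x, 1) \<in> relations" using ex[OF c] by blast
    then have "relations #>\<^bsub>F\<^esub> c = pure x"
      unfolding pure_def by (intro coset_eq_iff[THEN iffD2]) (use c in auto)
    with x(1) show ?thesis ..
  qed
  have car: "carrier (tensor (group_ring G) M T) = (\<lambda>c. relations #>\<^bsub>F\<^esub> c) ` carrier F"
    unfolding tensor_def FactGroup_def RCOSETS_def by (simp add: UNION_singleton_eq_range del: carrier_free_Abelian_group_iff)
  have pure: "pure x \<in> (\<lambda>c. relations #>\<^bsub>F\<^esub> c) ` carrier F" if "x \<in> carrier M" for x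
    unfolding pure_def by (rule imageI) (use that in simp)
  show ?thesis
    unfolding car
  proof (intro equalityI image_subsetI)
    fix c assume "c \<in> carrier F"
    then obtain x where "x \<in> carrier M" "relations #>\<^bsub>F\<^esub> c = pure x" using ex'[of c] by auto
    then show "relations #>\<^bsub>F\<^esub> c \<in> pure ` carrier M" by simp
  qed (rule pure)
qed

lemma tensor_group: "comm_group (tensor (group_ring G) M T)"
  unfolding tensor_def by (rule comm_group.abelian_FactGroup[OF abelian_free_Abelian_group subgroup_relations])

lemma one_tensor: "\<one>\<^bsub>tensor (group_ring G) M T\<^esub> = pure \<zero>\<^bsub>M\<^esub>"
proof -
  have "relations = relations #>\<^bsub>F\<^esub> 0" by (simp add: r_coset_def)
  also have "\<dots> = pure \<zero>\<^bsub>M\<^esub>"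
    unfolding pure_def by (subst coset_eq_iff) (auto intro: relations_minus frag_of_zero)
  finally show ?thesis by (simp add: tensor_def FactGroup_def)
qed

lemma pure_add:
  assumes "x \<in> carrier M" "y \<in> carrier M"
  shows "pure (x \<oplus>\<^bsub>M\<^esub> y) = pure x \<otimes>\<^bsub>tensor (group_ring G) M T\<^esub> pure y"
proof -
  interpret N: normal relations F
    using comm_group.normal_iff_subgroup[OF abelian_free_Abelian_group] subgroup_relations by blast
  have "pure x \<otimes>\<^bsub>tensor (group_ring G) M T\<^esub> pure y = relations #>\<^bsub>F\<^esub> (frag_of (x, 1) + frag_of (y, 1))"
    using N.rcos_sum[of "frag_of (x, 1)" "frag_of (y, 1)"] assms by (simp add: tensor_def FactGroup_def pure_def)
  also have "\<dots> = pure (x \<oplus>\<^bsub>M\<^esub> y)"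
    unfolding pure_def
  proof (subst coset_eq_iff)
    show "frag_of (x, 1) + frag_of (y, 1) - frag_of (x \<oplus>\<^bsub>M\<^esub> y, 1) \<in> relations"
      using relations_minus[OF relations_left[OF assms, of 1]] by (simp add: algebra_simps)
  qed (use assms keys_add[of "frag_of (x, 1::int)" "frag_of (y, 1)"] in auto)
  finally show ?thesis ..
qed

end

text \<open>The induced map on formal sums sends relations to relations, so all members of the coset
  \<open>pure x\<close> land in one coset; this is what gives \<open>the_elem\<close> its
  value.\<close>

lemma tensor_map_pure:
  assumes M: "coinvariants G M" and M': "coinvariants G M'" and f: "f \<in> mod_hom (group_ring G) M M'"
    and x: "x \<in> carrier M"
  shows "tensor_map (group_ring G) M M' (trivial_module G) f (coinvariants.pure G M x)
    = coinvariants.pure G M' (f x)"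
proof -
  interpret M: coinvariants G M by fact
  interpret M': coinvariants G M' by fact
  let ?F = "frag_extend (\<lambda>(x, y). frag_of (f x, y :: int))"
  note fD = mod_homD[OF f]
  have rel: "?F c \<in> M'.relations" if "c \<in> M.relations" for c
    using M.M M.left_T that
  proof (induction rule: tensor_relations_induct)
    case (left x x' y)
    then show ?case using M'.relations_left[OF fD(1) fD(1)] by (simp add: frag_extend_diff fD)
  next
    case (right x y y')
    then show ?case using M'.relations_right[OF fD(1)]
      by (simp add: frag_extend_diff trivial_module_simps)
  next
    case (balanced a x y)
    then show ?case using M'.relations_balanced[OF _ fD(1)]
      by (simp add: frag_extend_diff trivial_module_simps fD)
  qed (simp_all add: M'.relations_0 M'.relations_add M'.relations_minus frag_extend_add frag_extend_minus)
  have "M'.relations #>\<^bsub>M'.F\<^esub> ?F c = M'.pure (f x)" if c: "c \<in> M.pure x" for c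
  proof -
    obtain r where r: "r \<in> M.relations" "c = r + frag_of (x, 1)"
      using c by (auto simp: M.pure_def r_coset_def)
    then have "?F c = ?F r + frag_of (f x, 1)" by (simp add: frag_extend_add)
    then show ?thesis
      unfolding M'.pure_def using rel[OF r(1)] fD(1)[OF x] M'.relations_keys[OF rel[OF r(1)]]
        keys_add[of "?F r" "frag_of (f x, 1)"]
      by (subst M'.coset_eq_iff) auto
  qed
  moreover have "M.pure x \<noteq> {}" using M.relations_0 by (auto simp: M.pure_def r_coset_def)
  ultimately have "(\<lambda>c. M'.relations #>\<^bsub>M'.F\<^esub> ?F c) ` M.pure x = {M'.pure (f x)}" by auto
  then show ?thesis by (simp add: tensor_map_def)
qed

section \<open>Homology as classes of cycles\<close>

definition cycles :: "('g, 'c) monoid_scheme \<Rightarrow> (nat \<Rightarrow> ('g \<Rightarrow> int, 'p) module) \<Rightarrow> (nat \<Rightarrow> 'p \<Rightarrow> 'p) \<Rightarrow>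
    nat \<Rightarrow> 'p set" where
  "cycles G P d n = {x \<in> carrier (P (Suc n)).
    coinvariants.pure G (P n) (d n x) = coinvariants.pure G (P n) \<zero>\<^bsub>P n\<^esub>}"

text \<open>Classes are formed from elements of \<open>P (Suc n)\<close> in place of tensors.
  Comparison through \<open>pure\<close> absorbs the choice of a representative, so a class here is
  the full preimage, among cycles, of a class in Tor of degree \<open>Suc n\<close>.\<close>

definition homologous :: "('g, 'c) monoid_scheme \<Rightarrow> (nat \<Rightarrow> ('g \<Rightarrow> int, 'p) module) \<Rightarrow> (nat \<Rightarrow> 'p \<Rightarrow> 'p) \<Rightarrow>
    nat \<Rightarrow> ('p \<times> 'p) set" where
  "homologous G P d n = {(x, x'). x \<in> cycles G P d n \<and> x' \<in> cycles G P d n \<and>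
    (\<exists>y \<in> carrier (P (Suc (Suc n))). coinvariants.pure G (P (Suc n)) x' =
      coinvariants.pure G (P (Suc n)) (d (Suc n) y \<oplus>\<^bsub>P (Suc n)\<^esub> x))}"

lemma mod_hom_pure_cong:
  assumes "coinvariants G M" "coinvariants G M'" "f \<in> mod_hom (group_ring G) M M'"
    and "x \<in> carrier M" "y \<in> carrier M" "coinvariants.pure G M x = coinvariants.pure G M y"
  shows "coinvariants.pure G M' (f x) = coinvariants.pure G M' (f y)"
  using tensor_map_pure[OF assms(1-4)] tensor_map_pure[OF assms(1-3,5)] assms(6) by simp

context
  fixes G :: "('g, 'c) monoid_scheme" and P :: "nat \<Rightarrow> ('g \<Rightarrow> int, 'p) module"
    and d :: "nat \<Rightarrow> 'p \<Rightarrow> 'p"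
  assumes G: "group G" and P: "\<And>n. right_module (group_ring G) (P n)"
    and d: "\<And>n. d n \<in> mod_hom (group_ring G) (P (Suc n)) (P n)"
    and dd: "\<forall>n. \<forall>x \<in> carrier (P (Suc (Suc n))). d n (d (Suc n) x) = \<zero>\<^bsub>P n\<^esub>"
begin

interpretation C: coinvariants G "P n" for n
  using G P by (rule coinvariants.intro)

interpretation T: comm_group "tensor (group_ring G) (P n) (trivial_module G)" for n
  by (rule C.tensor_group)

lemma pure_closed: "x \<in> carrier (P n) \<Longrightarrow> C.pure n x \<in> carrier (tensor (group_ring G) (P n) (trivial_module G))"
  by (simp add: C.carrier_tensor)

lemma cycles_add:
  assumes "x \<in> cycles G P d n" "y \<in> carrier (P (Suc (Suc n)))"
  shows "d (Suc n) y \<oplus>\<^bsub>P (Suc n)\<^esub> x \<in> cycles G P d n"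
  using assms dd unfolding cycles_def
  by (simp add: mod_homD(1,2)[OF d])

lemma equiv_homologous: "equiv (cycles G P d n) (homologous G P d n)"
proof (rule equivI)
  have cl: "cycles G P d n \<subseteq> carrier (P (Suc n))" by (auto simp: cycles_def)
  note dc = mod_homD(1)[OF d] and zero = mod_hom_zero[OF P P d]
  show "refl_on (cycles G P d n) (homologous G P d n)"
  proof (rule refl_onI)
    fix x assume x: "x \<in> cycles G P d n"
    then have "d (Suc n) \<zero>\<^bsub>P (Suc (Suc n))\<^esub> \<oplus>\<^bsub>P (Suc n)\<^esub> x = x" using cl by (auto simp: zero)
    with x show "(x, x) \<in> homologous G P d n"
      unfolding homologous_def by (auto intro!: bexI[of _ "\<zero>\<^bsub>P (Suc (Suc n))\<^esub>"])
  qed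
  show "sym (homologous G P d n)"
  proof (rule symI)
    fix x x' assume "(x, x') \<in> homologous G P d n"
    then obtain y where x: "x \<in> cycles G P d n" "x' \<in> cycles G P d n" and y: "y \<in> carrier (P (Suc (Suc n)))"
      "C.pure (Suc n) x' = C.pure (Suc n) (d (Suc n) y \<oplus>\<^bsub>P (Suc n)\<^esub> x)"
      by (auto simp: homologous_def)
    have xc: "x \<in> carrier (P (Suc n))" "x' \<in> carrier (P (Suc n))" using x cl by auto
    let ?y = "\<ominus>\<^bsub>P (Suc (Suc n))\<^esub> y"
    have "d (Suc n) ?y \<oplus>\<^bsub>P (Suc n)\<^esub> d (Suc n) y = \<zero>\<^bsub>P (Suc n)\<^esub>"
      using y(1) by (simp add: mod_homD(2)[OF d, symmetric] C.M.l_neg zero)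
    then have "C.pure (Suc n) (d (Suc n) ?y \<oplus>\<^bsub>P (Suc n)\<^esub> x') = C.pure (Suc n) x"
      using y xc dc by (simp add: C.pure_add C.M.a_closed C.M.a_inv_closed)
        (simp add: C.pure_add[symmetric] C.M.a_assoc[symmetric])
    with x y(1) show "(x', x) \<in> homologous G P d n"
      unfolding homologous_def by (auto intro!: bexI[of _ ?y])
  qed
  show "trans (homologous G P d n)"
  proof (rule transI)
    fix x x' x'' assume "(x, x') \<in> homologous G P d n" "(x', x'') \<in> homologous G P d n"
    then obtain y y' where x: "x \<in> cycles G P d n" "x'' \<in> cycles G P d n"
      and y: "y \<in> carrier (P (Suc (Suc n)))" "C.pure (Suc n) x' = C.pure (Suc n) (d (Suc n) y \<oplus>\<^bsub>P (Suc n)\<^esub> x)"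
      and y': "y' \<in> carrier (P (Suc (Suc n)))" "C.pure (Suc n) x'' = C.pure (Suc n) (d (Suc n) y' \<oplus>\<^bsub>P (Suc n)\<^esub> x')"
      and x': "x' \<in> cycles G P d n"
      by (auto simp: homologous_def)
    have xc: "x \<in> carrier (P (Suc n))" "x' \<in> carrier (P (Suc n))" using x x' cl by auto
    have "C.pure (Suc n) x'' = C.pure (Suc n) (d (Suc n) (y' \<oplus>\<^bsub>P (Suc (Suc n))\<^esub> y) \<oplus>\<^bsub>P (Suc n)\<^esub> x)"
      using y y' xc dc by (simp add: C.pure_add mod_homD(2)[OF d] T.m_assoc pure_closed)
    with x y y' show "(x, x'') \<in> homologous G P d n"
      unfolding homologous_def by (auto intro!: bexI[of _ "y' \<oplus>\<^bsub>P (Suc (Suc n))\<^esub> y"])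
  qed
qed (auto simp: homologous_def)

text \<open>\<open>pure\<close> maps cycles onto the kernel in the tensor complex, and by the form
  of \<open>homologous\<close> two cycles are related exactly when their images are. So direct
  images of classes are classes.\<close>

lemma bij_betw_group_homology:
  "\<exists>h. bij_betw h (cycles G P d n // homologous G P d n) (carrier (group_homology G P d (Suc n)))"
proof -
  let ?R = "group_ring G" and ?Z = "trivial_module G"
  let ?T = "\<lambda>n. tensor ?R (P n) ?Z"
  let ?g = "tensor_map ?R (P (Suc n)) (P n) ?Z (d n)"
    and ?f = "tensor_map ?R (P (Suc (Suc n))) (P (Suc n)) ?Z (d (Suc n))"
  let ?K = "kernel (?T (Suc n)) (?T n) ?g"
  define E where "E = {(x, y). x \<in> ?K \<and> y \<in> ?K \<and> (\<exists>a \<in> carrier (?T (Suc (Suc n))). y = ?f a \<otimes>\<^bsub>?T (Suc n)\<^esub> x)}"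
  note dc = mod_homD(1)[OF d]
  have tm: "tensor_map ?R (P (Suc k)) (P k) ?Z (d k) (C.pure (Suc k) x) = C.pure k (d k x)"
    if "x \<in> carrier (P (Suc k))" for k x
    by (rule tensor_map_pure[OF C.coinvariants_axioms C.coinvariants_axioms d that])
  have K: "?K = C.pure (Suc n) ` cycles G P d n"
  proof (intro equalityI subsetI)
    fix t assume t: "t \<in> ?K"
    then obtain x where "x \<in> carrier (P (Suc n))" "t = C.pure (Suc n) x"
      unfolding kernel_def C.carrier_tensor by blast
    with t show "t \<in> C.pure (Suc n) ` cycles G P d n"
      by (simp add: kernel_def C.one_tensor tm cycles_def)
  next
    fix t assume "t \<in> C.pure (Suc n) ` cycles G P d n"
    then obtain x where "x \<in> cycles G P d n" "t = C.pure (Suc n) x" by blast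
    then show "t \<in> ?K"
      by (simp add: kernel_def C.one_tensor tm cycles_def C.carrier_tensor)
  qed
  have pure_f: "?f (C.pure (Suc (Suc n)) y) \<otimes>\<^bsub>?T (Suc n)\<^esub> C.pure (Suc n) x
      = C.pure (Suc n) (d (Suc n) y \<oplus>\<^bsub>P (Suc n)\<^esub> x)"
    if "y \<in> carrier (P (Suc (Suc n)))" "x \<in> cycles G P d n" for x y
    using that dc by (simp add: tm C.pure_add cycles_def)
  have E: "(C.pure (Suc n) x, C.pure (Suc n) x') \<in> E \<longleftrightarrow> (x, x') \<in> homologous G P d n"
    if "x \<in> cycles G P d n" "x' \<in> cycles G P d n" for x x'
  proof -
    have "(C.pure (Suc n) x, C.pure (Suc n) x') \<in> E \<longleftrightarrow> (\<exists>y \<in> carrier (P (Suc (Suc n))).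
        C.pure (Suc n) x' = ?f (C.pure (Suc (Suc n)) y) \<otimes>\<^bsub>?T (Suc n)\<^esub> C.pure (Suc n) x)"
      unfolding E_def K C.carrier_tensor mem_Collect_eq case_prod_conv using that by blast
    then show ?thesis using that by (simp add: homologous_def pure_f cong: bex_cong)
  qed
  have "?f a \<otimes>\<^bsub>?T (Suc n)\<^esub> t \<in> ?K" if a: "a \<in> carrier (?T (Suc (Suc n)))" and t: "t \<in> ?K" for a t
  proof -
    obtain y where y: "y \<in> carrier (P (Suc (Suc n)))" "a = C.pure (Suc (Suc n)) y"
      using a unfolding C.carrier_tensor by (rule imageE)
    obtain x where x: "x \<in> cycles G P d n" "t = C.pure (Suc n) x"
      using t unfolding K by (rule imageE)
    have "?f a \<otimes>\<^bsub>?T (Suc n)\<^esub> t = C.pure (Suc n) (d (Suc n) y \<oplus>\<^bsub>P (Suc n)\<^esub> x)"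
      unfolding x(2) y(2) by (rule pure_f[OF y(1) x(1)])
    then show ?thesis unfolding K using cycles_add[OF x(1) y(1)] by simp
  qed
  then have car: "carrier (group_homology G P d (Suc n)) = ?K // E"
    unfolding group_homology_def Tor.simps E_def by (rule carrier_homology_at)
  let ?h = "\<lambda>X. C.pure (Suc n) ` X"
  have quot: "E `` {C.pure (Suc n) x} = ?h (homologous G P d n `` {x})" if x: "x \<in> cycles G P d n" for x
  proof -
    have "t \<in> E `` {C.pure (Suc n) x} \<longleftrightarrow> t \<in> ?h (homologous G P d n `` {x})" for t
    proof
      assume "t \<in> E `` {C.pure (Suc n) x}"
      moreover from this obtain x' where "x' \<in> cycles G P d n" "t = C.pure (Suc n) x'"
        unfolding E_def K by blast
      ultimately show "t \<in> ?h (homologous G P d n `` {x})" using E[OF x] by blast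
    next
      assume "t \<in> ?h (homologous G P d n `` {x})"
      then obtain x' where x': "(x, x') \<in> homologous G P d n" "t = C.pure (Suc n) x'" by auto
      then have "x' \<in> cycles G P d n" by (auto simp: homologous_def)
      with x' show "t \<in> E `` {C.pure (Suc n) x}" using E[OF x] by blast
    qed
    then show ?thesis by blast
  qed
  have "bij_betw ?h (cycles G P d n // homologous G P d n) (?K // E)"
    unfolding bij_betw_def
  proof
    show "?h ` (cycles G P d n // homologous G P d n) = ?K // E"
    proof (intro equalityI subsetI)
      fix X assume "X \<in> ?h ` (cycles G P d n // homologous G P d n)"
      then obtain x where x: "x \<in> cycles G P d n" "X = ?h (homologous G P d n `` {x})"
        by (auto elim: quotientE)
      then have "X = E `` {C.pure (Suc n) x}" by (simp add: quot)
      with x(1) show "X \<in> ?K // E" by (simp add: K quotientI)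
    next
      fix X assume "X \<in> ?K // E"
      then obtain x where "x \<in> cycles G P d n" "X = E `` {C.pure (Suc n) x}"
        unfolding K by (auto elim!: quotientE)
      then show "X \<in> ?h ` (cycles G P d n // homologous G P d n)"
        by (auto simp: quot intro!: imageI quotientI)
    qed
    show "inj_on ?h (cycles G P d n // homologous G P d n)"
    proof (rule inj_onI)
      fix X Y assume X: "X \<in> cycles G P d n // homologous G P d n" and Y: "Y \<in> cycles G P d n // homologous G P d n"
        and eq: "?h X = ?h Y"
      obtain x where x: "x \<in> cycles G P d n" "X = homologous G P d n `` {x}" using X by (rule quotientE)
      obtain y where y: "y \<in> cycles G P d n" "Y = homologous G P d n `` {y}" using Y by (rule quotientE)
      have "x \<in> X" using x equiv_class_self[OF equiv_homologous] by simp
      then have "C.pure (Suc n) x \<in> ?h Y" using eq by blast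
      then have "(y, x) \<in> homologous G P d n" using E[OF y(1) x(1)] quot[OF y(1)] y(2) by blast
      then show "X = Y" using x y equiv_class_eq[OF equiv_homologous] by blast
    qed
  qed
  then show ?thesis unfolding car by blast
qed

end

lemma cyclesD:
  assumes "x \<in> cycles G P d n"
  shows "x \<in> carrier (P (Suc n))"
    "coinvariants.pure G (P n) (d n x) = coinvariants.pure G (P n) \<zero>\<^bsub>P n\<^esub>"
  using assms by (auto simp: cycles_def)

lemma chain_map_cycles:
  assumes G: "group G"
    and P: "projective_resolution (group_ring G) (trivial_module G) P d e"
    and Q: "projective_resolution (group_ring G) (trivial_module G) Q d' e'"
    and u: "chain_map (group_ring G) P d e Q d' e' u"
  shows "x \<in> cycles G P d n \<Longrightarrow> u (Suc n) x \<in> cycles G Q d' n"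
    and "(x, x') \<in> homologous G P d n \<Longrightarrow> (u (Suc n) x, u (Suc n) x') \<in> homologous G Q d' n"
proof -
  note PD = projective_resolutionD[OF P] and QD = projective_resolutionD[OF Q]
  note uD = chain_mapD[OF u]
  interpret CP: coinvariants G "P n" for n using G PD(3) by (rule coinvariants.intro)
  interpret CQ: coinvariants G "Q n" for n using G QD(3) by (rule coinvariants.intro)
  note cong = mod_hom_pure_cong[OF CP.coinvariants_axioms CQ.coinvariants_axioms uD(1)]
  show 1: "u (Suc n) x \<in> cycles G Q d' n" if x: "x \<in> cycles G P d n" for x
  proof -
    from x have xc: "x \<in> carrier (P (Suc n))" and p: "CP.pure n (d n x) = CP.pure n \<zero>\<^bsub>P n\<^esub>"
      by (auto simp: cycles_def)
    have "CQ.pure n (u n (d n x)) = CQ.pure n (u n \<zero>\<^bsub>P n\<^esub>)"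
      by (rule cong[OF mod_homD(1)[OF PD(4) xc] CP.M.zero_closed p])
    then show ?thesis
      using xc mod_homD(1)[OF uD(1)] uD(2)[OF xc] mod_hom_zero[OF PD(3) QD(3) uD(1)]
      by (simp add: cycles_def)
  qed
  assume "(x, x') \<in> homologous G P d n"
  then obtain y where x: "x \<in> cycles G P d n" "x' \<in> cycles G P d n" and y: "y \<in> carrier (P (Suc (Suc n)))"
    "CP.pure (Suc n) x' = CP.pure (Suc n) (d (Suc n) y \<oplus>\<^bsub>P (Suc n)\<^esub> x)"
    by (auto simp: homologous_def)
  have xc: "x \<in> carrier (P (Suc n))" "x' \<in> carrier (P (Suc n))" using x by (auto simp: cycles_def)
  have dy: "d (Suc n) y \<in> carrier (P (Suc n))" by (rule mod_homD(1)[OF PD(4) y(1)])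
  have "CQ.pure (Suc n) (u (Suc n) x') = CQ.pure (Suc n) (u (Suc n) (d (Suc n) y \<oplus>\<^bsub>P (Suc n)\<^esub> x))"
    by (rule cong[OF xc(2) CP.M.a_closed[OF dy xc(1)] y(2)])
  also have "u (Suc n) (d (Suc n) y \<oplus>\<^bsub>P (Suc n)\<^esub> x)
    = d' (Suc n) (u (Suc (Suc n)) y) \<oplus>\<^bsub>Q (Suc n)\<^esub> u (Suc n) x"
    using uD(2)[OF y(1)] by (simp add: mod_homD(2)[OF uD(1) dy xc(1)])
  finally show "(u (Suc n) x, u (Suc n) x') \<in> homologous G Q d' n"
    using x 1 mod_homD(1)[OF uD(1) y(1)] unfolding homologous_def by blast
qed

text \<open>The boundary \<open>d n x\<close> of a cycle vanishes in the coinvariants, though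
  possibly not in \<open>P n\<close>. The module map \<open>s n\<close> preserves this, so the
  homotopy term \<open>s n (d n x)\<close> disappears after \<open>pure\<close>.\<close>

lemma homologous_chain_homotopy:
  assumes G: "group G"
    and P: "projective_resolution (group_ring G) (trivial_module G) P d e"
    and Q: "projective_resolution (group_ring G) (trivial_module G) Q d' e'"
    and u: "chain_map (group_ring G) P d e Q d' e' u"
    and v: "chain_map (group_ring G) Q d' e' P d e v"
    and x: "x \<in> cycles G P d n"
  shows "(x, v (Suc n) (u (Suc n) x)) \<in> homologous G P d n"
proof -
  let ?R = "group_ring G" and ?T = "trivial_module G"
  note PD = projective_resolutionD[OF P] and QD = projective_resolutionD[OF Q]
  note uD = chain_mapD[OF u] and vD = chain_mapD[OF v]
  have C: "coinvariants G (P n)" for n using G PD(3) by (rule coinvariants.intro)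
  have M: "abelian_group (P n)" for n using PD(3) by (rule right_module.axioms)
  note r_one = monoid.r_one[OF group.is_monoid[OF comm_group.axioms(2)[OF coinvariants.tensor_group[OF C]]]]
  note xc = cyclesD(1)[OF x] and p = cyclesD(2)[OF x]
  obtain s where s: "\<And>n. s n \<in> mod_hom ?R (P n) (P (Suc n))"
    "\<And>n x. x \<in> carrier (P (Suc n)) \<Longrightarrow>
      v (Suc n) (u (Suc n) x) = d (Suc n) (s (Suc n) x) \<oplus>\<^bsub>P (Suc n)\<^esub> s n (d n x) \<oplus>\<^bsub>P (Suc n)\<^esub> x"
    using chain_homotopy_inverse[OF P Q u v] by blast
  let ?y = "d (Suc n) (s (Suc n) x)" and ?z = "s n (d n x)"
  have yz: "?y \<in> carrier (P (Suc n))" "?z \<in> carrier (P (Suc n))"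
    using xc mod_homD(1)[OF s(1)] mod_homD(1)[OF PD(4)] by blast+
  have "coinvariants.pure G (P (Suc n)) ?z = coinvariants.pure G (P (Suc n)) (s n \<zero>\<^bsub>P n\<^esub>)"
    by (rule mod_hom_pure_cong[OF C C s(1)
          mod_homD(1)[OF PD(4) xc] abelian_monoid.zero_closed[OF abelian_group.axioms(1)[OF M]] p])
  then have "coinvariants.pure G (P (Suc n)) ?z = \<one>\<^bsub>tensor ?R (P (Suc n)) ?T\<^esub>"
    by (simp add: mod_hom_zero[OF PD(3) PD(3) s(1)] coinvariants.one_tensor[OF C])
  then have "coinvariants.pure G (P (Suc n)) (?y \<oplus>\<^bsub>P (Suc n)\<^esub> ?z) = coinvariants.pure G (P (Suc n)) ?y"
    using yz by (simp add: coinvariants.pure_add[OF C] coinvariants.carrier_tensor[OF C] r_one)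
  then have "coinvariants.pure G (P (Suc n)) (v (Suc n) (u (Suc n) x))
    = coinvariants.pure G (P (Suc n)) (?y \<oplus>\<^bsub>P (Suc n)\<^esub> x)"
    using yz xc by (simp add: s(2) coinvariants.pure_add[OF C] abelian_monoid.a_closed[OF abelian_group.axioms(1)[OF M]])
  then show ?thesis
    using x chain_map_cycles(1)[OF G Q P v chain_map_cycles(1)[OF G P Q u x]] mod_homD(1)[OF s(1) xc]
    unfolding homologous_def by blast
qed

lemma bij_betw_homology_classes:
  fixes G :: "('g, 'c) monoid_scheme"
  assumes G: "group G"
    and P: "projective_resolution (group_ring G) (trivial_module G) P d e"
    and Q: "projective_resolution (group_ring G) (trivial_module G) Q d' e'"
  shows "\<exists>h. bij_betw h (cycles G P d n // homologous G P d n) (cycles G Q d' n // homologous G Q d' n)"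
proof -
  let ?R = "group_ring G" and ?T = "trivial_module G"
  obtain u where u: "chain_map ?R P d e Q d' e' u" by (rule ex_chain_map[OF P Q])
  obtain v where v: "chain_map ?R Q d' e' P d e v" by (rule ex_chain_map[OF Q P])
  have PZ: "\<forall>n. \<forall>x \<in> carrier (P (Suc (Suc n))). d n (d (Suc n) x) = \<zero>\<^bsub>P n\<^esub>"
    and QZ: "\<forall>n. \<forall>x \<in> carrier (Q (Suc (Suc n))). d' n (d' (Suc n) x) = \<zero>\<^bsub>Q n\<^esub>"
    using projective_resolution_zero(2)[OF P] projective_resolution_zero(2)[OF Q] by blast+
  note PD = projective_resolutionD[OF P] and QD = projective_resolutionD[OF Q]
  show ?thesis
    by (rule exI, rule bij_betw_quotients[where phi = "u (Suc n)" and psi = "v (Suc n)",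
        OF equiv_homologous[where P = P and d = d, OF G PD(3,4) PZ]
          equiv_homologous[where P = Q and d = d', OF G QD(3,4) QZ]])
      (erule chain_map_cycles[OF G P Q u] chain_map_cycles[OF G Q P v]
        homologous_chain_homotopy[OF G P Q u v] homologous_chain_homotopy[OF G Q P v u])+
qed

section \<open>Modules with a finite basis\<close>

abbreviation aug :: "('g \<Rightarrow> int) \<Rightarrow> int" where
  "aug a \<equiv> (\<Sum>g | a g \<noteq> 0. a g)"

text \<open>A finite free module given by basis vectors \<open>e\<close> and dual coordinates
  \<open>c\<close> in the group ring. Augmenting the coordinates describes both Hom into and the
  tensor product with the trivial module.\<close>

locale based_module = coinvariants G M
  for G :: "('g, 'z) monoid_scheme" and M :: "('g \<Rightarrow> int, 'm) module" +
  fixes I :: "'i set" and e :: "'i \<Rightarrow> 'm" and c :: "'i \<Rightarrow> 'm \<Rightarrow> 'g \<Rightarrow> int"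
  assumes finite_I: "finite I" and e_closed: "i \<in> I \<Longrightarrow> e i \<in> carrier M"
    and c_closed: "i \<in> I \<Longrightarrow> x \<in> carrier M \<Longrightarrow> c i x \<in> carrier (group_ring G)"
    and c_add: "i \<in> I \<Longrightarrow> x \<in> carrier M \<Longrightarrow> y \<in> carrier M \<Longrightarrow>
      c i (x \<oplus>\<^bsub>M\<^esub> y) = c i x \<oplus>\<^bsub>group_ring G\<^esub> c i y"
    and c_smult: "i \<in> I \<Longrightarrow> a \<in> carrier (group_ring G) \<Longrightarrow> x \<in> carrier M \<Longrightarrow>
      c i (a \<odot>\<^bsub>M\<^esub> x) = c i x \<otimes>\<^bsub>group_ring G\<^esub> a"
    and c_e: "i \<in> I \<Longrightarrow> j \<in> I \<Longrightarrow> c i (e j) = (if i = j then \<one>\<^bsub>group_ring G\<^esub> else \<zero>\<^bsub>group_ring G\<^esub>)"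
    and expansion: "x \<in> carrier M \<Longrightarrow> x = finsum M (\<lambda>i. c i x \<odot>\<^bsub>M\<^esub> e i) I"
begin

lemma inj_e: "inj_on e I"
proof (rule inj_onI, rule ccontr)
  fix i j assume ij: "i \<in> I" "j \<in> I" "e i = e j" "i \<noteq> j"
  then have "\<one>\<^bsub>group_ring G\<^esub> = \<zero>\<^bsub>group_ring G\<^esub>" using c_e[of i i] c_e[of i j] by simp
  then show False using augmentation_one[of G] by (simp add: group_ring_def fun_eq_iff)
qed

lemma projective: "projective_right_module (group_ring G) M"
proof -
  \<comment> \<open>Projectivity is defined with a basis inside the element type, so the basis
    vectors themselves serve as indices; \<open>inj_e\<close> allows passing back to
    \<open>I\<close>.\<close>
  let ?E = "free_right_module (group_ring G) (e ` I)"
  have E: "right_module (group_ring G) ?E" by (rule right_module_free_right_module[OF R.ring_axioms])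
  let ?i = "\<lambda>x y. if y \<in> e ` I then c (the_inv_into I e y) x else \<zero>\<^bsub>group_ring G\<^esub>"
  let ?p = "\<lambda>f. finsum M (\<lambda>i. f (e i) \<odot>\<^bsub>M\<^esub> e i) I"
  have the_inv: "the_inv_into I e (e i) = i" if "i \<in> I" for i
    using that inj_e by (simp add: the_inv_into_f_f)
  have mem: "f y \<in> carrier (group_ring G)" if "f \<in> carrier ?E" for f y
    using that by (auto simp: free_right_module_simps)
  have i: "restrict ?i (carrier M) \<in> mod_hom (group_ring G) M ?E"
  proof (rule mod_hom_restrictI[OF M])
    fix x assume x: "x \<in> carrier M"
    have sub: "{y. ?i x y \<noteq> \<zero>\<^bsub>group_ring G\<^esub>} \<subseteq> e ` I" by auto
    moreover have "range (?i x) \<subseteq> carrier (group_ring G)"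
      using x by (auto simp: the_inv c_closed)
    ultimately show "?i x \<in> carrier ?E"
      unfolding free_right_module_simps using finite_subset[OF sub finite_imageI[OF finite_I]] by blast
  next
    fix x y assume "x \<in> carrier M" "y \<in> carrier M"
    then show "?i (x \<oplus>\<^bsub>M\<^esub> y) = ?i x \<oplus>\<^bsub>?E\<^esub> ?i y"
      by (auto simp: free_right_module_simps the_inv c_add fun_eq_iff)
  next
    fix a x assume "a \<in> carrier (group_ring G)" "x \<in> carrier M"
    then show "?i (a \<odot>\<^bsub>M\<^esub> x) = a \<odot>\<^bsub>?E\<^esub> ?i x"
      by (auto simp: free_right_module_simps the_inv c_smult fun_eq_iff)
  qed
  have p: "restrict ?p (carrier ?E) \<in> mod_hom (group_ring G) ?E M"
  proof (rule mod_hom_restrictI[OF E])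
    fix f g assume fg: "f \<in> carrier ?E" "g \<in> carrier ?E"
    have "?p (f \<oplus>\<^bsub>?E\<^esub> g) = finsum M (\<lambda>i. f (e i) \<odot>\<^bsub>M\<^esub> e i \<oplus>\<^bsub>M\<^esub> g (e i) \<odot>\<^bsub>M\<^esub> e i) I"
      using fg by (intro M.finsum_cong')
        (auto simp: free_right_module_simps(3) mem e_closed smult_closed smult_l_distr)
    also have "\<dots> = ?p f \<oplus>\<^bsub>M\<^esub> ?p g"
      using fg by (intro M.finsum_addf) (auto simp: mem e_closed smult_closed)
    finally show "?p (f \<oplus>\<^bsub>?E\<^esub> g) = ?p f \<oplus>\<^bsub>M\<^esub> ?p g" .
  next
    fix a f assume "a \<in> carrier (group_ring G)" "f \<in> carrier ?E"
    then show "?p (a \<odot>\<^bsub>?E\<^esub> f) = a \<odot>\<^bsub>M\<^esub> ?p f"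
      by (subst smult_finsum[OF finite_I])
        (auto simp: free_right_module_simps(4) mem e_closed smult_closed smult_assoc intro!: M.finsum_cong')
  qed (auto intro!: M.finsum_closed smult_closed mem e_closed)
  have "restrict ?p (carrier ?E) (restrict ?i (carrier M) x) = x" if x: "x \<in> carrier M" for x
  proof -
    have "restrict ?p (carrier ?E) (restrict ?i (carrier M) x) = ?p (?i x)"
      using mod_homD(1)[OF i x] x by simp
    also have "\<dots> = finsum M (\<lambda>i. c i x \<odot>\<^bsub>M\<^esub> e i) I"
      by (rule M.finsum_cong') (auto simp: the_inv x intro!: smult_closed c_closed e_closed)
    finally show ?thesis using expansion[OF x] by simp
  qed
  with i p M show ?thesis unfolding projective_right_module_def by blast
qed

abbreviation "cbar x i \<equiv> aug (c i x)"

lemma cbar_add: "i \<in> I \<Longrightarrow> x \<in> carrier M \<Longrightarrow> y \<in> carrier M \<Longrightarrow> cbar (x \<oplus>\<^bsub>M\<^esub> y) i = cbar x i + cbar y i"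
  by (simp only: c_add augmentation_add c_closed)

lemma cbar_smult: "i \<in> I \<Longrightarrow> a \<in> carrier (group_ring G) \<Longrightarrow> x \<in> carrier M \<Longrightarrow>
    cbar (a \<odot>\<^bsub>M\<^esub> x) i = aug a * cbar x i"
  by (simp only: c_smult augmentation_mult[OF G] c_closed mult.commute)

lemma cbar_e: "i \<in> I \<Longrightarrow> j \<in> I \<Longrightarrow> cbar (e j) i = (if i = j then 1 else 0)"
  using augmentation_one[of G] by (simp add: c_e) (simp add: group_ring_def)

lemma additive_finsum:
  assumes "\<And>x y. x \<in> carrier M \<Longrightarrow> y \<in> carrier M \<Longrightarrow> h (x \<oplus>\<^bsub>M\<^esub> y) = h x + (h y :: int)"
    and "finite A" "f \<in> A \<rightarrow> carrier M"
  shows "h (finsum M f A) = (\<Sum>i\<in>A. h (f i))"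
  using assms(2,3)
proof induction
  case empty
  show ?case using assms(1)[of "\<zero>\<^bsub>M\<^esub>" "\<zero>\<^bsub>M\<^esub>"] by simp
next
  case (insert i A)
  then show ?case by (auto simp: assms(1) Pi_iff)
qed

text \<open>A map to the trivial module sees the coordinates only through their augmentations, so
  its values on the basis are its coordinates as a cochain.\<close>

lemma hom_expansion:
  assumes f: "f \<in> mod_hom (group_ring G) M T" and x: "x \<in> carrier M"
  shows "f x = (\<Sum>i\<in>I. cbar x i * f (e i))"
proof -
  have "f x = f (finsum M (\<lambda>i. c i x \<odot>\<^bsub>M\<^esub> e i) I)" using expansion[OF x] by simp
  also have "\<dots> = (\<Sum>i\<in>I. f (c i x \<odot>\<^bsub>M\<^esub> e i))"
    by (rule additive_finsum[OF mod_hom_intD(1)[OF f] finite_I]) (auto intro!: smult_closed c_closed e_closed x)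
  also have "\<dots> = (\<Sum>i\<in>I. cbar x i * f (e i))"
    by (rule sum.cong) (simp_all only: mod_hom_intD(2)[OF f c_closed[OF _ x] e_closed])
  finally show ?thesis .
qed

lemma hom_of_values: "(\<lambda>x\<in>carrier M. \<Sum>i\<in>I. cbar x i * v i) \<in> mod_hom (group_ring G) M T"
proof (rule mod_hom_intI[OF M])
  fix a x assume "a \<in> carrier (group_ring G)" "x \<in> carrier M"
  then have "(\<Sum>i\<in>I. cbar (a \<odot>\<^bsub>M\<^esub> x) i * v i) = (\<Sum>i\<in>I. aug a * (cbar x i * v i))"
    by (intro sum.cong refl) (simp only: cbar_smult mult.assoc)
  then show "(\<Sum>i\<in>I. cbar (a \<odot>\<^bsub>M\<^esub> x) i * v i) = aug a * (\<Sum>i\<in>I. cbar x i * v i)"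
    unfolding sum_distrib_left[of "aug a" _ I] .
qed (simp add: cbar_add distrib_right sum.distrib cong: sum.cong)

lemma hom_of_values_e: "j \<in> I \<Longrightarrow> (\<Sum>i\<in>I. cbar (e j) i * v i) = v j"
  using finite_I by (simp add: cbar_e if_distrib[of "\<lambda>t. t * _"] cong: sum.cong if_cong)

lemma ex_cbar: "\<exists>x \<in> carrier M. \<forall>i \<in> I. cbar x i = w i"
proof -
  let ?a = "\<lambda>k g. if g = \<one>\<^bsub>G\<^esub> then k else 0 :: int"
  have a: "?a k \<in> carrier (group_ring G)" for k
    using G by (auto simp: group_ring_def group.is_monoid monoid.one_closed)
  have "{g. ?a k g \<noteq> 0} = (if k = 0 then {} else {\<one>\<^bsub>G\<^esub>})" for k by auto
  then have aug_a: "aug (?a k) = k" for k by simp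
  let ?x = "finsum M (\<lambda>i. ?a (w i) \<odot>\<^bsub>M\<^esub> e i) I"
  have "cbar ?x j = w j" if j: "j \<in> I" for j
  proof -
    have "cbar ?x j = (\<Sum>i\<in>I. cbar (?a (w i) \<odot>\<^bsub>M\<^esub> e i) j)"
      by (rule additive_finsum[OF cbar_add[OF j] finite_I]) (auto intro!: smult_closed a e_closed)
    also have "\<dots> = (\<Sum>i\<in>I. if j = i then w i else 0)"
      by (rule sum.cong[OF refl]) (simp only: cbar_smult[OF j a e_closed] cbar_e[OF j] aug_a, simp)
    finally show ?thesis using j finite_I by simp
  qed
  moreover have "?x \<in> carrier M" by (auto intro!: M.finsum_closed smult_closed a e_closed)
  ultimately show ?thesis by blast
qed

text \<open>Augmented coordinates are coordinates on the coinvariants: they kill the relations, and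
  conversely x tensor 1 is, modulo relations, the sum of the tensors of \<open>e i\<close> and
  \<open>cbar x i\<close>.\<close>

lemma pure_eq_iff_cbar:
  assumes x: "x \<in> carrier M" and y: "y \<in> carrier M"
  shows "pure x = pure y \<longleftrightarrow> (\<forall>i \<in> I. cbar x i = cbar y i)"
proof
  assume "pure x = pure y"
  then have rel: "frag_of (x, 1) - frag_of (y, 1) \<in> relations" using pure_eq_iff[OF x y] by simp
  show "\<forall>i \<in> I. cbar x i = cbar y i"
  proof
    fix i assume i: "i \<in> I"
    \<comment> \<open>\<open>frag_extend\<close> takes values in formal sums, so the integers are
      modelled by the free abelian group on the one point \<open>()\<close>.\<close>
    let ?h = "frag_extend (\<lambda>(x, k). frag_cmul (k * cbar x i) (frag_of ()))"
    have "?h r = 0" if "r \<in> relations" for r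
      using M left_T that
    proof (induction rule: tensor_relations_induct)
      case (left x x' k)
      then show ?case by (simp add: frag_extend_diff cbar_add[OF i] frag_cmul_distrib distrib_left)
    next
      case (right x k k')
      then show ?case
        by (simp add: frag_extend_diff frag_cmul_distrib distrib_right trivial_module_simps)
    next
      case (balanced a x k)
      then show ?case
        by (simp add: frag_extend_diff cbar_smult[OF i] trivial_module_simps mult.assoc mult.left_commute)
    qed (simp_all add: frag_extend_add frag_extend_minus)
    from this[OF rel] have "frag_cmul (cbar x i - cbar y i) (frag_of ()) = 0"
      by (simp add: frag_extend_diff frag_cmul_diff_distrib)
    then show "cbar x i = cbar y i" by simp
  qed
next
  assume eq: "\<forall>i \<in> I. cbar x i = cbar y i"
  have sum: "frag_of (finsum M f A, 1) - (\<Sum>i\<in>A. frag_of (f i, 1)) \<in> relations"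
    if "finite A" "f \<in> A \<rightarrow> carrier M" for f and A :: "'i set"
    using that
  proof induction
    case empty
    show ?case using frag_of_zero[of 1] by simp
  next
    case (insert i A)
    then have f: "f i \<in> carrier M" "finsum M f A \<in> carrier M" by auto
    have "frag_of (finsum M f A, 1) - (\<Sum>i\<in>A. frag_of (f i, 1)) \<in> relations" using insert by auto
    from relations_add[OF relations_left[OF f, of 1] this] insert f show ?case
      by (simp add: algebra_simps)
  qed
  have *: "frag_of (z, 1) - (\<Sum>i\<in>I. frag_of (e i, cbar z i)) \<in> relations" if z: "z \<in> carrier M" for z
  proof -
    have 1: "frag_of (z, 1) - (\<Sum>i\<in>I. frag_of (c i z \<odot>\<^bsub>M\<^esub> e i, 1)) \<in> relations"
      by (subst (1) expansion[OF z], rule sum[OF finite_I]) (auto intro!: smult_closed c_closed e_closed z)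
    have "(\<Sum>i\<in>A. frag_of (c i z \<odot>\<^bsub>M\<^esub> e i, 1)) - (\<Sum>i\<in>A. frag_of (e i, cbar z i)) \<in> relations"
      if "A \<subseteq> I" for A
      using finite_subset[OF that finite_I] that
    proof induction
      case empty
      show ?case by (simp add: relations_0)
    next
      case (insert i A)
      then have "frag_of (c i z \<odot>\<^bsub>M\<^esub> e i, 1) - frag_of (e i, cbar z i) \<in> relations"
        using relations_balanced[OF c_closed[OF _ z, of i] e_closed[of i], of 1] by simp
      from relations_add[OF this] insert show ?case by (simp add: add_diff_add)
    qed
    from relations_add[OF 1 this[OF order_refl]] show ?thesis by simp
  qed
  have "(\<Sum>i\<in>I. frag_of (e i, cbar x i)) = (\<Sum>i\<in>I. frag_of (e i, cbar y i))"
    by (rule sum.cong) (use eq in auto)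
  then have "frag_of (x, 1) - frag_of (y, 1) \<in> relations"
    using relations_diff[OF *[OF x] *[OF y]] by simp
  then show "pure x = pure y" using pure_eq_iff[OF x y] by simp
qed

end

text \<open>\<open>h\<close> followed by an augmented coordinate is a map to the trivial module, so
  \<open>hom_expansion\<close> gives the matrix of \<open>h\<close> on coinvariants.\<close>

lemma based_module_map:
  assumes "based_module G M I e c" "based_module G M' I' e' c'" and h: "h \<in> mod_hom (group_ring G) M' M"
    and x: "x \<in> carrier M'" and i: "i \<in> I"
  shows "aug (c i (h x)) = (\<Sum>j\<in>I'. aug (c' j x) * aug (c i (h (e' j))))"
proof -
  interpret A: based_module G M I e c by fact
  interpret B: based_module G M' I' e' c' by fact
  have "(\<lambda>y\<in>carrier M'. aug (c i (h y))) \<in> mod_hom (group_ring G) M' (trivial_module G)"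
    by (rule mod_hom_intI[OF B.M])
      (simp_all only: mod_homD[OF h] A.cbar_add[OF i] A.cbar_smult[OF i])
  from B.hom_expansion[OF this x] x show ?thesis by (simp add: B.e_closed)
qed

section \<open>The bar resolution\<close>

text \<open>The alternating sum of the values of \<open>u\<close> at the lists obtained from a list by deleting one
  entry.\<close>

fun del :: "('g list \<Rightarrow> 'a::ab_group_add) \<Rightarrow> 'g list \<Rightarrow> 'a" where
  "del u [] = 0"
| "del u (g # t) = u t - del (\<lambda>s. u (g # s)) t"

lemma del_diff: "del (\<lambda>s. u s - v s) t = del u t - del v t"
  by (induction t arbitrary: u v) (simp_all add: algebra_simps)

lemma del_0: "del (\<lambda>s. 0) t = 0"
  by (induction t) simp_all

text \<open>The recursion is that of a cone. At \<open>g # t\<close> the two copies of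
  \<open>del u t\<close> cancel, and the rest is the induction hypothesis for the function
  \<open>\<lambda>s. u (g # s)\<close>.\<close>

lemma del_del: "del (del u) t = 0"
  by (induction t arbitrary: u) (simp_all add: del_diff)

lemma del_cong:
  assumes "\<And>s. set s \<subseteq> set t \<Longrightarrow> length t = Suc (length s) \<Longrightarrow> u s = v s"
  shows "del u t = del v t"
  using assms
proof (induction t arbitrary: u v)
  case (Cons g t)
  have "u t = v t" by (rule Cons.prems) auto
  moreover have "del (\<lambda>s. u (g # s)) t = del (\<lambda>s. v (g # s)) t"
    by (rule Cons.IH, rule Cons.prems) auto
  ultimately show ?case by simp
qed simp

lemma del_map: "del u (map f t) = del (\<lambda>s. u (map f s)) t"
  by (induction t arbitrary: u) simp_all

lemma del_sum: "del (\<lambda>s. \<Sum>i\<in>I. u i s) t = (\<Sum>i\<in>I. del (u i) t)"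
  by (induction t arbitrary: u) (simp_all add: sum_subtractf)

lemma del_mult: "del (\<lambda>s. c * u s) t = (c :: 'a::ring) * del u t"
  by (induction t arbitrary: u) (simp_all add: right_diff_distrib)

lemma del_of_int: "del (\<lambda>s. of_int (u s)) t = (of_int (del u t) :: 'a::ring_1)"
  by (induction t arbitrary: u) simp_all

definition ind :: "'b \<Rightarrow> 'b \<Rightarrow> 'a::zero_neq_one" where
  "ind s t = (if t = s then 1 else 0)"

locale finite_group = group G for G :: "('g, 'z) monoid_scheme" (structure) +
  assumes fin: "finite (carrier G)"
begin

definition X :: "nat \<Rightarrow> 'g list set" where
  "X n = {t. set t \<subseteq> carrier G \<and> length t = n}"

lemma finite_X: "finite (X n)"
  unfolding X_def by (rule finite_lists_length_eq[OF fin])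

lemma X_0: "X 0 = {[]}" by (auto simp: X_def)

lemma Cons_X: "g # t \<in> X (Suc n) \<longleftrightarrow> g \<in> carrier G \<and> t \<in> X n"
  by (auto simp: X_def)

lemma X_Suc: "X (Suc n) = (\<lambda>(g, t). g # t) ` (carrier G \<times> X n)"
  by (force simp: X_def length_Suc_conv image_iff)

lemma sum_X_Suc: "(\<Sum>t\<in>X (Suc n). f t) = (\<Sum>g\<in>carrier G. \<Sum>t\<in>X n. f (g # t))"
proof -
  have "inj_on (\<lambda>(g, t). g # t) (carrier G \<times> X n)" by (auto simp: inj_on_def)
  then show ?thesis unfolding X_Suc by (simp add: sum.reindex sum.cartesian_product case_prod_unfold)
qed

definition tr :: "'g list \<Rightarrow> 'g \<Rightarrow> 'g list" where
  "tr t g = map (\<lambda>h. h \<otimes> g) t"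

lemma tr_X: "t \<in> X n \<Longrightarrow> g \<in> carrier G \<Longrightarrow> tr t g \<in> X n"
  by (auto simp: X_def tr_def)

lemma tr_Cons: "tr (h # t) g = (h \<otimes> g) # tr t g"
  by (simp add: tr_def)

lemma tr_tr: "t \<in> X n \<Longrightarrow> g \<in> carrier G \<Longrightarrow> h \<in> carrier G \<Longrightarrow> tr (tr t g) h = tr t (g \<otimes> h)"
  by (auto simp: X_def tr_def m_assoc)

lemma tr_one: "t \<in> X n \<Longrightarrow> tr t \<one> = t"
  by (auto simp: X_def tr_def subset_iff intro!: map_idI)

lemma tr_inv: "t \<in> X n \<Longrightarrow> g \<in> carrier G \<Longrightarrow> tr (tr t g) (inv g) = t"
  "t \<in> X n \<Longrightarrow> g \<in> carrier G \<Longrightarrow> tr (tr t (inv g)) g = t"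
  by (simp_all add: tr_tr tr_one)

lemma sum_tr:
  assumes "g \<in> carrier G"
  shows "(\<Sum>t\<in>X n. f (tr t g)) = (\<Sum>t\<in>X n. f t)"
  by (rule sum.reindex_bij_witness[of _ "\<lambda>t. tr t (inv g)" "\<lambda>t. tr t g"])
    (simp_all add: tr_inv tr_X assms)

lemma sum_left_translate:
  assumes "g \<in> carrier G"
  shows "(\<Sum>h\<in>carrier G. f (g \<otimes> h)) = (\<Sum>h\<in>carrier G. f h)"
  by (rule sum.reindex_bij_witness[of _ "\<lambda>h. inv g \<otimes> h" "\<lambda>h. g \<otimes> h"])
    (simp_all add: assms m_assoc[symmetric])

lemma sum_ind: "finite A \<Longrightarrow> (\<Sum>t\<in>A. f t * ind s t) = (if s \<in> A then f s else (0 :: 'a::comm_ring_1))"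
  "finite A \<Longrightarrow> (\<Sum>t\<in>A. f t * ind t s) = (if s \<in> A then f s else (0 :: 'a::comm_ring_1))"
  by (simp_all add: ind_def if_distrib[of "\<lambda>x. _ * x"] cong: if_cong)

lemma del_cong_X:
  assumes "t \<in> X (Suc n)" "\<And>s. s \<in> X n \<Longrightarrow> u s = v s"
  shows "del u t = del v t"
  by (rule del_cong) (use assms in \<open>auto simp: X_def\<close>)

text \<open>Expanding \<open>u\<close> in indicators shows that the numbers
  \<open>del (ind s) t\<close> are the matrix entries of \<open>del\<close>; the boundary is defined
  by transposing them.\<close>

lemma del_expand:
  fixes u :: "'g list \<Rightarrow> 'a::comm_ring_1"
  assumes "t \<in> X (Suc n)"
  shows "del u t = (\<Sum>s\<in>X n. u s * del (ind s) t)"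
proof -
  have "del u t = del (\<lambda>r. \<Sum>s\<in>X n. u s * ind s r) t"
    by (rule del_cong_X[OF assms]) (simp add: sum_ind finite_X)
  then show ?thesis by (simp add: del_sum del_mult)
qed

lemma del_ind_tr:
  assumes "t \<in> X (Suc n)" "s \<in> X n" "g \<in> carrier G"
  shows "del (ind s :: _ \<Rightarrow> 'a::comm_ring_1) (tr t g) = del (ind (tr s (inv g))) t"
proof -
  have "del (ind s :: _ \<Rightarrow> 'a) (tr t g) = del (\<lambda>r. ind s (tr r g)) t"
    unfolding tr_def by (rule del_map)
  also have "\<dots> = del (ind (tr s (inv g))) t"
    by (rule del_cong_X[OF assms(1)]) (use assms in \<open>auto simp: ind_def tr_inv\<close>)
  finally show ?thesis .
qed

subsection \<open>The boundary map and its contraction\<close>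

text \<open>The transpose of \<open>del\<close>. The index counts list entries, one more than the
  homological degree: \<open>bd (Suc n)\<close> goes from degree \<open>Suc n\<close> to degree
  \<open>n\<close>, and \<open>bd 0\<close> is the augmentation.\<close>

definition bd :: "nat \<Rightarrow> ('g list \<Rightarrow> int) \<Rightarrow> 'g list \<Rightarrow> int" where
  "bd n x s = (if s \<in> X n then \<Sum>t\<in>X (Suc n). x t * del (ind s) t else 0)"

lemma pair_bd: "(\<Sum>s\<in>X n. u s * bd n x s) = (\<Sum>t\<in>X (Suc n). x t * del u t)"
proof -
  have "(\<Sum>s\<in>X n. u s * bd n x s) = (\<Sum>s\<in>X n. \<Sum>t\<in>X (Suc n). x t * (u s * del (ind s) t))"
    by (simp add: bd_def sum_distrib_left mult.left_commute cong: sum.cong)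
  also have "\<dots> = (\<Sum>t\<in>X (Suc n). \<Sum>s\<in>X n. x t * (u s * del (ind s) t))" by (rule sum.swap)
  also have "\<dots> = (\<Sum>t\<in>X (Suc n). x t * del u t)"
    by (simp add: del_expand[of _ n u] sum_distrib_left cong: sum.cong)
  finally show ?thesis .
qed

lemma bd_bd: "bd n (bd (Suc n) x) = (\<lambda>s. 0)"
proof
  fix s
  have "(\<Sum>t\<in>X (Suc n). bd (Suc n) x t * del (ind s) t) = (\<Sum>t\<in>X (Suc (Suc n)). x t * del (del (ind s)) t)"
    using pair_bd[of "del (ind s)" "Suc n" x] by (simp add: mult.commute)
  then show "bd n (bd (Suc n) x) s = 0" by (simp add: bd_def[of n] del_del)
qed

text \<open>The additive operator that prepends the identity to every list. It is not equivariant,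
  but exactness is a statement about sets and an additive contraction settles it.\<close>

definition contract :: "nat \<Rightarrow> ('g list \<Rightarrow> int) \<Rightarrow> 'g list \<Rightarrow> int" where
  "contract n x t = (if t \<in> X (Suc n) \<and> hd t = \<one> then x (tl t) else 0)"

text \<open>The boundary of \<open>\<one> # t\<close> is \<open>t\<close> minus the boundary of
  \<open>t\<close> with the identity prepended; on a cycle the second contribution vanishes.\<close>

lemma bd_contract:
  assumes x: "\<And>t. t \<notin> X (Suc n) \<Longrightarrow> x t = 0" and "bd n x = (\<lambda>s. 0)"
  shows "bd (Suc n) (contract (Suc n) x) = x"
proof
  fix s
  show "bd (Suc n) (contract (Suc n) x) s = x s"
  proof (cases "s \<in> X (Suc n)")
    case True
    then obtain h r where s: "s = h # r" "h \<in> carrier G" "r \<in> X n" by (cases s) (auto simp: X_def)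
    have "bd (Suc n) (contract (Suc n) x) s
      = (\<Sum>g\<in>carrier G. \<Sum>t\<in>X (Suc n). contract (Suc n) x (g # t) * del (ind s) (g # t))"
      using True by (simp add: bd_def sum_X_Suc[of _ "Suc n"])
    also have "\<dots> = (\<Sum>g\<in>carrier G. if \<one> = g then \<Sum>t\<in>X (Suc n). x t * del (ind s) (\<one> # t) else 0)"
      by (rule sum.cong[OF refl]) (auto simp: contract_def Cons_X intro!: sum.neutral sum.cong)
    also have "\<dots> = (\<Sum>t\<in>X (Suc n). x t * del (ind s) (\<one> # t))" using fin by simp
    also have "\<dots> = (\<Sum>t\<in>X (Suc n). x t * ind s t) - (\<Sum>t\<in>X (Suc n). x t * del (\<lambda>q. ind s (\<one> # q)) t)"
      by (simp add: right_diff_distrib sum_subtractf)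
    also have "(\<Sum>t\<in>X (Suc n). x t * del (\<lambda>q. ind s (\<one> # q)) t) = 0"
    proof (cases "h = \<one>")
      case True
      then have "(\<lambda>q. ind s (\<one> # q)) = (ind r :: _ \<Rightarrow> int)" by (auto simp: ind_def s fun_eq_iff)
      then have "(\<Sum>t\<in>X (Suc n). x t * del (\<lambda>q. ind s (\<one> # q)) t) = bd n x r"
        using s by (simp add: bd_def)
      then show ?thesis by (simp add: assms(2))
    next
      case False
      then have "(\<lambda>q. ind s (\<one> # q)) = (\<lambda>q. 0 :: int)" by (auto simp: ind_def s fun_eq_iff)
      then show ?thesis by (simp add: del_0)
    qed
    also have "(\<Sum>t\<in>X (Suc n). x t * ind s t) = x s" using True by (simp add: sum_ind finite_X)
    finally show ?thesis by simp
  next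
    case False
    then show ?thesis by (simp add: bd_def x)
  qed
qed

subsection \<open>The bar resolution as a projective resolution\<close>

text \<open>The homogeneous bar resolution: integral functions on lists of length
  \<open>Suc n\<close>, with the group translating all entries on the right. The membership test in
  the action keeps the functions zero off \<open>X (Suc n)\<close>.\<close>

definition bar :: "nat \<Rightarrow> ('g \<Rightarrow> int, 'g list \<Rightarrow> int) module" where
  "bar n = \<lparr>carrier = {x. \<forall>t. t \<notin> X (Suc n) \<longrightarrow> x t = 0}, monoid.mult = undefined, monoid.one = undefined,
    ring.zero = (\<lambda>t. 0), ring.add = (\<lambda>x y t. x t + y t),
    module.smult = (\<lambda>a x t. if t \<in> X (Suc n) then \<Sum>g\<in>carrier G. a g * x (tr t (inv g)) else 0)\<rparr>"

lemma bar_simps: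
  "x \<in> carrier (bar n) \<longleftrightarrow> (\<forall>t. t \<notin> X (Suc n) \<longrightarrow> x t = 0)"
  "\<zero>\<^bsub>bar n\<^esub> = (\<lambda>t. 0)"
  "x \<oplus>\<^bsub>bar n\<^esub> y = (\<lambda>t. x t + y t)"
  "a \<odot>\<^bsub>bar n\<^esub> x = (\<lambda>t. if t \<in> X (Suc n) then \<Sum>g\<in>carrier G. a g * x (tr t (inv g)) else 0)"
  by (simp_all add: bar_def)

lemma group_ring_mult:
  assumes "a \<in> carrier (group_ring G)" "x \<in> carrier G"
  shows "(a \<otimes>\<^bsub>group_ring G\<^esub> b) x = (\<Sum>g\<in>carrier G. a g * b (inv g \<otimes> x))"
  using assms fin by (auto simp: group_ring_def intro!: sum.mono_neutral_left)

lemma aug_eq: "a \<in> carrier (group_ring G) \<Longrightarrow> aug a = (\<Sum>g\<in>carrier G. a g)"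
  using fin by (auto simp: group_ring_def intro!: sum.mono_neutral_left)

lemma group_ring_simps:
  "a \<in> carrier (group_ring G) \<longleftrightarrow> (\<forall>g. g \<notin> carrier G \<longrightarrow> a g = 0)"
  "(a \<oplus>\<^bsub>group_ring G\<^esub> b) = (\<lambda>g. a g + b g)"
  "\<one>\<^bsub>group_ring G\<^esub> = (\<lambda>g. if g = \<one> then 1 else 0)"
  "\<zero>\<^bsub>group_ring G\<^esub> = (\<lambda>g. 0)"
proof -
  show "a \<in> carrier (group_ring G) \<longleftrightarrow> (\<forall>g. g \<notin> carrier G \<longrightarrow> a g = 0)"
    using finite_subset[OF _ fin, of "{g. a g \<noteq> 0}"] by (auto simp: group_ring_def)
qed (simp_all add: group_ring_def)

lemma right_module_bar: "right_module (group_ring G) (bar n)"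
proof -
  have "abelian_group (bar n)"
  proof (rule abelian_groupI)
    fix x assume "x \<in> carrier (bar n)"
    then show "\<exists>y \<in> carrier (bar n). y \<oplus>\<^bsub>bar n\<^esub> x = \<zero>\<^bsub>bar n\<^esub>"
      by (intro bexI[of _ "\<lambda>t. - x t"]) (auto simp: bar_simps)
  qed (auto simp: bar_simps)
  moreover have "(a \<otimes>\<^bsub>group_ring G\<^esub> b) \<odot>\<^bsub>bar n\<^esub> x = b \<odot>\<^bsub>bar n\<^esub> (a \<odot>\<^bsub>bar n\<^esub> x)"
    if a: "a \<in> carrier (group_ring G)" for a b x
  proof
    fix t
    show "((a \<otimes>\<^bsub>group_ring G\<^esub> b) \<odot>\<^bsub>bar n\<^esub> x) t = (b \<odot>\<^bsub>bar n\<^esub> (a \<odot>\<^bsub>bar n\<^esub> x)) t"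
    proof (cases "t \<in> X (Suc n)")
      case t: True
      have "((a \<otimes>\<^bsub>group_ring G\<^esub> b) \<odot>\<^bsub>bar n\<^esub> x) t
        = (\<Sum>k\<in>carrier G. \<Sum>g\<in>carrier G. a g * b (inv g \<otimes> k) * x (tr t (inv k)))"
        using t by (simp add: bar_simps group_ring_mult[OF a] sum_distrib_right cong: sum.cong)
      also have "\<dots> = (\<Sum>g\<in>carrier G. \<Sum>k\<in>carrier G. a g * b (inv g \<otimes> k) * x (tr t (inv k)))"
        by (rule sum.swap)
      also have "\<dots> = (\<Sum>g\<in>carrier G. \<Sum>k\<in>carrier G. a g * b (inv g \<otimes> (g \<otimes> k)) * x (tr t (inv (g \<otimes> k))))"
        by (rule sum.cong[OF refl]) (rule sum_left_translate[symmetric])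
      also have "\<dots> = (\<Sum>g\<in>carrier G. \<Sum>k\<in>carrier G. b k * (a g * x (tr (tr t (inv k)) (inv g))))"
        using t by (intro sum.cong refl)
          (simp add: m_assoc[symmetric] tr_tr inv_mult_group mult_ac)
      also have "\<dots> = (\<Sum>k\<in>carrier G. \<Sum>g\<in>carrier G. b k * (a g * x (tr (tr t (inv k)) (inv g))))"
        by (rule sum.swap)
      also have "\<dots> = (b \<odot>\<^bsub>bar n\<^esub> (a \<odot>\<^bsub>bar n\<^esub> x)) t"
        using t by (simp add: bar_simps sum_distrib_left tr_X)
      finally show ?thesis .
    qed (simp add: bar_simps)
  qed
  moreover have "\<one>\<^bsub>group_ring G\<^esub> \<odot>\<^bsub>bar n\<^esub> x = x" if "x \<in> carrier (bar n)" for x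
    using that fin
    by (auto simp: bar_simps group_ring_simps fun_eq_iff tr_one if_distrib[of "\<lambda>t. t * _"] cong: if_cong)
  ultimately show ?thesis
    by (intro right_module.intro right_module_axioms.intro ring_group_ring is_group)
      (auto simp: bar_simps group_ring_simps(2) distrib_right distrib_left sum.distrib)
qed

lemma bd_hom: "restrict (bd (Suc n)) (carrier (bar (Suc n))) \<in> mod_hom (group_ring G) (bar (Suc n)) (bar n)"
proof (rule mod_hom_restrictI[OF right_module_bar])
  fix a x assume "a \<in> carrier (group_ring G)" "x \<in> carrier (bar (Suc n))"
  show "bd (Suc n) (a \<odot>\<^bsub>bar (Suc n)\<^esub> x) = a \<odot>\<^bsub>bar n\<^esub> bd (Suc n) x"
  proof
    fix s
    show "bd (Suc n) (a \<odot>\<^bsub>bar (Suc n)\<^esub> x) s = (a \<odot>\<^bsub>bar n\<^esub> bd (Suc n) x) s"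
    proof (cases "s \<in> X (Suc n)")
      case s: True
      let ?Y = "X (Suc (Suc n))"
      have "bd (Suc n) (a \<odot>\<^bsub>bar (Suc n)\<^esub> x) s
        = (\<Sum>t\<in>?Y. \<Sum>g\<in>carrier G. a g * x (tr t (inv g)) * del (ind s) t)"
        using s by (simp add: bd_def bar_simps sum_distrib_right cong: sum.cong)
      also have "\<dots> = (\<Sum>g\<in>carrier G. \<Sum>t\<in>?Y. a g * x (tr t (inv g)) * del (ind s) t)"
        by (rule sum.swap)
      also have "\<dots> = (\<Sum>g\<in>carrier G. \<Sum>t\<in>?Y. a g * x (tr (tr t g) (inv g)) * del (ind s) (tr t g))"
        by (rule sum.cong[OF refl]) (rule sum_tr[symmetric])
      also have "\<dots> = (\<Sum>g\<in>carrier G. \<Sum>t\<in>?Y. a g * (x t * del (ind (tr s (inv g))) t))"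
        using s by (intro sum.cong refl) (simp add: tr_inv del_ind_tr mult.assoc)
      also have "\<dots> = (a \<odot>\<^bsub>bar n\<^esub> bd (Suc n) x) s"
        using s by (simp add: bar_simps bd_def tr_X sum_distrib_left)
      finally show ?thesis .
    qed (simp add: bd_def bar_simps)
  qed
qed (auto simp: bd_def bar_simps distrib_right sum.distrib fun_eq_iff)

end

section \<open>A basis of the bar modules over the group ring\<close>

context finite_group
begin

text \<open>Right translation acts freely on nonempty lists and every orbit contains exactly one
  list that begins with the identity. These lists are the basis, indexed by their tails.\<close>

definition bas :: "'g list \<Rightarrow> 'g list \<Rightarrow> int" where
  "bas l = ind (\<one> # l)"

definition coord :: "'g list \<Rightarrow> ('g list \<Rightarrow> int) \<Rightarrow> 'g \<Rightarrow> int" where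
  "coord l x g = (if g \<in> carrier G then x (tr (\<one> # l) g) else 0)"

lemma finsum_bar: "f \<in> A \<rightarrow> carrier (bar n) \<Longrightarrow> finite A \<Longrightarrow> finsum (bar n) f A t = (\<Sum>i\<in>A. f i t)"
proof (induction A rule: infinite_finite_induct)
  interpret right_module "group_ring G" "bar n" by (rule right_module_bar)
  case empty
  show ?case by (simp add: bar_simps)
next
  interpret right_module "group_ring G" "bar n" by (rule right_module_bar)
  case (insert i A)
  then show ?case by (simp add: M.finsum_insert bar_simps(3) Pi_iff)
qed auto

lemma tr_one_Cons: "g \<in> carrier G \<Longrightarrow> tr (\<one> # l) g = g # tr l g"
  by (simp add: tr_def)

lemma tr_eq_one_Cons_iff:
  assumes "h \<in> carrier G" "r \<in> X n" "l \<in> X n" "g \<in> carrier G"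
  shows "tr (h # r) (inv g) = \<one> # l \<longleftrightarrow> g = h \<and> l = tr r (inv h)"
proof -
  have "h \<otimes> inv g = \<one> \<longleftrightarrow> g = h"
    using assms by (metis inv_closed inv_equality inv_inv r_inv)
  then show ?thesis by (auto simp: tr_Cons)
qed

lemma based_module_bar: "based_module G (bar n) (X n) bas coord"
proof (intro based_module.intro based_module_axioms.intro coinvariants.intro is_group right_module_bar finite_X)
  fix l assume l: "l \<in> X n"
  show "bas l \<in> carrier (bar n)" using l by (auto simp: bas_def bar_simps ind_def Cons_X)
  fix x assume x: "x \<in> carrier (bar n)"
  show "coord l x \<in> carrier (group_ring G)" by (simp add: group_ring_simps coord_def)
  show "coord l (x \<oplus>\<^bsub>bar n\<^esub> y) = coord l x \<oplus>\<^bsub>group_ring G\<^esub> coord l y" for y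
    by (simp add: bar_simps group_ring_simps coord_def fun_eq_iff)
  show "coord l (a \<odot>\<^bsub>bar n\<^esub> x) = coord l x \<otimes>\<^bsub>group_ring G\<^esub> a" if a: "a \<in> carrier (group_ring G)" for a
  proof
    fix g
    show "coord l (a \<odot>\<^bsub>bar n\<^esub> x) g = (coord l x \<otimes>\<^bsub>group_ring G\<^esub> a) g"
    proof (cases "g \<in> carrier G")
      case g: True
      have l1: "\<one> # l \<in> X (Suc n)" using l by (simp add: Cons_X)
      have "coord l (a \<odot>\<^bsub>bar n\<^esub> x) g = (\<Sum>h\<in>carrier G. a h * x (tr (\<one> # l) (g \<otimes> inv h)))"
        using g l1 by (simp add: coord_def bar_simps tr_X tr_tr)
      also have "\<dots> = (\<Sum>k\<in>carrier G. x (tr (\<one> # l) k) * a (inv k \<otimes> g))"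
        by (rule sum.reindex_bij_witness[of _ "\<lambda>k. inv k \<otimes> g" "\<lambda>h. g \<otimes> inv h"])
          (use g in \<open>simp_all add: inv_mult_group m_assoc, simp_all add: m_assoc[symmetric]\<close>)
      also have "\<dots> = (coord l x \<otimes>\<^bsub>group_ring G\<^esub> a) g"
        using g by (subst group_ring_mult) (auto simp: group_ring_simps coord_def)
      finally show ?thesis .
    qed (simp add: coord_def group_ring_def)
  qed
next
  fix i j assume "i \<in> X n" "j \<in> X n"
  moreover from this have "g # tr i g = \<one> # j \<longleftrightarrow> g = \<one> \<and> i = j" for g by (auto simp: tr_one)
  ultimately show "coord i (bas j) = (if i = j then \<one>\<^bsub>group_ring G\<^esub> else \<zero>\<^bsub>group_ring G\<^esub>)"
    by (auto simp: coord_def bas_def ind_def group_ring_simps tr_one_Cons fun_eq_iff)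
next
  interpret right_module "group_ring G" "bar n" by (rule right_module_bar)
  fix x assume x: "x \<in> carrier (bar n)"
  show "x = finsum (bar n) (\<lambda>l. coord l x \<odot>\<^bsub>bar n\<^esub> bas l) (X n)"
  proof
    fix t
    have "(\<lambda>l. coord l x \<odot>\<^bsub>bar n\<^esub> bas l) \<in> X n \<rightarrow> carrier (bar n)"
      by (auto simp: bar_simps)
    then have "finsum (bar n) (\<lambda>l. coord l x \<odot>\<^bsub>bar n\<^esub> bas l) (X n) t
      = (\<Sum>l\<in>X n. (coord l x \<odot>\<^bsub>bar n\<^esub> bas l) t)"
      by (rule finsum_bar) (rule finite_X)
    also have "\<dots> = x t"
    proof (cases "t \<in> X (Suc n)")
      case True
      then obtain h r where t: "t = h # r" "h \<in> carrier G" "r \<in> X n" by (cases t) (auto simp: X_def)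
      \<comment> \<open>Only one summand reaches \<open>t = h # r\<close>: the orbit representative
        with tail \<open>tr r (inv h)\<close>, translated by \<open>h\<close>.\<close>
      have "(\<Sum>l\<in>X n. (coord l x \<odot>\<^bsub>bar n\<^esub> bas l) t)
        = (\<Sum>l\<in>X n. \<Sum>g\<in>carrier G. if h = g then if tr r (inv h) = l then x (tr (\<one> # l) g) else 0 else 0)"
        using True t
        by (intro sum.cong refl) (auto simp: bar_simps bas_def ind_def coord_def tr_eq_one_Cons_iff intro!: sum.cong)
      also have "\<dots> = x (tr (\<one> # tr r (inv h)) h)"
        using t fin finite_X[of n] by (simp add: tr_X)
      also have "\<dots> = x t" using t by (simp add: tr_one_Cons tr_inv)
      finally show ?thesis .
    next
      case False
      then show ?thesis using x by (simp add: bar_simps)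
    qed
    finally show "x t = finsum (bar n) (\<lambda>l. coord l x \<odot>\<^bsub>bar n\<^esub> bas l) (X n) t" ..
  qed
qed

definition bar_d :: "nat \<Rightarrow> ('g list \<Rightarrow> int) \<Rightarrow> 'g list \<Rightarrow> int" where
  "bar_d n = restrict (bd (Suc n)) (carrier (bar (Suc n)))"

definition bar_e :: "('g list \<Rightarrow> int) \<Rightarrow> int" where
  "bar_e = (\<lambda>x\<in>carrier (bar 0). \<Sum>t\<in>X 1. x t)"

text \<open>\<open>X 0\<close> contains just the empty list, so the lowest boundary is the
  augmentation, and exactness at degree 0 becomes the case \<open>n = 0\<close> of
  \<open>bd_image\<close>.\<close>

lemma bd_0: "bd 0 x = (\<lambda>s. if s = [] then \<Sum>t\<in>X 1. x t else 0)"
proof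
  have "del (ind []) t = (1 :: int)" if "t \<in> X (Suc 0)" for t :: "'g list"
    using that by (cases t) (auto simp: X_def ind_def)
  then show "bd 0 x s = (if s = [] then \<Sum>t\<in>X 1. x t else 0)" for s
    by (auto simp: bd_def X_0 cong: sum.cong)
qed

lemma bd_closed: "bd (Suc n) x \<in> carrier (bar n)"
  by (simp add: bd_def bar_simps)

lemma contract_closed: "contract n x \<in> carrier (bar n)"
  by (simp add: contract_def bar_simps)

lemma bd_image:
  "bd (Suc n) ` carrier (bar (Suc n)) = {x \<in> carrier (bar n). bd n x = (\<lambda>s. 0)}"
proof (intro equalityI subsetI)
  fix x assume "x \<in> {x \<in> carrier (bar n). bd n x = (\<lambda>s. 0)}"
  then have "\<And>t. t \<notin> X (Suc n) \<Longrightarrow> x t = 0" "bd n x = (\<lambda>s. 0)" by (auto simp: bar_simps)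
  from bd_contract[OF this] show "x \<in> bd (Suc n) ` carrier (bar (Suc n))"
    using contract_closed by (intro image_eqI[of _ _ "contract (Suc n) x"]) auto
qed (auto simp: bd_closed bd_bd)

theorem projective_resolution_bar:
  "projective_resolution (group_ring G) (trivial_module G) bar bar_d bar_e"
proof -
  have e: "bar_e \<in> mod_hom (group_ring G) (bar 0) (trivial_module G)"
    unfolding bar_e_def
  proof (rule mod_hom_intI[OF right_module_bar])
    fix a x assume a: "a \<in> carrier (group_ring G)"
    have "(\<Sum>t\<in>X 1. (a \<odot>\<^bsub>bar 0\<^esub> x) t) = (\<Sum>t\<in>X 1. \<Sum>g\<in>carrier G. a g * x (tr t (inv g)))"
      by (rule sum.cong) (auto simp: bar_simps)
    also have "\<dots> = (\<Sum>g\<in>carrier G. \<Sum>t\<in>X 1. a g * x (tr t (inv g)))" by (rule sum.swap)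
    also have "\<dots> = (\<Sum>g\<in>carrier G. \<Sum>t\<in>X 1. a g * x t)"
      by (rule sum.cong[OF refl], rule sum_tr) simp
    also have "\<dots> = aug a * (\<Sum>t\<in>X 1. x t)" by (simp add: aug_eq[OF a] sum_product)
    finally show "(\<Sum>t\<in>X 1. (a \<odot>\<^bsub>bar 0\<^esub> x) t) = aug a * (\<Sum>t\<in>X 1. x t)" .
  qed (simp add: bar_simps sum.distrib)
  have "k \<in> bar_e ` carrier (bar 0)" for k
  proof (rule image_eqI)
    show "(\<lambda>t. k * ind [\<one>] t) \<in> carrier (bar 0)" by (auto simp: bar_simps ind_def X_def)
    then show "k = bar_e (\<lambda>t. k * ind [\<one>] t)"
      using finite_X[of 1] by (simp add: bar_e_def sum_distrib_left[symmetric] ind_def) (auto simp: X_def)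
  qed
  then have im: "bar_e ` carrier (bar 0) = carrier (trivial_module G)"
    by (auto simp: trivial_module_simps)
  have ker0: "bar_d 0 ` carrier (bar (Suc 0)) = a_kernel (bar 0) (trivial_module G) bar_e"
    using bd_image[of 0]
    by (auto simp: bar_d_def a_kernel_def kernel_def bar_e_def bd_0 fun_eq_iff trivial_module_def)
  have kerS: "bar_d (Suc n) ` carrier (bar (Suc (Suc n))) = a_kernel (bar (Suc n)) (bar n) (bar_d n)" for n
    using bd_image[of "Suc n"] by (auto simp: bar_d_def a_kernel_def kernel_def bar_simps(2))
  show ?thesis
    unfolding projective_resolution_def
    using right_module_trivial_module[OF is_group] based_module.projective[OF based_module_bar] bd_hom
      e im ker0 kerS by (simp add: bar_d_def)
qed

subsection \<open>Coboundary matrices twisted by a linear character\<close>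

lemma Nil_X [simp]: "[] \<notin> X (Suc n)"
  by (simp add: X_def)

text \<open>A function \<open>v\<close> on the basis \<^term>\<open>X n\<close> of \<^term>\<open>bar n\<close> extends uniquely to a function
  \<open>ext \<chi> v\<close> on \<^term>\<open>X (Suc n)\<close> with \<open>ext \<chi> v (t g) = \<chi> g * ext \<chi> v t\<close>.  In these coordinates
  \<open>cob \<chi>\<close> is the matrix of the coboundary, and \<open>hty \<chi>\<close> that of the contraction made equivariant by
  summing over the group.\<close>

definition nrm :: "'g list \<Rightarrow> 'g list" where
  "nrm t = tr (tl t) (inv (hd t))"

definition ext :: "('g \<Rightarrow> 'a) \<Rightarrow> ('g list \<Rightarrow> 'a) \<Rightarrow> 'g list \<Rightarrow> 'a::comm_ring_1" where
  "ext \<chi> v t = \<chi> (hd t) * v (nrm t)"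

definition cob :: "('g \<Rightarrow> 'a) \<Rightarrow> 'g list \<Rightarrow> 'g list \<Rightarrow> 'a::comm_ring_1" where
  "cob \<chi> l s = del (ext \<chi> (ind s)) (\<one> # l)"

definition hty :: "('g \<Rightarrow> 'a) \<Rightarrow> 'g list \<Rightarrow> 'g list \<Rightarrow> 'a::comm_ring_1" where
  "hty \<chi> l s = (\<Sum>g\<in>carrier G. ext \<chi> (ind s) (g # \<one> # l))"

lemma nrm_X: "t \<in> X (Suc n) \<Longrightarrow> nrm t \<in> X n"
  by (cases t) (auto simp: nrm_def Cons_X intro!: tr_X)

lemma nrm_Cons_one: "l \<in> X n \<Longrightarrow> nrm (\<one> # l) = l"
  by (simp add: nrm_def tr_one)

lemma nrm_tr: "t \<in> X (Suc n) \<Longrightarrow> g \<in> carrier G \<Longrightarrow> nrm (tr t g) = nrm t"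
  by (cases t) (auto simp: nrm_def Cons_X tr_Cons tr_tr inv_mult_group m_assoc[symmetric])

lemma one_Cons_nrm: "t \<in> X (Suc n) \<Longrightarrow> \<one> # nrm t = tr t (inv (hd t))"
  by (cases t) (auto simp: nrm_def Cons_X tr_Cons)

lemma ext_expand:
  fixes v :: "'g list \<Rightarrow> 'a::comm_ring_1"
  assumes "t \<in> X (Suc n)"
  shows "ext \<chi> v t = (\<Sum>s\<in>X n. v s * ext \<chi> (ind s) t)"
proof -
  have "ext \<chi> v t = \<chi> (hd t) * (\<Sum>s\<in>X n. v s * ind s (nrm t))"
    using nrm_X[OF assms] by (simp add: ext_def sum_ind finite_X)
  then show ?thesis by (simp add: ext_def sum_distrib_left mult.left_commute)
qed

lemma cob_apply:
  fixes v :: "'g list \<Rightarrow> 'a::comm_ring_1"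
  assumes "l \<in> X (Suc n)"
  shows "(\<Sum>s\<in>X n. cob \<chi> l s * v s) = del (ext \<chi> v) (\<one> # l)"
proof -
  have "del (ext \<chi> v) (\<one> # l) = del (\<lambda>t. \<Sum>s\<in>X n. v s * ext \<chi> (ind s) t) (\<one> # l)"
    by (rule del_cong_X[of _ "Suc n"]) (use assms in \<open>auto simp: Cons_X intro: ext_expand\<close>)
  then show ?thesis by (simp add: del_sum del_mult cob_def mult.commute)
qed

lemma hty_apply:
  fixes v :: "'g list \<Rightarrow> 'a::comm_ring_1"
  assumes "l \<in> X n"
  shows "(\<Sum>s\<in>X (Suc n). hty \<chi> l s * v s) = (\<Sum>g\<in>carrier G. ext \<chi> v (g # \<one> # l))"
proof -
  have "(\<Sum>g\<in>carrier G. ext \<chi> v (g # \<one> # l)) = (\<Sum>g\<in>carrier G. \<Sum>s\<in>X (Suc n). v s * ext \<chi> (ind s) (g # \<one> # l))"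
    by (rule sum.cong[OF refl], rule ext_expand) (use assms in \<open>simp add: Cons_X\<close>)
  also have "\<dots> = (\<Sum>s\<in>X (Suc n). \<Sum>g\<in>carrier G. v s * ext \<chi> (ind s) (g # \<one> # l))"
    by (rule sum.swap)
  finally show ?thesis by (simp add: hty_def sum_distrib_left[symmetric] mult.commute)
qed

lemma sum_right_translate:
  assumes "g \<in> carrier G"
  shows "(\<Sum>h\<in>carrier G. f (h \<otimes> g)) = (\<Sum>h\<in>carrier G. f h)"
  by (rule sum.reindex_bij_witness[of _ "\<lambda>h. h \<otimes> inv g" "\<lambda>h. h \<otimes> g"])
    (simp_all add: assms m_assoc)

context
  fixes \<chi> :: "'g \<Rightarrow> 'a::comm_ring_1"
  assumes chi_one: "\<chi> \<one> = 1" and chi_mult: "\<And>g h. g \<in> carrier G \<Longrightarrow> h \<in> carrier G \<Longrightarrow> \<chi> (g \<otimes> h) = \<chi> g * \<chi> h"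
begin

lemma ext_tr:
  assumes "t \<in> X (Suc n)" "g \<in> carrier G"
  shows "ext \<chi> v (tr t g) = \<chi> g * ext \<chi> v t"
proof -
  have "\<chi> (hd (tr t g)) = \<chi> g * \<chi> (hd t)"
    using assms by (cases t) (auto simp: Cons_X tr_Cons chi_mult mult.commute)
  then show ?thesis using nrm_tr[OF assms] by (simp add: ext_def mult.assoc)
qed

lemma chi_inv: "g \<in> carrier G \<Longrightarrow> \<chi> g * \<chi> (inv g) = 1"
  using chi_mult[of g "inv g"] chi_one by simp

text \<open>Translating a list so that it begins with the identity shows that an equivariant
  function is the extension of its values on the basis. This transports identities for
  \<open>del\<close> to the matrices \<open>cob\<close> and \<open>hty\<close>.\<close>

lemma ext_equivariant:
  assumes w: "\<And>t g. t \<in> X (Suc n) \<Longrightarrow> g \<in> carrier G \<Longrightarrow> w (tr t g) = \<chi> g * w t" and t: "t \<in> X (Suc n)"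
  shows "ext \<chi> (\<lambda>l. w (\<one> # l)) t = w t"
proof -
  have h: "hd t \<in> carrier G" using t by (cases t) (auto simp: Cons_X)
  have "ext \<chi> (\<lambda>l. w (\<one> # l)) t = \<chi> (hd t) * (\<chi> (inv (hd t)) * w t)"
    unfolding ext_def one_Cons_nrm[OF t] using w[OF t] h by simp
  then show ?thesis by (simp add: mult.assoc[symmetric] chi_inv[OF h])
qed

lemma del_ext_tr:
  assumes "t \<in> X (Suc (Suc n))" "g \<in> carrier G"
  shows "del (ext \<chi> v) (tr t g) = \<chi> g * del (ext \<chi> v) t"
proof -
  have "del (ext \<chi> v) (tr t g) = del (\<lambda>s. ext \<chi> v (tr s g)) t" unfolding tr_def by (rule del_map)
  also have "\<dots> = del (\<lambda>s. \<chi> g * ext \<chi> v s) t"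
    by (rule del_cong_X[OF assms(1)]) (rule ext_tr[OF _ assms(2)])
  finally show ?thesis by (simp add: del_mult)
qed

lemma cob_cob:
  assumes "l \<in> X (Suc (Suc n))"
  shows "(\<Sum>s\<in>X (Suc n). cob \<chi> l s * (\<Sum>r\<in>X n. cob \<chi> s r * v r)) = 0"
proof -
  have "(\<Sum>s\<in>X (Suc n). cob \<chi> l s * (\<Sum>r\<in>X n. cob \<chi> s r * v r))
    = (\<Sum>s\<in>X (Suc n). cob \<chi> l s * del (ext \<chi> v) (\<one> # s))"
    by (rule sum.cong) (simp_all add: cob_apply)
  also have "\<dots> = del (ext \<chi> (\<lambda>s. del (ext \<chi> v) (\<one> # s))) (\<one> # l)" by (rule cob_apply[OF assms])
  also have "\<dots> = del (del (ext \<chi> v)) (\<one> # l)"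
  proof (rule del_cong_X)
    show "\<one> # l \<in> X (Suc (Suc (Suc n)))" using assms by (simp add: Cons_X)
  qed (rule ext_equivariant[OF del_ext_tr])
  finally show ?thesis by (simp only: del_del)
qed

text \<open>For fixed g, prepending g is a contraction: \<open>del u (g # t)\<close> is
  \<open>u t\<close> minus \<open>del (\<lambda>s. u (g # s)) t\<close>, so the two composites add
  up to the identity. Summing over g makes the operator equivariant and turns the identity into
  |G|.\<close>

lemma cob_hty:
  assumes l: "l \<in> X (Suc n)"
  shows "(\<Sum>s\<in>X n. cob \<chi> l s * (\<Sum>r\<in>X (Suc n). hty \<chi> s r * v r))
    + (\<Sum>s\<in>X (Suc (Suc n)). hty \<chi> l s * (\<Sum>r\<in>X (Suc n). cob \<chi> s r * v r))
    = of_nat (card (carrier G)) * v l"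
proof -
  \<comment> \<open>The averaged contraction applied to the extension of \<open>v\<close>; it is
    equivariant because the summation variable can be translated by \<open>g\<close>.\<close>
  let ?w = "\<lambda>t. \<Sum>g\<in>carrier G. ext \<chi> v (g # t)"
  have w: "?w (tr t g) = \<chi> g * ?w t" if "t \<in> X (Suc n)" "g \<in> carrier G" for t g
  proof -
    have "?w (tr t g) = (\<Sum>h\<in>carrier G. ext \<chi> v ((h \<otimes> g) # tr t g))"
      by (rule sum_right_translate[OF that(2), symmetric])
    also have "\<dots> = (\<Sum>h\<in>carrier G. \<chi> g * ext \<chi> v (h # t))"
      by (rule sum.cong[OF refl], subst tr_Cons[symmetric], rule ext_tr) (use that in \<open>auto simp: Cons_X\<close>)
    finally show ?thesis by (simp add: sum_distrib_left)
  qed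
  have l1: "\<one> # l \<in> X (Suc (Suc n))" using l by (simp add: Cons_X)
  have "(\<Sum>s\<in>X n. cob \<chi> l s * (\<Sum>r\<in>X (Suc n). hty \<chi> s r * v r)) = (\<Sum>s\<in>X n. cob \<chi> l s * ?w (\<one> # s))"
    by (rule sum.cong) (simp_all add: hty_apply)
  also have "\<dots> = del (ext \<chi> (\<lambda>s. ?w (\<one> # s))) (\<one> # l)" by (rule cob_apply[OF l])
  also have "\<dots> = del ?w (\<one> # l)"
    by (rule del_cong_X[OF l1]) (rule ext_equivariant[OF w])
  also have "\<dots> = (\<Sum>g\<in>carrier G. del (\<lambda>t. ext \<chi> v (g # t)) (\<one> # l))" by (rule del_sum)
  finally have 1: "(\<Sum>s\<in>X n. cob \<chi> l s * (\<Sum>r\<in>X (Suc n). hty \<chi> s r * v r))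
    = (\<Sum>g\<in>carrier G. del (\<lambda>t. ext \<chi> v (g # t)) (\<one> # l))" .
  have "(\<Sum>s\<in>X (Suc (Suc n)). hty \<chi> l s * (\<Sum>r\<in>X (Suc n). cob \<chi> s r * v r))
    = (\<Sum>s\<in>X (Suc (Suc n)). hty \<chi> l s * del (ext \<chi> v) (\<one> # s))"
    by (rule sum.cong) (simp_all add: cob_apply)
  also have "\<dots> = (\<Sum>g\<in>carrier G. ext \<chi> (\<lambda>s. del (ext \<chi> v) (\<one> # s)) (g # \<one> # l))"
    by (rule hty_apply[OF l])
  also have "\<dots> = (\<Sum>g\<in>carrier G. del (ext \<chi> v) (g # \<one> # l))"
    by (rule sum.cong[OF refl], rule ext_equivariant[OF del_ext_tr[of _ "Suc n"]]) (use l1 in \<open>auto simp: Cons_X\<close>)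
  also have "\<dots> = of_nat (card (carrier G)) * ext \<chi> v (\<one> # l)
    - (\<Sum>g\<in>carrier G. del (\<lambda>t. ext \<chi> v (g # t)) (\<one> # l))"
    by (subst del.simps(2)) (simp add: sum_subtractf del: del.simps)
  finally show ?thesis unfolding 1 by (simp add: ext_def chi_one nrm_Cons_one[OF l])
qed

text \<open>In degree 0 one of the two composites is missing, and the other leaves |G| minus the
  character sum. This is 0 for the trivial character and |G| for a nontrivial complex one, the
  source of the difference of ranks.\<close>

lemma hty_cob_0:
  "(\<Sum>s\<in>X 1. hty \<chi> [] s * (\<Sum>r\<in>X 0. cob \<chi> s r * v r))
    = (of_nat (card (carrier G)) - (\<Sum>g\<in>carrier G. \<chi> g)) * v []"
proof -
  have "(\<Sum>s\<in>X 1. hty \<chi> [] s * (\<Sum>r\<in>X 0. cob \<chi> s r * v r)) = (\<Sum>s\<in>X (Suc 0). hty \<chi> [] s * del (ext \<chi> v) (\<one> # s))"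
    by (rule sum.cong) (simp_all add: cob_apply)
  also have "\<dots> = (\<Sum>g\<in>carrier G. ext \<chi> (\<lambda>s. del (ext \<chi> v) (\<one> # s)) (g # \<one> # []))"
    by (rule hty_apply) (simp add: X_0)
  also have "\<dots> = (\<Sum>g\<in>carrier G. del (ext \<chi> v) [g, \<one>])"
    by (rule sum.cong[OF refl], rule ext_equivariant[OF del_ext_tr[of _ 0]]) (auto simp: Cons_X X_0)
  also have "\<dots> = (\<Sum>g\<in>carrier G. (1 - \<chi> g) * v [])"
    by (simp add: ext_def nrm_def tr_def chi_one algebra_simps)
  also have "\<dots> = (\<Sum>g\<in>carrier G. 1 - \<chi> g) * v []" by (simp only: sum_distrib_right)
  finally show ?thesis by (simp add: sum_subtractf)
qed

end

end

section \<open>Diagonalisation of matrices\<close>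

text \<open>Invertibility through an explicit two-sided inverse, which entrywise ring homomorphisms
  carry along.\<close>

definition GL :: "nat \<Rightarrow> 'a::comm_ring_1 mat set" where
  "GL n = {U \<in> carrier_mat n n. \<exists>U' \<in> carrier_mat n n. U * U' = 1\<^sub>m n \<and> U' * U = 1\<^sub>m n}"

definition mequiv :: "'a::comm_ring_1 mat \<Rightarrow> 'a mat \<Rightarrow> bool" where
  "mequiv A B \<longleftrightarrow> (\<exists>U \<in> GL (dim_row A). \<exists>V \<in> GL (dim_col A). B = U * A * V)"

lemma GL_carrier: "U \<in> GL n \<Longrightarrow> U \<in> carrier_mat n n"
  by (simp add: GL_def)

lemma GL_I: "U \<in> carrier_mat n n \<Longrightarrow> U' \<in> carrier_mat n n \<Longrightarrow> U * U' = 1\<^sub>m n \<Longrightarrow> U' * U = 1\<^sub>m n \<Longrightarrow> U \<in> GL n"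
  by (auto simp: GL_def)

lemma GL_one: "1\<^sub>m n \<in> GL n"
  by (rule GL_I[of _ _ "1\<^sub>m n"]) auto

lemma GL_mult:
  assumes "U \<in> GL n" "V \<in> GL n"
  shows "U * V \<in> GL n"
proof -
  from assms obtain U' V' where U: "U \<in> carrier_mat n n" "U' \<in> carrier_mat n n" "U * U' = 1\<^sub>m n" "U' * U = 1\<^sub>m n"
    and V: "V \<in> carrier_mat n n" "V' \<in> carrier_mat n n" "V * V' = 1\<^sub>m n" "V' * V = 1\<^sub>m n"
    by (auto simp: GL_def)
  have *: "A * B * (B' * A') = 1\<^sub>m n"
    if c: "A \<in> carrier_mat n n" "A' \<in> carrier_mat n n" "B \<in> carrier_mat n n" "B' \<in> carrier_mat n n"
      and i: "A * A' = 1\<^sub>m n" "B * B' = 1\<^sub>m n" for A A' B B' :: "'a mat"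
  proof -
    have "A * B * (B' * A') = A * (B * (B' * A'))"
      by (rule assoc_mult_mat[of _ n n _ n _ n]) (use c in auto)
    also have "B * (B' * A') = B * B' * A'"
      by (rule assoc_mult_mat[of _ n n _ n _ n, symmetric]) (use c in auto)
    finally show ?thesis using c i by simp
  qed
  show ?thesis
    using U V by (intro GL_I[of _ _ "V' * U'"] *) auto
qed

lemma GL_transpose:
  assumes "U \<in> GL n" shows "transpose_mat U \<in> GL n"
proof -
  from assms obtain U' where U: "U \<in> carrier_mat n n" "U' \<in> carrier_mat n n" "U * U' = 1\<^sub>m n" "U' * U = 1\<^sub>m n"
    by (auto simp: GL_def)
  have "transpose_mat U * transpose_mat U' = 1\<^sub>m n" "transpose_mat U' * transpose_mat U = 1\<^sub>m n"
    unfolding transpose_mult[OF U(2,1), symmetric] transpose_mult[OF U(1,2), symmetric] U(3,4) by simp_all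
  with U show ?thesis by (intro GL_I[of _ _ "transpose_mat U'"]) auto
qed

lemma mequiv_refl: "mequiv A A"
  unfolding mequiv_def by (rule bexI[OF _ GL_one], rule bexI[OF _ GL_one]) simp

lemma mequiv_dim: "mequiv A B \<Longrightarrow> dim_row B = dim_row A \<and> dim_col B = dim_col A"
  by (auto simp: mequiv_def dest!: GL_carrier)

lemma mequiv_trans:
  assumes "mequiv A B" "mequiv B C" shows "mequiv A C"
proof -
  let ?n = "dim_row A" and ?m = "dim_col A"
  have A: "A \<in> carrier_mat ?n ?m" by simp
  from assms(1) obtain U V where UV: "U \<in> GL ?n" "V \<in> GL ?m" "B = U * A * V" by (auto simp: mequiv_def)
  from assms(2) mequiv_dim[OF assms(1)] obtain U2 V2 where UV2: "U2 \<in> GL ?n" "V2 \<in> GL ?m" "C = U2 * B * V2"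
    by (auto simp: mequiv_def)
  note [simp] = GL_carrier[OF UV(1)] GL_carrier[OF UV(2)] GL_carrier[OF UV2(1)] GL_carrier[OF UV2(2)] A
  have "C = U2 * (U * A * V) * V2" using UV UV2 by simp
  also have "\<dots> = U2 * (U * A) * V * V2"
    by (subst assoc_mult_mat[of U2 ?n ?n "U * A" ?m V ?m, symmetric]) (auto intro!: mult_carrier_mat[of _ _ ?n])
  also have "\<dots> = U2 * U * A * V * V2"
    by (subst assoc_mult_mat[of U2 ?n ?n U ?n A ?m, symmetric]) auto
  also have "\<dots> = U2 * U * A * (V * V2)"
    by (rule assoc_mult_mat[of _ ?n ?m V ?m V2 ?m]) (auto intro!: mult_carrier_mat[of _ _ ?n])
  finally show ?thesis
    unfolding mequiv_def using GL_mult[OF UV2(1) UV(1)] GL_mult[OF UV(2) UV2(2)] by blast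
qed

lemma mequiv_transpose:
  assumes "mequiv A B" shows "mequiv (transpose_mat A) (transpose_mat B)"
proof -
  let ?n = "dim_row A" and ?m = "dim_col A"
  from assms obtain U V where UV: "U \<in> GL ?n" "V \<in> GL ?m" "B = U * A * V" by (auto simp: mequiv_def)
  note [simp] = GL_carrier[OF UV(1)] GL_carrier[OF UV(2)]
  have UA: "U * A \<in> carrier_mat ?n ?m" by (rule mult_carrier_mat[of _ _ ?n]) auto
  have "transpose_mat B = transpose_mat V * (transpose_mat A * transpose_mat U)"
    unfolding UV(3) by (subst transpose_mult[OF UA, of V ?m], simp, subst transpose_mult[of U ?n ?n A ?m]) auto
  also have "\<dots> = transpose_mat V * transpose_mat A * transpose_mat U"
    by (rule assoc_mult_mat[of _ ?m ?m _ ?n _ ?n, symmetric]) auto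
  finally show ?thesis
    unfolding mequiv_def
    by (intro bexI[of _ "transpose_mat V"] bexI[of _ "transpose_mat U"])
      (simp_all add: GL_transpose UV)
qed

lemma mequiv_left:
  assumes "U \<in> GL (dim_row A)" shows "mequiv A (U * A)"
  unfolding mequiv_def
  by (intro bexI[OF _ assms] bexI[OF _ GL_one]) (use GL_carrier[OF assms] in auto)

lemma mequiv_swap:
  assumes "k < dim_row A" "l < dim_row A" shows "mequiv A (swaprows k l A)"
proof -
  let ?n = "dim_row A"
  have "swaprows_mat ?n k l \<in> GL ?n"
    by (rule GL_I[OF _ _ swaprows_mat_inv[OF assms] swaprows_mat_inv[OF assms]]) auto
  from mequiv_left[OF this] show ?thesis
    using swaprows_mat[of A ?n "dim_col A" k l] assms by simp
qed

text \<open>The nonzero entries carry no divisibility chain; what is read off later is their number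
  and their product.\<close>

definition diagonal_form :: "nat \<Rightarrow> (nat \<Rightarrow> 'a::zero) \<Rightarrow> 'a mat \<Rightarrow> bool" where
  "diagonal_form \<rho> \<delta> A \<longleftrightarrow> \<rho> \<le> dim_row A \<and> \<rho> \<le> dim_col A \<and> (\<forall>i<\<rho>. \<delta> i \<noteq> 0) \<and>
    (\<forall>i<dim_row A. \<forall>j<dim_col A. A $$ (i, j) = (if i = j \<and> i < \<rho> then \<delta> i else 0))"

lemma diagonal_form_transpose: "diagonal_form \<rho> \<delta> A \<Longrightarrow> diagonal_form \<rho> \<delta> (transpose_mat A)"
  by (auto simp: diagonal_form_def)

text \<open>A single unipotent matrix performs all row operations at once; its inverse has the
  opposite multipliers.\<close>

lemma mequiv_clear_column:
  fixes A :: "'a::comm_ring_1 mat"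
  assumes "0 < dim_row A" "0 < dim_col A"
  shows "\<exists>B. mequiv A B \<and> (\<forall>j<dim_col A. B $$ (0, j) = A $$ (0, j)) \<and>
    (\<forall>i<dim_row A. \<forall>j<dim_col A. i > 0 \<longrightarrow> B $$ (i, j) = A $$ (i, j) - q i * A $$ (0, j))"
proof -
  let ?n = "dim_row A" and ?m = "dim_col A"
  let ?U = "\<lambda>q. mat ?n ?n (\<lambda>(i, j). if i = j then 1 else if j = 0 then - q i else 0 :: 'a)"
  have sc: "(?U q * B) $$ (i, j) = (if i = 0 then B $$ (0, j) else B $$ (i, j) - q i * B $$ (0, j))"
    if B: "B \<in> carrier_mat ?n k" and ij: "i < ?n" "j < k" for B :: "'a mat" and q i j k
  proof -
    have "(?U q * B) $$ (i, j) = (\<Sum>l\<in>{0..<?n}. (if i = l then 1 else if l = 0 then - q i else 0) * B $$ (l, j))"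
      using B ij by (simp add: scalar_prod_def)
    also have "\<dots> = (\<Sum>l\<in>{0..<?n}. (if i = l then B $$ (l, j) else 0) + (if l = 0 then if i = 0 then 0 else - q i * B $$ (l, j) else 0))"
      by (rule sum.cong) auto
    also have "\<dots> = B $$ (i, j) + (if i = 0 then 0 else - q i * B $$ (0, j))"
      using ij assms by (simp add: sum.distrib)
    finally show ?thesis by simp
  qed
  have inv: "?U q * ?U (\<lambda>i. - q i) = 1\<^sub>m ?n" for q
    by (rule eq_matI) (auto simp del: index_mult_mat(1) simp: sc[of _ ?n] one_mat_def)
  have "?U (\<lambda>i. - q i) * ?U q = 1\<^sub>m ?n" using inv[of "\<lambda>i. - q i"] unfolding minus_minus .
  then have "?U q \<in> GL ?n" by (intro GL_I[OF _ _ inv[of q]]) auto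
  from mequiv_left[OF this] show ?thesis
    using sc[of A ?m _ _ q] assms by (intro exI[of _ "?U q * A"]) (auto simp del: index_mult_mat(1))
qed

text \<open>The hypothesis covers the integers with the absolute value as well as a field with
  constant \<open>f\<close>, where no remainders arise. A pivot of minimal size among all equivalent
  matrices divides its row and column, which replaces a termination argument for repeated
  division.\<close>

theorem ex_diagonal_form:
  fixes A :: "'a::idom mat" and f :: "'a \<Rightarrow> nat"
  assumes euclid: "\<And>a b. b \<noteq> 0 \<Longrightarrow> \<exists>q. a - q * b = 0 \<or> f (a - q * b) < f b"
  shows "\<exists>B \<rho> \<delta>. mequiv A B \<and> diagonal_form \<rho> \<delta> B"
proof (induction "dim_row A" arbitrary: A)
  case 0
  then show ?case
    using mequiv_refl[of A] by - (rule exI[of _ A], rule exI[of _ 0], auto simp: diagonal_form_def)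
next
  case (Suc n)
  let ?m = "dim_col A"
  let ?P = "\<lambda>k. \<exists>B i j. mequiv A B \<and> i < Suc n \<and> j < ?m \<and> B $$ (i, j) \<noteq> 0 \<and> f (B $$ (i, j)) = k"
  show ?case
  proof (cases "\<exists>k. ?P k")
    case False
    then have "A $$ (i, j) = 0" if "i < Suc n" "j < ?m" for i j
      using mequiv_refl[of A] that by blast
    then show ?thesis
      using mequiv_refl[of A] Suc(2)
      by - (rule exI[of _ A], rule exI[of _ 0], auto simp: diagonal_form_def)
  next
    case True
    define k where "k = (LEAST k. ?P k)"
    have "?P k" unfolding k_def by (rule LeastI_ex[OF True])
    then obtain B i j where B: "mequiv A B" "i < Suc n" "j < ?m" "B $$ (i, j) \<noteq> 0" "f (B $$ (i, j)) = k"
      by blast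
    have min: "k \<le> f (C $$ (i, j))" if "mequiv A C" "i < Suc n" "j < ?m" "C $$ (i, j) \<noteq> 0" for C i j
      unfolding k_def by (rule Least_le) (use that in blast)
    have dB: "dim_row B = Suc n" "dim_col B = ?m" using mequiv_dim[OF B(1)] Suc(2) by auto
    \<comment> \<open>The pivot is moved to the corner; columns are exchanged as rows of the
      transpose.\<close>
    let ?C = "transpose_mat (swaprows 0 j (transpose_mat (swaprows 0 i B)))"
    have s1: "mequiv B (swaprows 0 i B)" by (rule mequiv_swap) (use dB B in auto)
    have s2: "mequiv (transpose_mat (swaprows 0 i B)) (swaprows 0 j (transpose_mat (swaprows 0 i B)))"
      by (rule mequiv_swap) (use dB B in auto)
    have "mequiv (swaprows 0 i B) ?C" using mequiv_transpose[OF s2] by (simp only: transpose_transpose)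
    then have C: "mequiv A ?C" by (rule mequiv_trans[OF mequiv_trans[OF B(1) s1]])
    define a where "a = ?C $$ (0, 0)"
    have "a = B $$ (i, j)" unfolding a_def using dB B by auto
    with B have a: "a \<noteq> 0" "f a = k" by auto
    have dC: "dim_row ?C = Suc n" "dim_col ?C = ?m" using dB by auto
    define q where "q i = (SOME q. ?C $$ (i, 0) - q * a = 0 \<or> f (?C $$ (i, 0) - q * a) < f a)" for i
    have q: "?C $$ (i, 0) - q i * a = 0 \<or> f (?C $$ (i, 0) - q i * a) < f a" for i
      unfolding q_def by (rule someI_ex) (rule euclid[OF a(1)])
    obtain D where D: "mequiv ?C D" "\<And>j. j < ?m \<Longrightarrow> D $$ (0, j) = ?C $$ (0, j)"
      "\<And>i j. i < Suc n \<Longrightarrow> j < ?m \<Longrightarrow> i > 0 \<Longrightarrow> D $$ (i, j) = ?C $$ (i, j) - q i * ?C $$ (0, j)"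
      using mequiv_clear_column[of ?C q] dC B(3) by auto
    have AD: "mequiv A D" by (rule mequiv_trans[OF C D(1)])
    have dD: "dim_row D = Suc n" "dim_col D = ?m" using mequiv_dim[OF AD] Suc(2) by auto
    have D00: "D $$ (0, 0) = a" using D(2)[of 0] B(3) by (simp add: a_def)
    \<comment> \<open>A nonzero remainder would be an entry smaller than the pivot in a matrix
      equivalent to \<open>A\<close>.\<close>
    have Di0: "D $$ (i, 0) = 0" if "i < Suc n" "i > 0" for i
      using D(3)[of i 0] q[of i] min[OF AD that(1), of 0] that B(3) a(2) unfolding a_def[symmetric] by fastforce
    define r where "r j = (SOME q. D $$ (0, j) - q * a = 0 \<or> f (D $$ (0, j) - q * a) < f a)" for j
    have r: "D $$ (0, j) - r j * a = 0 \<or> f (D $$ (0, j) - r j * a) < f a" for j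
      unfolding r_def by (rule someI_ex) (rule euclid[OF a(1)])
    obtain E' where E': "mequiv (transpose_mat D) E'"
      "\<And>i. i < Suc n \<Longrightarrow> E' $$ (0, i) = transpose_mat D $$ (0, i)"
      "\<And>i j. j < ?m \<Longrightarrow> i < Suc n \<Longrightarrow> j > 0 \<Longrightarrow>
        E' $$ (j, i) = transpose_mat D $$ (j, i) - r j * transpose_mat D $$ (0, i)"
      using mequiv_clear_column[of "transpose_mat D" r] dD B(3) by auto
    define E where "E = transpose_mat E'"
    have dE': "dim_row E' = ?m" "dim_col E' = Suc n" using mequiv_dim[OF E'(1)] dD by auto
    have AE: "mequiv A E" unfolding E_def using mequiv_trans[OF AD] mequiv_transpose[OF E'(1)] by simp
    have dE: "dim_row E = Suc n" "dim_col E = ?m" using dE' by (auto simp: E_def)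
    have E00: "E $$ (0, 0) = a" using E'(2)[of 0] dD dE' B(3) D00 by (simp add: E_def)
    \<comment> \<open>Clearing leaves row 0 of the transpose alone, so the column cleared before
      stays zero.\<close>
    have Ei0: "E $$ (i, 0) = 0" if "i < Suc n" "i > 0" for i
      using E'(2)[of i] dD dE' B(3) Di0[OF that] that by (simp add: E_def)
    have E0j: "E $$ (0, j) = 0" if "j < ?m" "j > 0" for j
    proof (rule ccontr)
      assume nz: "E $$ (0, j) \<noteq> 0"
      have "E $$ (0, j) = D $$ (0, j) - r j * a"
        using E'(3)[of j 0] dD dE' that D00 by (simp add: E_def)
      then show False using r[of j] min[OF AE _ that(1) nz] a(2) nz by simp
    qed
    let ?m' = "?m - 1"
    have m: "?m = Suc ?m'" using B(3) by simp
    define A' where "A' = mat n ?m' (\<lambda>(i, j). E $$ (Suc i, Suc j))"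
    have dA': "dim_row A' = n" "dim_col A' = ?m'" by (auto simp: A'_def)
    \<comment> \<open>Bordering an invertible matrix by 1 extends a diagonalisation of the lower
      block to the whole matrix.\<close>
    let ?b = "\<lambda>n m U. four_block_mat (mat 1 1 (\<lambda>_. 1)) (0\<^sub>m 1 m) (0\<^sub>m n 1) U"
    have block: "E = four_block_mat (mat 1 1 (\<lambda>_. a)) (0\<^sub>m 1 ?m') (0\<^sub>m n 1) A'"
    proof (rule eq_matI)
      fix i j assume "i < dim_row (four_block_mat (mat 1 1 (\<lambda>_. a)) (0\<^sub>m 1 ?m') (0\<^sub>m n 1) A')"
        "j < dim_col (four_block_mat (mat 1 1 (\<lambda>_. a)) (0\<^sub>m 1 ?m') (0\<^sub>m n 1) A')"
      then show "E $$ (i, j) = four_block_mat (mat 1 1 (\<lambda>_. a)) (0\<^sub>m 1 ?m') (0\<^sub>m n 1) A' $$ (i, j)"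
        using E00 Ei0[of i] E0j[of j] dE m by (cases i; cases j) (auto simp: A'_def)
    qed (use dE m in \<open>auto simp: A'_def\<close>)
    from Suc(1)[of A'] dA' obtain B' \<rho> \<delta> where B': "mequiv A' B'" "diagonal_form \<rho> \<delta> B'" by auto
    then obtain U V where UV: "U \<in> GL n" "V \<in> GL ?m'" "B' = U * A' * V" using dA' by (auto simp: mequiv_def)
    have one: "1\<^sub>m (Suc k) = ?b k k (1\<^sub>m k :: 'a mat)" for k
      by (rule eq_matI) (auto simp: four_block_mat_def Let_def one_mat_def)
    have bGL: "?b k k W \<in> GL (Suc k)" if W: "W \<in> GL k" for W :: "'a mat" and k
    proof -
      from W obtain W' where W': "W \<in> carrier_mat k k" "W' \<in> carrier_mat k k" "W * W' = 1\<^sub>m k" "W' * W = 1\<^sub>m k"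
        by (auto simp: GL_def)
      have one1: "mat 1 1 (\<lambda>_. 1 :: 'a) = 1\<^sub>m 1" by (rule eq_matI) auto
      have "?b k k W * ?b k k W' = ?b k k (W * W')" "?b k k W' * ?b k k W = ?b k k (W' * W)"
        using W' unfolding one1
        by (subst mult_four_block_mat[of _ 1 1 _ k _ k _ _ 1 _ k], auto)+
      with W' one[of k] show ?thesis
        by (intro GL_I[of _ _ "?b k k W'"]) (auto intro!: four_block_carrier_mat[of _ 1 1 _ k k, simplified])
    qed
    have "?b n n U * E * ?b ?m' ?m' V = four_block_mat (mat 1 1 (\<lambda>_. a)) (0\<^sub>m 1 ?m') (0\<^sub>m n 1) B'"
    proof -
      have one1: "mat 1 1 (\<lambda>_. 1 :: 'a) = 1\<^sub>m 1" by (rule eq_matI) auto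
      have c: "U \<in> carrier_mat n n" "V \<in> carrier_mat ?m' ?m'" "A' \<in> carrier_mat n ?m'"
        by (rule GL_carrier[OF UV(1)], rule GL_carrier[OF UV(2)], simp add: A'_def)
      note c = c mult_carrier_mat[OF c(1,3)]
      have "?b n n U * E = four_block_mat (mat 1 1 (\<lambda>_. a)) (0\<^sub>m 1 ?m') (0\<^sub>m n 1) (U * A')"
        unfolding block one1 using c
        by (subst mult_four_block_mat[of _ 1 1 _ n _ n _ _ 1 _ ?m']) auto
      then show ?thesis
        unfolding one1 UV(3) using c
        by (simp, subst mult_four_block_mat[of _ 1 1 _ ?m' _ n _ _ 1 _ ?m']) auto
    qed
    moreover have "diagonal_form (Suc \<rho>) (\<lambda>i. case i of 0 \<Rightarrow> a | Suc i \<Rightarrow> \<delta> i)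
      (four_block_mat (mat 1 1 (\<lambda>_. a)) (0\<^sub>m 1 ?m') (0\<^sub>m n 1) B')"
    proof -
      have dB': "dim_row B' = n" "dim_col B' = ?m'" using mequiv_dim[OF B'(1)] dA' by auto
      show ?thesis
        using B'(2) a(1) unfolding diagonal_form_def
        by (auto simp: dB' split: nat.splits)
    qed
    ultimately show ?thesis
      using mequiv_trans[OF AE] bGL[OF UV(1)] bGL[OF UV(2)] dE m unfolding mequiv_def by metis
  qed
qed


lemma mequivE:
  assumes "mequiv A B" "A \<in> carrier_mat n m"
  obtains U U' V V' where "U \<in> carrier_mat n n" "U' \<in> carrier_mat n n" "V \<in> carrier_mat m m" "V' \<in> carrier_mat m m"
    "U * U' = 1\<^sub>m n" "U' * U = 1\<^sub>m n" "V * V' = 1\<^sub>m m" "V' * V = 1\<^sub>m m" "B = U * A * V" "A = U' * B * V'"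
    "B \<in> carrier_mat n m"
proof -
  from assms obtain U V where UV: "U \<in> GL n" "V \<in> GL m" "B = U * A * V" by (auto simp: mequiv_def)
  then obtain U' V' where U': "U \<in> carrier_mat n n" "U' \<in> carrier_mat n n" "U * U' = 1\<^sub>m n" "U' * U = 1\<^sub>m n"
    and V': "V \<in> carrier_mat m m" "V' \<in> carrier_mat m m" "V * V' = 1\<^sub>m m" "V' * V = 1\<^sub>m m"
    by (auto simp: GL_def)
  have A: "A \<in> carrier_mat n m" by fact
  have UA: "U * A \<in> carrier_mat n m" using U' A by auto
  have "U' * B = U' * (U * A) * V"
    unfolding UV(3) by (rule assoc_mult_mat[OF U'(2) UA V'(1), symmetric])
  also have "U' * (U * A) = A"
    using assoc_mult_mat[OF U'(2) U'(1) A] U' A by simp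
  finally have "U' * B * V' = A * (V * V')" using assoc_mult_mat[OF A V'(1,2)] by simp
  also have "\<dots> = A" using V' A by simp
  finally have A': "A = U' * B * V'" by (rule sym)
  have "B \<in> carrier_mat n m" unfolding UV(3) by (rule mult_carrier_mat[OF UA V'(1)])
  then show thesis by (rule that[OF U'(1,2) V'(1,2) U'(3,4) V'(3,4) UV(3) A'])
qed

section \<open>Trace and rank\<close>

definition tr_mat :: "'a::comm_ring_1 mat \<Rightarrow> 'a" where
  "tr_mat A = (\<Sum>i<dim_row A. A $$ (i, i))"

lemma index_mult_mat_sum:
  assumes "A \<in> carrier_mat n k" "B \<in> carrier_mat k m" "i < n" "j < m"
  shows "(A * B) $$ (i, j) = (\<Sum>l<k. A $$ (i, l) * B $$ (l, j))"
  using assms by (simp add: scalar_prod_def atLeast0LessThan)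

lemma tr_mat_comm:
  assumes "A \<in> carrier_mat n m" "B \<in> carrier_mat m n"
  shows "tr_mat (A * B) = tr_mat (B * A)"
proof -
  have "tr_mat (A * B) = (\<Sum>i<n. \<Sum>k<m. A $$ (i, k) * B $$ (k, i))"
    using assms by (simp add: tr_mat_def scalar_prod_def atLeast0LessThan)
  also have "\<dots> = (\<Sum>k<m. \<Sum>i<n. A $$ (i, k) * B $$ (k, i))" by (rule sum.swap)
  also have "\<dots> = tr_mat (B * A)"
    using assms by (simp add: tr_mat_def scalar_prod_def atLeast0LessThan mult.commute)
  finally show ?thesis .
qed

lemma diagonal_form_mult_left:
  assumes D: "diagonal_form \<rho> \<delta> D" "D \<in> carrier_mat n m" and W: "W \<in> carrier_mat m k"
    and "i < n" "j < k"
  shows "(D * W) $$ (i, j) = (if i < \<rho> then \<delta> i * W $$ (i, j) else 0)"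
proof -
  have "(D * W) $$ (i, j) = (\<Sum>l<m. D $$ (i, l) * W $$ (l, j))"
    using assms by (simp add: scalar_prod_def atLeast0LessThan)
  also have "\<dots> = (\<Sum>l<m. if i = l then if i < \<rho> then \<delta> i * W $$ (i, j) else 0 else 0)"
    by (rule sum.cong) (use assms in \<open>auto simp: diagonal_form_def\<close>)
  also have "\<dots> = (if i < \<rho> then \<delta> i * W $$ (i, j) else 0)"
    using D by (auto simp: diagonal_form_def)
  finally show ?thesis .
qed

text \<open>The matrix \<open>H\<close> is a generalised inverse of \<open>A\<close> up to the factor \<open>k\<close>, so that \<open>A H / k\<close> is
  idempotent with the same image as \<open>A\<close>.\<close>

lemma rank_eq_trace:
  fixes A :: "'a::idom mat"
  assumes AB: "mequiv A D" and A: "A \<in> carrier_mat n m" and H: "H \<in> carrier_mat m n"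
    and D: "diagonal_form \<rho> \<delta> D" and inv: "A * H * A = k \<cdot>\<^sub>m A"
  shows "tr_mat (A * H) = k * of_nat \<rho>"
proof -
  obtain U U' V V' where U: "U \<in> carrier_mat n n" "U' \<in> carrier_mat n n" "V \<in> carrier_mat m m" "V' \<in> carrier_mat m m"
    "U * U' = 1\<^sub>m n" "U' * U = 1\<^sub>m n" "V * V' = 1\<^sub>m m" "V' * V = 1\<^sub>m m" "D = U * A * V" "A = U' * D * V'"
    and Dc: "D \<in> carrier_mat n m"
    by (rule mequivE[OF AB A]) blast
  \<comment> \<open>\<open>W\<close> is \<open>H\<close> in the coordinates that diagonalise
    \<open>A\<close>. The hypothesis becomes \<open>D * W * D = k \<cdot>\<^sub>m D\<close>, whose
    diagonal entries force \<open>\<delta> i * W $$ (i, i) = k\<close> for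
    \<open>i < \<rho>\<close>.\<close>
  define W where "W = V' * H * U'"
  have W: "W \<in> carrier_mat m n" using U H by (auto simp: W_def)
  have V'H: "V' * H \<in> carrier_mat m n" and U'D: "U' * D \<in> carrier_mat n m" and UA: "U * A \<in> carrier_mat n m"
    using U H Dc A by auto
  have AH: "A * H = U' * D * (V' * H)"
    unfolding U(10) by (rule assoc_mult_mat[OF U'D U(4) H])
  have "tr_mat (A * H) = tr_mat (V' * H * (U' * D))"
    unfolding AH by (rule tr_mat_comm[OF U'D V'H])
  also have "V' * H * (U' * D) = W * D"
    unfolding W_def by (rule assoc_mult_mat[OF V'H U(2) Dc, symmetric])
  also have "tr_mat (W * D) = tr_mat (D * W)" by (rule tr_mat_comm[OF W Dc])
  finally have 1: "tr_mat (A * H) = tr_mat (D * W)" .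
  have "D * W = U * A * V * (V' * H * U')" by (simp only: U(9)[symmetric] W_def)
  also have "\<dots> = U * A * (V * (V' * H * U'))"
    by (rule assoc_mult_mat[OF UA U(3) mult_carrier_mat[OF V'H U(2)]])
  also have "V * (V' * H * U') = V * (V' * (H * U'))"
    by (simp only: assoc_mult_mat[OF U(4) H U(2)])
  also have "\<dots> = H * U'"
    by (simp only: assoc_mult_mat[OF U(3,4) mult_carrier_mat[OF H U(2)], symmetric] U(7)
        left_mult_one_mat[OF mult_carrier_mat[OF H U(2)]])
  also have "U * A * (H * U') = U * A * H * U'"
    by (rule assoc_mult_mat[OF UA H U(2), symmetric])
  finally have DW: "D * W = U * A * H * U'" .
  have "D * W * D = U * A * H * U' * (U * A * V)" by (simp only: DW U(9)[symmetric])
  also have "\<dots> = U * A * H * (U' * (U * A * V))"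
    by (rule assoc_mult_mat[OF mult_carrier_mat[OF UA H] U(2) mult_carrier_mat[OF UA U(3)]])
  also have "U' * (U * A * V) = U' * (U * (A * V))" by (simp only: assoc_mult_mat[OF U(1) A U(3)])
  also have "\<dots> = A * V" by (simp only: assoc_mult_mat[OF U(2,1) mult_carrier_mat[OF A U(3)], symmetric] U(6)
        left_mult_one_mat[OF mult_carrier_mat[OF A U(3)]])
  also have "U * A * H * (A * V) = U * A * H * A * V"
    by (rule assoc_mult_mat[OF mult_carrier_mat[OF UA H] A U(3), symmetric])
  also have "U * A * H = U * (A * H)" by (rule assoc_mult_mat[OF U(1) A H])
  also have "U * (A * H) * A = U * (A * H * A)"
    by (rule assoc_mult_mat[OF U(1) mult_carrier_mat[OF A H] A])
  also have "U * (A * H * A) * V = k \<cdot>\<^sub>m D"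
    by (simp only: inv U(9) mult_smult_distrib[OF U(1) A] mult_smult_assoc_mat[OF UA U(3)])
  finally have DWD: "D * W * D = k \<cdot>\<^sub>m D" .
  have d: "\<rho> \<le> n" "\<rho> \<le> m" "\<And>i. i < \<rho> \<Longrightarrow> \<delta> i \<noteq> 0" "\<And>i. i < \<rho> \<Longrightarrow> D $$ (i, i) = \<delta> i"
    using D Dc by (auto simp: diagonal_form_def)
  have WD: "W * D \<in> carrier_mat m m" using W Dc by auto
  have "\<delta> i * W $$ (i, i) = k" if i: "i < \<rho>" for i
  proof -
    have "(W * D) $$ (i, i) = (transpose_mat D * transpose_mat W) $$ (i, i)"
      using transpose_mult[OF W Dc] i d WD by (metis carrier_matD index_transpose_mat(1) less_le_trans)
    also have "\<dots> = \<delta> i * W $$ (i, i)"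
      using diagonal_form_mult_left[OF diagonal_form_transpose[OF D], of m n "transpose_mat W" m i i] Dc W i d
      by auto
    finally have "(D * (W * D)) $$ (i, i) = \<delta> i * (\<delta> i * W $$ (i, i))"
      using diagonal_form_mult_left[OF D Dc WD, of i i] i d by auto
    moreover have "(D * (W * D)) $$ (i, i) = k * \<delta> i"
      using DWD assoc_mult_mat[OF Dc W Dc] i d Dc by auto
    ultimately show ?thesis using d(3)[OF i] by (metis mult.commute mult_left_cancel)
  qed
  then have "(\<Sum>i<n. (D * W) $$ (i, i)) = (\<Sum>i<n. if i < \<rho> then k else 0)"
    by (intro sum.cong refl) (use diagonal_form_mult_left[OF D Dc W] in auto)
  also have "\<dots> = (\<Sum>i<\<rho>. k)"
    by (rule sum.mono_neutral_cong_right) (use d in auto)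
  finally show ?thesis using 1 Dc by (simp add: tr_mat_def mult.commute)
qed

definition minor :: "nat \<Rightarrow> 'a mat \<Rightarrow> 'a mat" where
  "minor r A = mat r r (\<lambda>(i, j). A $$ (i, j))"

lemma det_minor_diagonal:
  assumes "diagonal_form r \<delta> D"
  shows "det (minor r D) = (\<Prod>i<r. \<delta> i)"
proof -
  have "upper_triangular (minor r D)" "minor r D \<in> carrier_mat r r"
    using assms by (auto simp: minor_def diagonal_form_def upper_triangular_def)
  then have "det (minor r D) = prod_list (diag_mat (minor r D))" by (rule det_upper_triangular)
  also have "\<dots> = (\<Prod>i<r. minor r D $$ (i, i))"
    by (simp add: prod_list_diag_prod minor_def atLeast0LessThan)
  also have "\<dots> = (\<Prod>i<r. \<delta> i)"
    by (rule prod.cong) (use assms in \<open>auto simp: minor_def diagonal_form_def\<close>)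
  finally show ?thesis .
qed

text \<open>Writing \<open>P * A * Q\<close> as \<open>?P * (D * ?Q)\<close>, the rows of the second
  factor from \<rho> on are zero. Since \<rho> < r, the leading minor is thus already a product of
  two square matrices of size r, the second of them singular.\<close>

lemma det_minor_eq_0:
  fixes A :: "'a::idom mat"
  assumes AB: "mequiv A D" and A: "A \<in> carrier_mat n m" and D: "diagonal_form \<rho> \<delta> D" and r: "\<rho> < r" "r \<le> n" "r \<le> m"
    and P: "P \<in> carrier_mat n n" and Q: "Q \<in> carrier_mat m m"
  shows "det (minor r (P * A * Q)) = 0"
proof -
  obtain U U' V V' where U: "U' \<in> carrier_mat n n" "V' \<in> carrier_mat m m" "A = U' * D * V'" and Dc: "D \<in> carrier_mat n m"
    by (rule mequivE[OF AB A]) blast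
  let ?P = "P * U'" and ?Q = "V' * Q"
  have PQ: "?P \<in> carrier_mat n n" "?Q \<in> carrier_mat m m" using P Q U by auto
  have "P * A * Q = P * (U' * D) * V' * Q"
    unfolding U(3) using P U Dc by (subst assoc_mult_mat[of P n n "U' * D" m V' m]) auto
  also have "P * (U' * D) = ?P * D" by (rule assoc_mult_mat[OF P U(1) Dc, symmetric])
  also have "?P * D * V' * Q = ?P * D * ?Q"
    using PQ Dc U Q by (intro assoc_mult_mat[of _ n m _ m _ m]) auto
  also have "\<dots> = ?P * (D * ?Q)" using assoc_mult_mat[OF PQ(1) Dc PQ(2)] .
  finally have eq: "P * A * Q = ?P * (D * ?Q)" .
  define P1 where "P1 = mat r r (\<lambda>(i, j). ?P $$ (i, j))"
  define Q1 where "Q1 = mat r r (\<lambda>(i, j). (D * ?Q) $$ (i, j))"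
  have zero: "(D * ?Q) $$ (i, j) = 0" if "\<rho> \<le> i" "i < n" "j < m" for i j
    using diagonal_form_mult_left[OF D Dc PQ(2) that(2,3)] that by simp
  have "minor r (P * A * Q) = P1 * Q1"
  proof (rule eq_matI)
    fix i j assume "i < dim_row (P1 * Q1)" "j < dim_col (P1 * Q1)"
    then have ij: "i < r" "j < r" by (auto simp: P1_def Q1_def)
    have "(?P * (D * ?Q)) $$ (i, j) = (\<Sum>l<n. ?P $$ (i, l) * (D * ?Q) $$ (l, j))"
      by (rule index_mult_mat_sum[OF PQ(1) mult_carrier_mat[OF Dc PQ(2)]]) (use ij r in auto)
    also have "\<dots> = (\<Sum>l<r. ?P $$ (i, l) * (D * ?Q) $$ (l, j))"
      by (rule sum.mono_neutral_right) (use r ij zero in auto)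
    also have "\<dots> = (P1 * Q1) $$ (i, j)"
      using index_mult_mat_sum[of P1 r r Q1 r i j] ij by (simp add: P1_def Q1_def)
    finally show "minor r (P * A * Q) $$ (i, j) = (P1 * Q1) $$ (i, j)"
      using ij by (simp add: minor_def eq)
  qed (simp_all add: minor_def P1_def Q1_def)
  moreover have "det Q1 = 0"
  proof -
    \<comment> \<open>Row \<rho> of \<open>Q1\<close> is zero and every Leibniz term has a factor
      from it.\<close>
    have "Q1 $$ (\<rho>, p \<rho>) = 0" if "p permutes {0..<r}" for p
      using zero[of \<rho> "p \<rho>"] permutes_in_image[OF that, of \<rho>] r by (simp add: Q1_def)
    then show ?thesis
      unfolding det_def'[of Q1 r, OF mat_carrier[of r r "\<lambda>(i, j). (D * ?Q) $$ (i, j)", folded Q1_def]]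
      using r by (intro sum.neutral ballI) (auto intro!: bexI[of _ \<rho>])
  qed
  moreover have "P1 \<in> carrier_mat r r" "Q1 \<in> carrier_mat r r" by (simp_all add: P1_def Q1_def)
  ultimately show ?thesis by (simp add: det_mult)
qed

section \<open>Torsion of the cokernel of an integer matrix\<close>

lemma mat_mult_zero_vec: "A \<in> carrier_mat n m \<Longrightarrow> A *\<^sub>v 0\<^sub>v m = (0\<^sub>v n :: int vec)"
  by (rule eq_vecI) auto

lemma mat_mult_smult_vec:
  "A \<in> carrier_mat n m \<Longrightarrow> v \<in> carrier_vec m \<Longrightarrow> A *\<^sub>v (k \<cdot>\<^sub>v v) = k \<cdot>\<^sub>v (A *\<^sub>v v :: int vec)"
  by (rule eq_vecI) (auto simp: scalar_prod_def sum_distrib_left mult.left_commute)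

text \<open>Modulo the image of \<open>A\<close> this is the torsion subgroup of the
  cokernel.\<close>

definition saturation :: "int mat \<Rightarrow> int vec set" where
  "saturation A = {v \<in> carrier_vec (dim_row A). \<exists>k. \<exists>w \<in> carrier_vec (dim_col A). k \<noteq> 0 \<and> k \<cdot>\<^sub>v v = A *\<^sub>v w}"

definition mod_image :: "int mat \<Rightarrow> (int vec \<times> int vec) set" where
  "mod_image A = {(v, v'). v \<in> saturation A \<and> v' \<in> saturation A \<and> (\<exists>w \<in> carrier_vec (dim_col A). v' = A *\<^sub>v w + v)}"

lemma equiv_mod_image: "equiv (saturation A) (mod_image A)"
proof (rule equivI)
  have c: "\<And>v. v \<in> saturation A \<Longrightarrow> v \<in> carrier_vec (dim_row A)" by (auto simp: saturation_def)
  have A: "A \<in> carrier_mat (dim_row A) (dim_col A)" by simp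
  have Aw: "A *\<^sub>v w \<in> carrier_vec (dim_row A)" for w by (rule carrier_vecI) simp
  show "refl_on (saturation A) (mod_image A)"
  proof (rule refl_onI)
    fix v assume v: "v \<in> saturation A"
    have "v = A *\<^sub>v 0\<^sub>v (dim_col A) + v" using c[OF v] by (simp add: mat_mult_zero_vec[OF A])
    with v show "(v, v) \<in> mod_image A"
      unfolding mod_image_def by (auto intro!: bexI[of _ "0\<^sub>v (dim_col A)"])
  qed
  show "sym (mod_image A)"
  proof (rule symI)
    fix v v' assume "(v, v') \<in> mod_image A"
    then obtain w where w: "v \<in> saturation A" "v' \<in> saturation A" "w \<in> carrier_vec (dim_col A)" "v' = A *\<^sub>v w + v"
      by (auto simp: mod_image_def)
    have "A *\<^sub>v (- w) + A *\<^sub>v w = A *\<^sub>v (- w + w)"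
      by (rule mult_add_distrib_mat_vec[OF A, symmetric]) (use w in auto)
    also have "- w + w = 0\<^sub>v (dim_col A)" by (rule uminus_l_inv_vec[OF w(3)])
    finally have "A *\<^sub>v (- w) + A *\<^sub>v w = 0\<^sub>v (dim_row A)" by (simp only: mat_mult_zero_vec[OF A])
    then have "A *\<^sub>v (- w) + v' = v"
      unfolding w(4) using assoc_add_vec[OF Aw Aw c[OF w(1)], of "- w" w] c[OF w(1)] by (simp only: left_zero_vec)
    with w show "(v', v) \<in> mod_image A"
      unfolding mod_image_def by (auto intro!: bexI[of _ "- w"])
  qed
  show "trans (mod_image A)"
  proof (rule transI)
    fix u v x assume "(u, v) \<in> mod_image A" "(v, x) \<in> mod_image A"
    then obtain w w' where w: "u \<in> saturation A" "x \<in> saturation A" "w \<in> carrier_vec (dim_col A)"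
      "w' \<in> carrier_vec (dim_col A)" "v = A *\<^sub>v w + u" "x = A *\<^sub>v w' + v"
      by (auto simp: mod_image_def)
    have "x = A *\<^sub>v (w' + w) + u"
      unfolding w(5,6) mult_add_distrib_mat_vec[OF A w(4,3)]
      by (rule assoc_add_vec[symmetric, OF Aw Aw c[OF w(1)]])
    with w show "(u, x) \<in> mod_image A"
      unfolding mod_image_def by (auto intro!: bexI[of _ "w' + w"])
  qed
qed (auto simp: mod_image_def)

lemma diagonal_form_mult_vec:
  assumes D: "diagonal_form \<rho> \<delta> D" "D \<in> carrier_mat n m" and w: "w \<in> carrier_vec m" and i: "i < n"
  shows "(D *\<^sub>v w) $ i = (if i < \<rho> then \<delta> i * w $ i else (0 :: int))"
proof -
  have "(D *\<^sub>v w) $ i = (\<Sum>l<m. D $$ (i, l) * w $ l)"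
    using assms by (simp add: scalar_prod_def atLeast0LessThan)
  also have "\<dots> = (\<Sum>l<m. if i = l then if i < \<rho> then \<delta> i * w $ i else 0 else 0)"
    by (rule sum.cong) (use assms in \<open>auto simp: diagonal_form_def\<close>)
  also have "\<dots> = (if i < \<rho> then \<delta> i * w $ i else 0)"
    using D by (auto simp: diagonal_form_def)
  finally show ?thesis .
qed

text \<open>In the coordinates given by \<open>U\<close>, the saturation consists of the vectors
  that vanish from \<rho> on, and the image of \<open>A\<close> of those whose entry at each
  \<open>i < \<rho>\<close> is in addition a multiple of \<open>\<delta> i\<close>. Residues
  classify the quotient.\<close>

lemma card_saturation_quotient:
  assumes AD: "mequiv A D" and D: "diagonal_form \<rho> \<delta> D"
  shows "card (saturation A // mod_image A) = nat (\<Prod>i<\<rho>. \<bar>\<delta> i\<bar>)"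
    and "finite (saturation A // mod_image A)"
proof -
  define n m where "n = dim_row A" and "m = dim_col A"
  have A: "A \<in> carrier_mat n m" by (simp add: n_def m_def)
  obtain U U' V V' where U: "U \<in> carrier_mat n n" "U' \<in> carrier_mat n n" "V \<in> carrier_mat m m" "V' \<in> carrier_mat m m"
    "U * U' = 1\<^sub>m n" "U' * U = 1\<^sub>m n" "V * V' = 1\<^sub>m m" "V' * V = 1\<^sub>m m" "D = U * A * V" "A = U' * D * V'"
    and Dc: "D \<in> carrier_mat n m"
    by (rule mequivE[OF AD A]) blast
  have rho: "\<rho> \<le> n" "\<rho> \<le> m" "\<And>i. i < \<rho> \<Longrightarrow> \<delta> i \<noteq> 0"
    using D Dc by (auto simp: diagonal_form_def)
  have Uv: "U *\<^sub>v v \<in> carrier_vec n" "U' *\<^sub>v v \<in> carrier_vec n" for v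
    using U by (auto intro!: carrier_vecI)
  have Vw: "V *\<^sub>v w \<in> carrier_vec m" "V' *\<^sub>v w \<in> carrier_vec m" for w
    using U by (auto intro!: carrier_vecI)
  have Aw: "A *\<^sub>v w \<in> carrier_vec n" and Dw: "D *\<^sub>v w \<in> carrier_vec n" for w
    using A Dc by (auto intro!: carrier_vecI)
  have UA: "U *\<^sub>v (A *\<^sub>v w) = D *\<^sub>v (V' *\<^sub>v w)" if w: "w \<in> carrier_vec m" for w
  proof -
    have "D *\<^sub>v (V' *\<^sub>v w) = (U * A) *\<^sub>v (V *\<^sub>v (V' *\<^sub>v w))"
      unfolding U(9) by (rule assoc_mult_mat_vec[OF mult_carrier_mat[OF U(1) A] U(3) Vw(2)])
    also have "V *\<^sub>v (V' *\<^sub>v w) = w"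
      by (simp only: assoc_mult_mat_vec[OF U(3,4) w, symmetric] U(7) one_mult_mat_vec[OF w])
    finally show ?thesis by (simp only: assoc_mult_mat_vec[OF U(1) A w])
  qed
  have UU': "U *\<^sub>v (U' *\<^sub>v v) = v" "U' *\<^sub>v (U *\<^sub>v v) = v" if v: "v \<in> carrier_vec n" for v
    by (simp_all only: assoc_mult_mat_vec[OF U(1,2) v, symmetric] assoc_mult_mat_vec[OF U(2,1) v, symmetric]
        U(5,6) one_mult_mat_vec[OF v])
  have AV: "A *\<^sub>v (V *\<^sub>v w) = U' *\<^sub>v (D *\<^sub>v w)" if w: "w \<in> carrier_vec m" for w
  proof -
    have "V' *\<^sub>v (V *\<^sub>v w) = w"
      by (simp only: assoc_mult_mat_vec[OF U(4,3) w, symmetric] U(8) one_mult_mat_vec[OF w])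
    then have "U *\<^sub>v (A *\<^sub>v (V *\<^sub>v w)) = D *\<^sub>v w" using UA[OF Vw(1)] by simp
    then have "U' *\<^sub>v (U *\<^sub>v (A *\<^sub>v (V *\<^sub>v w))) = U' *\<^sub>v (D *\<^sub>v w)" by simp
    then show ?thesis by (simp only: UU'(2)[OF Aw])
  qed
  have sat: "v \<in> saturation A \<longleftrightarrow> v \<in> carrier_vec n \<and> (\<exists>k. \<exists>w \<in> carrier_vec m. k \<noteq> 0 \<and> k \<cdot>\<^sub>v v = A *\<^sub>v w)" for v
    by (simp add: saturation_def n_def m_def)
  have rel: "(v, v') \<in> mod_image A \<longleftrightarrow> v \<in> saturation A \<and> v' \<in> saturation A \<and> (\<exists>w \<in> carrier_vec m. v' = A *\<^sub>v w + v)" for v v'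
    by (simp add: mod_image_def m_def)
  have sat0: "(U *\<^sub>v v) $ i = 0" if v: "v \<in> saturation A" and i: "\<rho> \<le> i" "i < n" for v i
  proof -
    obtain k w where w: "v \<in> carrier_vec n" "w \<in> carrier_vec m" "k \<noteq> 0" "k \<cdot>\<^sub>v v = A *\<^sub>v w"
      using v by (auto simp: sat)
    have "k \<cdot>\<^sub>v (U *\<^sub>v v) = D *\<^sub>v (V' *\<^sub>v w)"
      by (simp only: mat_mult_smult_vec[OF U(1) w(1), symmetric] w(4) UA[OF w(2)])
    then have "k * (U *\<^sub>v v) $ i = 0"
      using diagonal_form_mult_vec[OF D Dc Vw(2), of i w] i Uv(1)[of v]
      by (metis index_smult_vec(1) carrier_vecD leD)
    then show ?thesis using w(3) by simp
  qed
  \<comment> \<open>Tuples of residues; the identity relation on them turns them into a set of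
    classes, so that \<open>bij_betw_quotients\<close> applies.\<close>
  let ?S = "\<Pi>\<^sub>E i\<in>{..<\<rho>}. {0..<\<bar>\<delta> i\<bar>}"
  let ?phi = "\<lambda>v. \<lambda>i\<in>{..<\<rho>}. (U *\<^sub>v v) $ i mod \<bar>\<delta> i\<bar>"
  let ?x = "\<lambda>f. vec n (\<lambda>i. if i < \<rho> then f i else (0 :: int))"
  let ?psi = "\<lambda>f. U' *\<^sub>v ?x f"
  have in_image: "\<exists>w \<in> carrier_vec m. U' *\<^sub>v y = A *\<^sub>v w"
    if y: "y \<in> carrier_vec n" and q: "\<And>i. i < n \<Longrightarrow> y $ i = (if i < \<rho> then \<delta> i * q i else 0)" for y q
  proof -
    have "D *\<^sub>v vec m q = y"
      by (rule eq_vecI) (use diagonal_form_mult_vec[OF D Dc, of "vec m q"] q y Dc rho in auto)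
    then have "A *\<^sub>v (V *\<^sub>v vec m q) = U' *\<^sub>v y" using AV[of "vec m q"] by simp
    then show ?thesis using Vw by metis
  qed
  have psi_sat: "?psi f \<in> saturation A" for f
  proof -
    \<comment> \<open>A common multiple of the diagonal entries brings every vector supported below
      \<rho> into the image.\<close>
    let ?k = "\<Prod>i<\<rho>. \<delta> i"
    have k: "?k = \<delta> i * (\<Prod>j\<in>{..<\<rho>} - {i}. \<delta> j)" if "i < \<rho>" for i
      using that by (subst prod.remove[of "{..<\<rho>}" i]) auto
    have "\<exists>w \<in> carrier_vec m. U' *\<^sub>v (?k \<cdot>\<^sub>v ?x f) = A *\<^sub>v w"
      by (rule in_image[where q = "\<lambda>i. (\<Prod>j\<in>{..<\<rho>} - {i}. \<delta> j) * f i"]) (auto simp: k mult.assoc)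
    moreover have "U' *\<^sub>v (?k \<cdot>\<^sub>v ?x f) = ?k \<cdot>\<^sub>v ?psi f" by (rule mat_mult_smult_vec[OF U(2)]) simp
    moreover have "?k \<noteq> 0" using rho(3) by simp
    ultimately show ?thesis using Uv(2) unfolding sat by metis
  qed
  have "bij_betw (\<lambda>X. Id_on ?S `` (?phi ` X)) (saturation A // mod_image A) (?S // Id_on ?S)"
  proof (rule bij_betw_quotients[OF equiv_mod_image, where psi = ?psi])
    show "equiv ?S (Id_on ?S)" by (auto intro!: equivI refl_onI symI transI)
    show phi: "?phi v \<in> ?S" for v using rho(3) by (auto intro!: restrict_PiE)
    show "(?phi v, ?phi v') \<in> Id_on ?S" if "(v, v') \<in> mod_image A" for v v'
    proof -
      obtain w where w: "v \<in> carrier_vec n" "w \<in> carrier_vec m" "v' = A *\<^sub>v w + v"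
        using \<open>(v, v') \<in> mod_image A\<close> by (auto simp: rel sat)
      have "U *\<^sub>v v' = D *\<^sub>v (V' *\<^sub>v w) + U *\<^sub>v v"
        unfolding w(3) mult_add_distrib_mat_vec[OF U(1) Aw w(1)] UA[OF w(2)] ..
      then have "(U *\<^sub>v v') $ i = \<delta> i * (V' *\<^sub>v w) $ i + (U *\<^sub>v v) $ i" if "i < \<rho>" for i
        using diagonal_form_mult_vec[OF D Dc Vw(2), of i w] rho that by (simp add: carrier_matD(1)[OF U(1)])
      moreover have "(\<delta> i * a + b) mod \<bar>\<delta> i\<bar> = b mod \<bar>\<delta> i\<bar>" for i a b
        by (metis abs_dvd_iff dvd_triv_left mod_add_self1 mod_add_left_eq mod_eq_0_iff_dvd add_0)
      ultimately have "?phi v = ?phi v'" by (auto simp: restrict_def fun_eq_iff)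
      then show ?thesis using phi[of v] by (simp add: Id_on_iff)
    qed
    show "?psi f \<in> saturation A" for f by (rule psi_sat)
    show "(?psi f, ?psi f') \<in> mod_image A" if "(f, f') \<in> Id_on ?S" for f f'
      using that equiv_mod_image[of A] psi_sat[of f] by (auto elim!: equivE dest: refl_onD)
    show "(v, ?psi (?phi v)) \<in> mod_image A" if v: "v \<in> saturation A" for v
    proof -
      have vc: "v \<in> carrier_vec n" using v by (simp add: sat)
      let ?y = "?x (?phi v) - U *\<^sub>v v"
      have "\<exists>w \<in> carrier_vec m. U' *\<^sub>v ?y = A *\<^sub>v w"
      proof (rule in_image)
        \<comment> \<open>Reduction subtracts a multiple of the absolute value of
          \<open>\<delta> i\<close>; the sign converts it into a multiple of
          \<open>\<delta> i\<close> itself.\<close>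
        show "?y $ i = (if i < \<rho> then \<delta> i * (- (sgn (\<delta> i) * ((U *\<^sub>v v) $ i div \<bar>\<delta> i\<bar>))) else 0)" if "i < n" for i
        proof (cases "i < \<rho>")
          case True
          have "?y $ i = (U *\<^sub>v v) $ i mod \<bar>\<delta> i\<bar> - (U *\<^sub>v v) $ i"
            using True that by (simp add: carrier_matD(1)[OF U(1)])
          also have "\<dots> = - (\<bar>\<delta> i\<bar> * ((U *\<^sub>v v) $ i div \<bar>\<delta> i\<bar>))"
            using mult_div_mod_eq[of "\<bar>\<delta> i\<bar>" "(U *\<^sub>v v) $ i"] by linarith
          also have "\<bar>\<delta> i\<bar> = \<delta> i * sgn (\<delta> i)" by (rule abs_sgn)
          finally show ?thesis using True by (simp only: mult.assoc mult_minus_right if_True abs_sgn)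
        next
          case False
          then show ?thesis using sat0[OF v, of i] that by (simp add: carrier_matD(1)[OF U(1)])
        qed
      qed (use Uv in auto)
      then obtain w where w: "w \<in> carrier_vec m" "U' *\<^sub>v ?y = A *\<^sub>v w" by blast
      have "U' *\<^sub>v ?y = ?psi (?phi v) - v"
        using mult_minus_distrib_mat_vec[OF U(2), of "?x (?phi v)" "U *\<^sub>v v"] Uv(1)[of v] UU'(2)[OF vc] by simp
      then have "?psi (?phi v) = A *\<^sub>v w + v"
        unfolding w(2)[symmetric] using Uv(2)[of "?x (?phi v)"] vc
        by (intro eq_vecI) (auto simp: carrier_matD(1)[OF U(2)])
      then show ?thesis unfolding rel using v psi_sat w(1) by blast
    qed
    show "(f, ?phi (?psi f)) \<in> Id_on ?S" if f: "f \<in> ?S" for f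
    proof -
      have "?phi (?psi f) = f"
      proof
        fix i
        show "?phi (?psi f) i = f i"
        proof (cases "i < \<rho>")
          case True
          then have "(U *\<^sub>v ?psi f) $ i = f i" using UU'(1)[of "?x f"] rho by simp
          then show ?thesis using True PiE_mem[OF f, of i] by simp
        next
          case False
          then show ?thesis using PiE_arb[OF f, of i] by simp
        qed
      qed
      with f show ?thesis by (simp add: Id_on_iff)
    qed
  qed
  moreover have "bij_betw (\<lambda>x. {x}) ?S (?S // Id_on ?S)"
    by (auto simp: bij_betw_def inj_on_def quotient_def Id_on_def)
  ultimately have b: "bij_betw (\<lambda>x. {x}) ?S (?S // Id_on ?S)"
    "bij_betw (\<lambda>X. Id_on ?S `` (?phi ` X)) (saturation A // mod_image A) (?S // Id_on ?S)" by auto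
  have "card (saturation A // mod_image A) = card ?S"
    using bij_betw_same_card[OF b(1)] bij_betw_same_card[OF b(2)] by simp
  also have "\<dots> = (\<Prod>i<\<rho>. nat \<bar>\<delta> i\<bar>)" by (simp add: card_PiE)
  also have "\<dots> = nat (\<Prod>i<\<rho>. \<bar>\<delta> i\<bar>)"
    by (subst nat_eq_iff2) (simp add: prod_nonneg)
  finally show "card (saturation A // mod_image A) = nat (\<Prod>i<\<rho>. \<bar>\<delta> i\<bar>)" .
  have "finite ?S" by (rule finite_PiE) auto
  then show "finite (saturation A // mod_image A)"
    using bij_betw_finite[OF b(1)] bij_betw_finite[OF b(2)] by simp
qed

section \<open>Linear characters\<close>

text \<open>\<open>\<chi>\<close> is a total function whose values off \<open>H\<close> are
  arbitrary, so extending a character means agreeing with it on \<open>H\<close>.\<close>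

definition partial_character :: "('a, 'b) monoid_scheme \<Rightarrow> 'a set \<Rightarrow> ('a \<Rightarrow> complex) \<Rightarrow> bool" where
  "partial_character A H \<chi> \<longleftrightarrow> \<chi> \<one>\<^bsub>A\<^esub> = 1 \<and> (\<forall>x\<in>H. \<forall>y\<in>H. \<chi> (x \<otimes>\<^bsub>A\<^esub> y) = \<chi> x * \<chi> y)"

lemma exists_nat_root: "k > 0 \<Longrightarrow> \<exists>z::complex. z ^ k = w"
proof -
  assume k: "k > 0"
  have "rcis (root k (norm w)) (Arg w / k) ^ k = rcis (norm w) (Arg w)"
    using k by (simp add: DeMoivre2 real_root_pow_pos2)
  then show ?thesis by (metis rcis_cmod_Arg)
qed

section \<open>Extension of characters of finite abelian groups\<close>

context comm_group
begin

lemma partial_character_pow: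
  assumes "subgroup H G" "partial_character G H \<chi>" "h \<in> H"
  shows "\<chi> (h [^] (q::nat)) = \<chi> h ^ q"
proof (induction q)
  case (Suc q)
  have "h [^] q \<in> H" using subgroup_int_pow_closed[OF assms(1,3), of "int q"] by (simp add: int_pow_int)
  with Suc assms show ?case by (simp add: partial_character_def)
qed (use assms in \<open>simp add: partial_character_def\<close>)

text \<open>With k the order of x modulo \<open>H\<close>, any k-th root of
  \<open>\<chi> (x [^] k)\<close> is an admissible value at x. Prescribing the root serves both to
  extend characters and to separate elements.\<close>

lemma extend_character_step:
  assumes fin: "finite (carrier G)" and H: "subgroup H G" and chi: "partial_character G H \<chi>"
    and x: "x \<in> carrier G"
    and k: "k > 0" "x [^] k \<in> H" "\<And>j. 0 < j \<Longrightarrow> j < k \<Longrightarrow> x [^] j \<notin> H" and z: "z ^ k = \<chi> (x [^] (k::nat))"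
  shows "\<exists>K \<psi>. subgroup K G \<and> partial_character G K \<psi> \<and> H \<subseteq> K \<and> x \<in> K \<and> (\<forall>h\<in>H. \<psi> h = \<chi> h) \<and> \<psi> x = z"
proof -
  note Hc = subgroup.mem_carrier[OF H] and H1 = subgroup.one_closed[OF H] and Hm = subgroup.m_closed[OF H]
    and Hi = subgroup.m_inv_closed[OF H]
  \<comment> \<open>By minimality of k, the exponents that lead into \<open>H\<close> are its
    multiples; hence the values of \<open>\<chi>\<close> there are powers of \<open>z\<close>, and
    \<open>wd\<close> follows.\<close>
  have dvd: "k dvd l" if l: "x [^] l \<in> H" for l :: nat
  proof -
    have "x [^] (k * (l div k)) \<in> H"
      using subgroup_int_pow_closed[OF H k(2), of "int (l div k)"] x by (simp add: int_pow_int nat_pow_pow)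
    moreover have "x [^] (k * (l div k)) \<otimes> x [^] (l mod k) = x [^] l" using x by (simp add: nat_pow_mult)
    ultimately have "x [^] (l mod k) \<in> H"
      using l x Hm[OF Hi, of "x [^] (k * (l div k))" "x [^] l"]
      by (metis inv_solve_left nat_pow_closed)
    then have "l mod k = 0" using k(3)[of "l mod k"] k(1) by (meson mod_less_divisor not_gr_zero)
    then show ?thesis by (simp add: dvd_eq_mod_eq_0)
  qed
  have chi_pow: "\<chi> (x [^] l) = z ^ l" if l: "x [^] l \<in> H" for l :: nat
  proof -
    obtain q where q: "l = k * q" using dvd[OF l] by (auto elim: dvdE)
    have "\<chi> ((x [^] k) [^] q) = \<chi> (x [^] k) ^ q" by (rule partial_character_pow[OF H chi k(2)])
    then show ?thesis using x by (simp add: q nat_pow_pow z[symmetric] power_mult)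
  qed
  have wd: "\<chi> h * z ^ i = \<chi> h' * z ^ j" if hh: "h \<in> H" "h' \<in> H" "h \<otimes> x [^] i = h' \<otimes> x [^] j" "i \<le> j" for h h' and i j :: nat
  proof -
    have "h \<otimes> x [^] i = (h' \<otimes> x [^] (j - i)) \<otimes> x [^] i"
      using hh x Hc by (simp add: m_assoc nat_pow_mult)
    then have eq: "h = h' \<otimes> x [^] (j - i)" using hh x Hc by simp
    then have "inv h' \<otimes> h = x [^] (j - i)" using hh x Hc by (simp add: m_assoc[symmetric])
    then have xH: "x [^] (j - i) \<in> H" using Hm[OF Hi[OF hh(2)] hh(1)] by simp
    then have "\<chi> h = \<chi> h' * z ^ (j - i)"
      using chi hh(2) chi_pow[OF xH] unfolding partial_character_def by (subst eq) simp
    then show ?thesis using hh(4) by (simp add: mult.assoc power_add[symmetric])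
  qed
  define K where "K = {h \<otimes> x [^] i | h i. h \<in> H \<and> (i::nat) \<ge> 0}"
  define \<psi> where "\<psi> y = (case (SOME p. fst p \<in> H \<and> y = fst p \<otimes> x [^] (snd p :: nat)) of (h, i) \<Rightarrow> \<chi> h * z ^ i)" for y
  have psi: "\<psi> (h \<otimes> x [^] i) = \<chi> h * z ^ i" if h: "h \<in> H" for h and i :: nat
  proof -
    let ?Q = "\<lambda>p. fst p \<in> H \<and> h \<otimes> x [^] i = fst p \<otimes> x [^] (snd p :: nat)"
    obtain h' j where p: "(SOME p. ?Q p) = (h', j)" by (cases "SOME p. ?Q p")
    have "?Q (SOME p. ?Q p)" by (rule someI[of ?Q "(h, i)"]) (use h in simp)
    then have "h' \<in> H" "h \<otimes> x [^] i = h' \<otimes> x [^] j" unfolding p by auto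
    then have "\<chi> h * z ^ i = \<chi> h' * z ^ j"
      using wd[OF h, of h' i j] wd[OF _ h, of h' j i] by (cases "i \<le> j") auto
    then show ?thesis by (simp add: \<psi>_def p)
  qed
  have mult: "(h \<otimes> x [^] i) \<otimes> (h' \<otimes> x [^] j) = (h \<otimes> h') \<otimes> x [^] (i + j)"
    if "h \<in> H" "h' \<in> H" for h h' and i j :: nat
    using that Hc x by (simp add: nat_pow_mult[symmetric] m_ac)
  have HK: "H \<subseteq> K"
  proof
    fix h assume "h \<in> H"
    then show "h \<in> K" unfolding K_def using Hc by (intro CollectI exI[of _ h] exI[of _ "0::nat"]) simp
  qed
  have xK: "x \<in> K" unfolding K_def using H1 x by (auto intro!: exI[of _ "\<one>"] exI[of _ "1::nat"])
  have "subgroup K G"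
  proof (rule subgroupI)
    show "K \<subseteq> carrier G" using Hc x by (auto simp: K_def)
    show "K \<noteq> {}" using xK by auto
    show "a \<otimes> b \<in> K" if ab: "a \<in> K" "b \<in> K" for a b
    proof -
      obtain h i h' j where "h \<in> H" "a = h \<otimes> x [^] (i::nat)" "h' \<in> H" "b = h' \<otimes> x [^] (j::nat)"
        using ab by (auto simp: K_def)
      then show ?thesis unfolding K_def using mult[of h h' i j] Hm[of h h'] by auto
    qed
    show "inv a \<in> K" if a: "a \<in> K" for a
    proof -
      obtain h i where h: "h \<in> H" "a = h \<otimes> x [^] (i::nat)" using a by (auto simp: K_def)
      \<comment> \<open>The power with exponent \<open>order G\<close> is the identity, so
        \<open>?j\<close> is a natural exponent that stands for \<open>-i\<close>.\<close>
      let ?j = "i * (order G - 1)"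
      have "order G > 0" using fin order_gt_0_iff_finite by blast
      then have "i + ?j = order G * i" by (cases "order G") simp_all
      then have "x [^] (i + ?j) = (x [^] order G) [^] i" using x by (simp only: nat_pow_pow)
      then have "x [^] (i + ?j) = \<one>" by (simp add: pow_order_eq_1[OF x])
      then have "a \<otimes> (inv h \<otimes> x [^] ?j) = \<one>" using mult[OF h(1) Hi[OF h(1)], of i ?j] Hc[OF h(1)] h by simp
      then have "inv a = inv h \<otimes> x [^] ?j"
        using h x Hc[OF h(1)] by (metis inv_closed inv_equality m_closed m_comm nat_pow_closed)
      then show ?thesis unfolding K_def using Hi[OF h(1)] by auto
    qed
  qed
  moreover have "partial_character G K \<psi>"
    unfolding partial_character_def
  proof (intro conjI ballI)
    show "\<psi> \<one> = 1" using psi[OF H1, of 0] chi by (simp add: partial_character_def)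
    fix a b assume "a \<in> K" "b \<in> K"
    then obtain h i h' j where h: "h \<in> H" "a = h \<otimes> x [^] (i::nat)" "h' \<in> H" "b = h' \<otimes> x [^] (j::nat)"
      by (auto simp: K_def)
    then show "\<psi> (a \<otimes> b) = \<psi> a * \<psi> b"
      using chi by (simp add: mult psi Hm partial_character_def power_add)
  qed
  moreover have "\<forall>h\<in>H. \<psi> h = \<chi> h" using psi[of _ 0] Hc by simp
  moreover have "\<psi> x = z" using psi[OF H1, of 1] x chi by (simp add: partial_character_def)
  ultimately show ?thesis using HK xK by blast
qed

lemma ex_least_pow:
  assumes "finite (carrier G)" "subgroup H G" "x \<in> carrier G"
  obtains k :: nat where "k > 0" "x [^] k \<in> H" "\<And>j. 0 < j \<Longrightarrow> j < k \<Longrightarrow> x [^] j \<notin> H"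
proof -
  let ?P = "\<lambda>k::nat. k > 0 \<and> x [^] k \<in> H"
  have "?P (order G)"
    using pow_order_eq_1[OF assms(3)] subgroup.one_closed[OF assms(2)] order_gt_0_iff_finite assms(1) by auto
  then have P: "?P (LEAST k. ?P k)" by (rule LeastI)
  show thesis
  proof (rule that)
    show "0 < (LEAST k. ?P k)" "x [^] (LEAST k. ?P k) \<in> H" using P by simp_all
    show "x [^] j \<notin> H" if "0 < j" "j < (LEAST k. ?P k)" for j
      using not_less_Least[OF that(2)] that(1) by simp
  qed
qed

text \<open>Complex numbers have roots of every positive order, so one element after another can be
  adjoined to \<open>H\<close>.\<close>

lemma extend_character:
  assumes fin: "finite (carrier G)" and "subgroup H G" "partial_character G H \<chi>"
  shows "\<exists>\<psi>. partial_character G (carrier G) \<psi> \<and> (\<forall>h\<in>H. \<psi> h = \<chi> h)"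
  using assms(2,3)
proof (induction "card (carrier G) - card H" arbitrary: H \<chi> rule: less_induct)
  case less
  show ?case
  proof (cases "H = carrier G")
    case False
    then obtain x where x: "x \<in> carrier G" "x \<notin> H" using subgroup.subset[OF less(2)] by blast
    obtain k :: nat where k: "k > 0" "x [^] k \<in> H" "\<And>j. 0 < j \<Longrightarrow> j < k \<Longrightarrow> x [^] j \<notin> H"
      by (rule ex_least_pow[OF fin less(2) x(1)]) blast
    obtain z where z: "z ^ k = \<chi> (x [^] k)" using exists_nat_root[OF k(1)] by blast
    obtain K \<psi> where K: "subgroup K G" "partial_character G K \<psi>" "H \<subseteq> K" "x \<in> K" "\<forall>h\<in>H. \<psi> h = \<chi> h"
      using extend_character_step[OF fin less(2,3) x(1) k z] by blast
    have "card H < card K" "card K \<le> card (carrier G)"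
      using K x finite_subset[OF subgroup.subset[OF K(1)] fin] fin subgroup.subset[OF K(1)]
      by (auto intro!: psubset_card_mono card_mono)
    then have "card (carrier G) - card K < card (carrier G) - card H" by simp
    from less(1)[OF this K(1,2)] K(3,5) show ?thesis by (metis subsetD)
  qed (use less in blast)
qed

lemma ex_separating_character:
  assumes fin: "finite (carrier G)" and b: "b \<in> carrier G" "b \<noteq> \<one>"
  shows "\<exists>\<psi>. partial_character G (carrier G) \<psi> \<and> \<psi> b \<noteq> 1"
proof -
  have H: "subgroup {\<one>} G" by (rule triv_subgroup)
  have chi: "partial_character G {\<one>} (\<lambda>x. 1)" by (simp add: partial_character_def)
  obtain k :: nat where k: "k > 0" "b [^] k \<in> {\<one>}" "\<And>j. 0 < j \<Longrightarrow> j < k \<Longrightarrow> b [^] j \<notin> {\<one>}"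
    by (rule ex_least_pow[OF fin H b(1)]) blast
  have "k \<noteq> 1" using k(2) b by auto
  with k(1) have k2: "k \<ge> 2" by simp
  \<comment> \<open>A primitive k-th root of unity, where k is the order of b. As k is at least 2,
    its angle lies in (0, pi], where the cosine is below 1.\<close>
  let ?z = "cis (2 * pi / k)"
  have z: "?z ^ k = 1" using k(1) by (simp add: DeMoivre)
  have "?z \<noteq> 1"
  proof
    assume "?z = 1"
    then have c: "cos (2 * pi / k) = 1" by (simp add: cis.ctr complex_eq_iff)
    have "0 < 2 * pi / k" "2 * pi / k \<le> pi" using k2 by (simp_all add: field_simps)
    then show False using c cos_monotone_0_pi[of 0 "2 * pi / k"] by simp
  qed
  obtain K \<psi> where K: "subgroup K G" "partial_character G K \<psi>" "b \<in> K" "\<psi> b = ?z"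
    using extend_character_step[OF fin H chi b(1) k, of ?z] z by blast
  obtain \<psi>' where "partial_character G (carrier G) \<psi>'" "\<forall>h\<in>K. \<psi>' h = \<psi> h"
    using extend_character[OF fin K(1,2)] by blast
  with K \<open>?z \<noteq> 1\<close> show ?thesis by metis
qed

end

section \<open>Characters of a finite group and its abelianisation\<close>

context finite_group
begin

text \<open>Extensionality counts each homomorphism once, which makes \<open>chars\<close> finite
  and sums over it meaningful.\<close>

definition chars :: "('g \<Rightarrow> complex) set" where
  "chars = {\<chi> \<in> extensional (carrier G). \<chi> \<one> = 1 \<and>
    (\<forall>x\<in>carrier G. \<forall>y\<in>carrier G. \<chi> (x \<otimes> y) = \<chi> x * \<chi> y)}"

lemma charsD:
  assumes "\<chi> \<in> chars"
  shows "\<chi> \<one> = 1" "x \<in> carrier G \<Longrightarrow> y \<in> carrier G \<Longrightarrow> \<chi> (x \<otimes> y) = \<chi> x * \<chi> y" "\<chi> \<in> extensional (carrier G)"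
  using assms by (auto simp: chars_def)

definition triv :: "'g \<Rightarrow> complex" where
  "triv = (\<lambda>x\<in>carrier G. 1)"

lemma triv_chars: "triv \<in> chars"
  by (simp add: triv_def chars_def)

lemma chars_pow: "\<chi> \<in> chars \<Longrightarrow> x \<in> carrier G \<Longrightarrow> \<chi> (x [^] (n::nat)) = \<chi> x ^ n"
  by (induction n) (simp_all add: charsD)

lemma finite_chars: "finite chars"
proof (rule finite_subset)
  have "order G > 0" using fin order_gt_0_iff_finite by blast
  then have "finite {z::complex. z ^ order G = 1}" by (intro finite_roots_unity) auto
  then show "finite (carrier G \<rightarrow>\<^sub>E {z::complex. z ^ order G = 1})" using fin by (intro finite_PiE) auto
  show "chars \<subseteq> carrier G \<rightarrow>\<^sub>E {z::complex. z ^ order G = 1}"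
    using chars_pow[of _ _ "order G"] by (auto simp: pow_order_eq_1 charsD PiE_def)
qed

lemma chars_mult: "\<chi> \<in> chars \<Longrightarrow> \<psi> \<in> chars \<Longrightarrow> (\<lambda>x\<in>carrier G. \<chi> x * \<psi> x) \<in> chars"
  by (auto simp: chars_def)

lemma chars_nonzero: "\<chi> \<in> chars \<Longrightarrow> x \<in> carrier G \<Longrightarrow> \<chi> x \<noteq> 0"
  using charsD(2)[of \<chi> x "inv x"] charsD(1)[of \<chi>] by auto

lemma chars_inv: "\<chi> \<in> chars \<Longrightarrow> (\<lambda>x\<in>carrier G. inverse (\<chi> x)) \<in> chars"
  by (auto simp: chars_def)

text \<open>A nontrivial class in the abelianisation is detected by a character of that group, which
  is then pulled back.\<close>

lemma char_separates:
  assumes "g \<in> carrier G" "\<And>\<chi>. \<chi> \<in> chars \<Longrightarrow> \<chi> g = 1"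
  shows "g \<in> derived G (carrier G)"
proof (rule ccontr)
  let ?D = "derived G (carrier G)"
  assume g: "g \<notin> ?D"
  have D: "?D \<lhd> G" by (rule derived_self_is_normal)
  interpret A: comm_group "G Mod ?D" by (rule derived_quot_is_comm_group)
  have q: "(\<lambda>x. ?D #> x) \<in> hom G (G Mod ?D)" by (rule normal.r_coset_hom_Mod[OF D])
  have one: "\<one>\<^bsub>G Mod ?D\<^esub> = ?D" by (simp add: FactGroup_def)
  have "?D #> g \<noteq> \<one>\<^bsub>G Mod ?D\<^esub>"
    unfolding one using g assms(1) D by (metis normal_imp_subgroup rcos_self)
  moreover have "finite (carrier (G Mod ?D))"
    using fin by (simp add: FactGroup_def RCOSETS_def)
  ultimately obtain \<psi> where psi: "partial_character (G Mod ?D) (carrier (G Mod ?D)) \<psi>" "\<psi> (?D #> g) \<noteq> 1"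
    using A.ex_separating_character[of "?D #> g"] hom_in_carrier[OF q assms(1)] by blast
  have "(\<lambda>x\<in>carrier G. \<psi> (?D #> x)) \<in> chars"
    using psi(1) hom_in_carrier[OF q] hom_mult[OF q] hom_one[OF q is_group A.is_group]
    by (auto simp: chars_def partial_character_def)
  from assms(2)[OF this] psi(2) assms(1) show False by simp
qed

lemma chars_derived:
  assumes chi: "\<chi> \<in> chars" and g: "g \<in> derived G (carrier G)"
  shows "\<chi> g = 1"
proof -
  have "g \<in> carrier G \<and> \<chi> g = 1" if "g \<in> generate G (\<Union>h1\<in>carrier G. \<Union>h2\<in>carrier G. {h1 \<otimes> h2 \<otimes> inv h1 \<otimes> inv h2})"
    using that
  proof (induction rule: generate.induct)
    case one
    show ?case using charsD(1)[OF chi] by simp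
  next
    case (incl h)
    then obtain a b where h: "a \<in> carrier G" "b \<in> carrier G" "h = a \<otimes> b \<otimes> inv a \<otimes> inv b" by auto
    have "\<chi> a * \<chi> (inv a) = 1" "\<chi> b * \<chi> (inv b) = 1"
      using h charsD(2)[OF chi, of a "inv a"] charsD(2)[OF chi, of b "inv b"] charsD(1)[OF chi] by auto
    then have "\<chi> h = 1" using h by (simp add: charsD(2)[OF chi] mult_ac) (metis mult.assoc mult.commute mult_1)
    with h show ?case by simp
  next
    case (inv h)
    then obtain a b where h: "a \<in> carrier G" "b \<in> carrier G" "h = a \<otimes> b \<otimes> inv a \<otimes> inv b" by auto
    have "\<chi> a * \<chi> (inv a) = 1" "\<chi> b * \<chi> (inv b) = 1"
      using h charsD(2)[OF chi, of a "inv a"] charsD(2)[OF chi, of b "inv b"] charsD(1)[OF chi] by auto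
    then have 1: "\<chi> h = 1" using h by (simp add: charsD(2)[OF chi] mult_ac) (metis mult.assoc mult.commute mult_1)
    have hc: "h \<in> carrier G" using h by simp
    have "\<chi> (inv h) = 1" using 1 charsD(1)[OF chi] charsD(2)[OF chi hc, of "inv h"] hc by simp
    with hc show ?case by simp
  next
    case (eng h1 h2)
    then show ?case by (simp add: charsD(2)[OF chi])
  qed
  then show ?thesis using g by (auto simp: derived_def)
qed

text \<open>Multiplication by a character \<psi> with \<psi> g \<noteq> 1 permutes
  \<open>chars\<close>, so the sum equals \<psi> g times itself.\<close>

lemma sum_chars:
  assumes g: "g \<in> carrier G"
  shows "(\<Sum>\<chi>\<in>chars. \<chi> g) = (if g \<in> derived G (carrier G) then of_nat (card chars) else 0)"
proof (cases "g \<in> derived G (carrier G)")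
  case True
  then show ?thesis by (simp add: chars_derived cong: sum.cong)
next
  case False
  then obtain \<psi> where psi: "\<psi> \<in> chars" "\<psi> g \<noteq> 1" using char_separates[OF g] by blast
  let ?m = "\<lambda>\<psi> \<chi>. \<lambda>x\<in>carrier G. \<psi> x * \<chi> x" and ?i = "\<lambda>x\<in>carrier G. inverse (\<psi> x)"
  have "(\<Sum>\<chi>\<in>chars. \<chi> g) = (\<Sum>\<chi>\<in>chars. ?m \<psi> \<chi> g)"
  proof (rule sum.reindex_bij_witness[of _ "?m \<psi>" "?m ?i"])
    show "?m \<psi> (?m ?i \<chi>) = \<chi>" "?m ?i (?m \<psi> \<chi>) = \<chi>" if "\<chi> \<in> chars" for \<chi>
      using charsD(3)[OF that] chars_nonzero[OF psi(1)] by (auto simp: extensional_def fun_eq_iff)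
    then show "?m \<psi> (?m ?i \<chi>) g = \<chi> g" if "\<chi> \<in> chars" for \<chi> using that by metis
  qed (rule chars_mult[OF chars_inv[OF psi(1)]] chars_mult[OF psi(1)], assumption)+
  also have "\<dots> = \<psi> g * (\<Sum>\<chi>\<in>chars. \<chi> g)" using g by (simp add: sum_distrib_left)
  finally have "(\<psi> g - 1) * (\<Sum>\<chi>\<in>chars. \<chi> g) = 0" by (simp add: algebra_simps)
  with psi(2) False show ?thesis by simp
qed

text \<open>Fourier inversion on the abelianisation: if the transform of \<open>c\<close> lives at
  the trivial character alone, then \<open>c\<close> has the same sum over every coset of the
  derived subgroup, and the total is the number of cosets times this integer.\<close>

lemma card_quotient_dvd:
  fixes c :: "'g \<Rightarrow> int"
  assumes "\<And>\<chi>. \<chi> \<in> chars \<Longrightarrow> \<chi> \<noteq> triv \<Longrightarrow> (\<Sum>g\<in>carrier G. of_int (c g) * \<chi> g) = 0"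
  shows "int (order (G Mod derived G (carrier G))) dvd (\<Sum>g\<in>carrier G. c g)"
proof -
  let ?D = "derived G (carrier G)" and ?f = "\<lambda>\<chi>. \<Sum>g\<in>carrier G. of_int (c g) * \<chi> g"
  have sub: "subgroup ?D G" by (rule normal_imp_subgroup[OF derived_self_is_normal])
  have N: "card chars \<noteq> 0" using triv_chars finite_chars by auto
  \<comment> \<open>The transform is multiplied by \<open>\<chi> (inv a)\<close> and summed over
    \<open>chars\<close>. By hypothesis this leaves the trivial character; by orthogonality it
    leaves the coset of \<open>a\<close>. The factor \<open>card chars\<close> is common to all
    cosets and cancels.\<close>
  have coset: "of_int (\<Sum>g\<in>carrier G. c g) = of_nat (card chars) * (of_int (\<Sum>g\<in>?D #> a. c g) :: complex)"
    if a: "a \<in> carrier G" for a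
  proof -
    have mem: "g \<otimes> inv a \<in> ?D \<longleftrightarrow> g \<in> ?D #> a" if "g \<in> carrier G" for g
    proof
      assume "g \<otimes> inv a \<in> ?D"
      moreover have "g = (g \<otimes> inv a) \<otimes> a" using that a by (simp add: m_assoc)
      ultimately show "g \<in> ?D #> a" unfolding r_coset_def by blast
    next
      assume "g \<in> ?D #> a"
      then obtain h where "h \<in> ?D" "g = h \<otimes> a" by (auto simp: r_coset_def)
      then show "g \<otimes> inv a \<in> ?D" using a subgroup.mem_carrier[OF sub] by (simp add: m_assoc)
    qed
    have "of_int (\<Sum>g\<in>carrier G. c g) = ?f triv * triv (inv a)" using a by (simp add: triv_def)
    also have "\<dots> = (\<Sum>\<chi>\<in>chars. if \<chi> = triv then ?f triv * triv (inv a) else 0)"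
      using finite_chars triv_chars by simp
    also have "\<dots> = (\<Sum>\<chi>\<in>chars. ?f \<chi> * \<chi> (inv a))"
      by (rule sum.cong) (use assms in auto)
    also have "\<dots> = (\<Sum>\<chi>\<in>chars. \<Sum>g\<in>carrier G. of_int (c g) * \<chi> (g \<otimes> inv a))"
      using a by (intro sum.cong refl) (simp add: sum_distrib_right mult.assoc charsD(2) cong: sum.cong)
    also have "\<dots> = (\<Sum>g\<in>carrier G. \<Sum>\<chi>\<in>chars. of_int (c g) * \<chi> (g \<otimes> inv a))" by (rule sum.swap)
    also have "\<dots> = (\<Sum>g\<in>carrier G. if g \<in> ?D #> a then of_nat (card chars) * of_int (c g) else 0)"
      using a by (intro sum.cong refl) (simp add: sum_distrib_left[symmetric] sum_chars mem)
    also have "\<dots> = (\<Sum>g\<in>?D #> a. of_nat (card chars) * of_int (c g))"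
      using r_coset_subset_G[OF subgroup.subset[OF sub] a] fin
      by (intro sum.mono_neutral_cong_right) auto
    finally show ?thesis by (simp add: sum_distrib_left)
  qed
  define k where "k = (\<Sum>g\<in>?D #> \<one>. c g)"
  have k: "(\<Sum>g\<in>C. c g) = k" if C: "C \<in> rcosets ?D" for C
  proof -
    obtain a where a: "a \<in> carrier G" "C = ?D #> a" using C by (auto simp: RCOSETS_def)
    have "of_nat (card chars) * (of_int (\<Sum>g\<in>C. c g) :: complex) = of_nat (card chars) * of_int k"
      using coset[OF a(1)] coset[OF one_closed] unfolding a(2) k_def by simp
    then show ?thesis using N by (metis mult_left_cancel of_int_eq_iff of_nat_eq_0_iff)
  qed
  have "(\<Sum>g\<in>carrier G. c g) = sum c (\<Union>(rcosets ?D))" by (simp add: rcosets_part_G[OF sub])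
  also have "\<dots> = (\<Sum>C\<in>rcosets ?D. sum c C)"
  proof (rule sum.Union_disjoint[unfolded o_def, of "rcosets ?D" c])
    show "\<forall>C\<in>rcosets ?D. finite C"
      using fin rcosets_part_G[OF sub] finite_subset by (metis Union_upper)
    show "\<forall>C\<in>rcosets ?D. \<forall>C'\<in>rcosets ?D. C \<noteq> C' \<longrightarrow> C \<inter> C' = {}"
      using rcos_disjoint[OF sub] by (auto simp: pairwise_def disjnt_def)
  qed
  also have "\<dots> = int (card (rcosets ?D)) * k" using k by simp
  finally show ?thesis by (simp add: Coset.order_def FactGroup_def)
qed

text \<open>The image of the integral group ring in the functions on \<open>chars\<close>. Its
  closure under sums and products carries integrality from matrix entries to determinants.\<close>

definition integral_span :: "(('g \<Rightarrow> complex) \<Rightarrow> complex) set" where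
  "integral_span = {F. \<exists>c. \<forall>\<chi>\<in>chars. F \<chi> = (\<Sum>g\<in>carrier G. of_int (c g) * \<chi> g)}"

lemma integral_span_sum:
  assumes "\<And>i. i \<in> I \<Longrightarrow> F i \<in> integral_span"
  shows "(\<lambda>\<chi>. \<Sum>i\<in>I. F i \<chi>) \<in> integral_span"
proof -
  obtain c where c: "\<And>i \<chi>. i \<in> I \<Longrightarrow> \<chi> \<in> chars \<Longrightarrow> F i \<chi> = (\<Sum>g\<in>carrier G. of_int (c i g) * \<chi> g)"
    using assms unfolding integral_span_def mem_Collect_eq by metis
  have "(\<Sum>i\<in>I. F i \<chi>) = (\<Sum>g\<in>carrier G. of_int (\<Sum>i\<in>I. c i g) * \<chi> g)" if "\<chi> \<in> chars" for \<chi>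
  proof -
    have "(\<Sum>i\<in>I. F i \<chi>) = (\<Sum>i\<in>I. \<Sum>g\<in>carrier G. of_int (c i g) * \<chi> g)"
      by (rule sum.cong) (simp_all add: c that)
    also have "\<dots> = (\<Sum>g\<in>carrier G. \<Sum>i\<in>I. of_int (c i g) * \<chi> g)" by (rule sum.swap)
    finally show ?thesis by (simp add: sum_distrib_right)
  qed
  then show ?thesis unfolding integral_span_def by (intro CollectI exI[of _ "\<lambda>g. \<Sum>i\<in>I. c i g"]) simp
qed

text \<open>The coefficients of a product are the convolution of the coefficients.\<close>

lemma integral_span_mult:
  assumes "F \<in> integral_span" "F' \<in> integral_span"
  shows "(\<lambda>\<chi>. F \<chi> * F' \<chi>) \<in> integral_span"
proof -
  obtain c c' where c: "\<And>\<chi>. \<chi> \<in> chars \<Longrightarrow> F \<chi> = (\<Sum>g\<in>carrier G. of_int (c g) * \<chi> g)"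
    and c': "\<And>\<chi>. \<chi> \<in> chars \<Longrightarrow> F' \<chi> = (\<Sum>g\<in>carrier G. of_int (c' g) * \<chi> g)"
    using assms unfolding integral_span_def by auto
  let ?c = "\<lambda>k. \<Sum>g\<in>carrier G. c g * c' (inv g \<otimes> k)"
  have "F \<chi> * F' \<chi> = (\<Sum>k\<in>carrier G. of_int (?c k) * \<chi> k)" if chi: "\<chi> \<in> chars" for \<chi>
  proof -
    have "(\<Sum>k\<in>carrier G. of_int (?c k) * \<chi> k)
      = (\<Sum>k\<in>carrier G. \<Sum>g\<in>carrier G. of_int (c g * c' (inv g \<otimes> k)) * \<chi> k)"
      by (simp add: sum_distrib_right)
    also have "\<dots> = (\<Sum>g\<in>carrier G. \<Sum>k\<in>carrier G. of_int (c g * c' (inv g \<otimes> k)) * \<chi> k)"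
      by (rule sum.swap)
    also have "\<dots> = (\<Sum>g\<in>carrier G. \<Sum>k\<in>carrier G. of_int (c g * c' (inv g \<otimes> (g \<otimes> k))) * \<chi> (g \<otimes> k))"
      by (rule sum.cong[OF refl]) (rule sum_left_translate[symmetric])
    also have "\<dots> = (\<Sum>g\<in>carrier G. \<Sum>k\<in>carrier G. (of_int (c g) * \<chi> g) * (of_int (c' k) * \<chi> k))"
    proof (intro sum.cong refl)
      fix g k assume gk: "g \<in> carrier G" "k \<in> carrier G"
      then have "inv g \<otimes> (g \<otimes> k) = k" by (simp add: m_assoc[symmetric])
      then show "of_int (c g * c' (inv g \<otimes> (g \<otimes> k))) * \<chi> (g \<otimes> k) = of_int (c g) * \<chi> g * (of_int (c' k) * \<chi> k)"
        using charsD(2)[OF chi gk] by simp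
    qed
    also have "\<dots> = F \<chi> * F' \<chi>" unfolding c[OF chi] c'[OF chi] by (rule sum_product[symmetric])
    finally show ?thesis ..
  qed
  then show ?thesis unfolding integral_span_def by (intro CollectI exI[of _ ?c] ballI)
qed

lemma integral_span_ev: "g \<in> carrier G \<Longrightarrow> (\<lambda>\<chi>. \<chi> g) \<in> integral_span"
  unfolding integral_span_def
  by (intro CollectI exI[of _ "\<lambda>h. if h = g then 1 else 0"])
    (use fin in \<open>simp add: if_distrib[of "\<lambda>t. of_int t * _"] if_distrib[of "\<lambda>t. t * _"] cong: if_cong\<close>)

lemma integral_span_cong: "F \<in> integral_span \<Longrightarrow> (\<And>\<chi>. \<chi> \<in> chars \<Longrightarrow> F \<chi> = F' \<chi>) \<Longrightarrow> F' \<in> integral_span"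
  unfolding integral_span_def by auto

lemma integral_span_of_int: "(\<lambda>\<chi>. of_int k) \<in> integral_span"
  unfolding integral_span_def
  by (intro CollectI exI[of _ "\<lambda>h. if h = \<one> then k else 0"])
    (use fin in \<open>simp add: charsD if_distrib[of "\<lambda>t. of_int t * _"] if_distrib[of "\<lambda>t. t * _"] cong: if_cong\<close>)

lemma integral_span_prod:
  assumes "\<And>i. i \<in> I \<Longrightarrow> F i \<in> integral_span" "finite I"
  shows "(\<lambda>\<chi>. \<Prod>i\<in>I. F i \<chi>) \<in> integral_span"
  using assms(2,1)
proof induction
  case empty
  show ?case using integral_span_of_int[of 1] by simp
next
  case (insert i I)
  then show ?case using integral_span_mult[of "F i" "\<lambda>\<chi>. \<Prod>i\<in>I. F i \<chi>"] by simp
qed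

lemma integral_span_det:
  assumes "\<And>i j. i < r \<Longrightarrow> j < r \<Longrightarrow> F i j \<in> integral_span"
  shows "(\<lambda>\<chi>. det (mat r r (\<lambda>(i, j). F i j \<chi>))) \<in> integral_span"
proof -
  have "det (mat r r (\<lambda>(i, j). F i j \<chi>)) = (\<Sum>p | p permutes {0..<r}. of_int (sign p) * (\<Prod>i\<in>{0..<r}. F i (p i) \<chi>))" for \<chi>
  proof -
    have "p i < r" if "p permutes {0..<r}" "i < r" for p i
      using permutes_in_image[OF that(1), of i] that(2) by simp
    then show ?thesis
      by (subst det_def'[OF mat_carrier]) (auto intro!: sum.cong prod.cong)
  qed
  moreover have "(\<lambda>\<chi>. \<Sum>p | p permutes {0..<r}. of_int (sign p) * (\<Prod>i\<in>{0..<r}. F i (p i) \<chi>)) \<in> integral_span"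
  proof (intro integral_span_sum integral_span_mult integral_span_of_int integral_span_prod)
    fix p i assume "p \<in> {p. p permutes {0..<r}}" "i \<in> {0..<r}"
    then show "F i (p i) \<in> integral_span" using assms permutes_in_image[of p "{0..<r}" i] by auto
  qed auto
  ultimately show ?thesis by simp
qed

end

section \<open>Homology and cohomology from the coboundary matrices\<close>

text \<open>As \<open>phi\<close> is onto and reflects the relation, any choice of preimages is an
  inverse up to the relations.\<close>

lemma bij_betw_quotients_surj:
  assumes E: "equiv K E" and E': "equiv K' E'" and im: "phi ` K = K'"
    and iff: "\<And>x y. x \<in> K \<Longrightarrow> y \<in> K \<Longrightarrow> (x, y) \<in> E \<longleftrightarrow> (phi x, phi y) \<in> E'"
  shows "\<exists>h. bij_betw h (K // E) (K' // E')"
proof (rule exI, rule bij_betw_quotients[OF E E', where phi = phi and psi = "inv_into K phi"])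
  have sub: "E \<subseteq> K \<times> K" "E' \<subseteq> K' \<times> K'"
    using E E' by (auto simp: equiv_def refl_on_def)
  have r: "inv_into K phi y \<in> K" "phi (inv_into K phi y) = y" if "y \<in> K'" for y
    using that im by (auto intro: inv_into_into f_inv_into_f)
  show "phi x \<in> K'" if "x \<in> K" for x using that im by blast
  show "(phi x, phi y) \<in> E'" if "(x, y) \<in> E" for x y using that iff sub by blast
  show "inv_into K phi x \<in> K" if "x \<in> K'" for x using r that by blast
  show "(inv_into K phi x, inv_into K phi y) \<in> E" if xy: "(x, y) \<in> E'" for x y
  proof -
    have "x \<in> K'" "y \<in> K'" using xy sub by auto
    then show ?thesis using iff[OF r(1) r(1), of x y] r(2) xy by simp
  qed
  show "(x, inv_into K phi (phi x)) \<in> E" if x: "x \<in> K" for x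
  proof -
    have "phi x \<in> K'" using x im by blast
    then show ?thesis
      using iff[OF x r(1), of "phi x"] r(2)[of "phi x"] E' by (simp add: equiv_def refl_on_def)
  qed
  show "(x, phi (inv_into K phi x)) \<in> E'" if "x \<in> K'" for x
    using that r(2) E' by (simp add: equiv_def refl_on_def)
qed

lemma tr_mat_add: "A \<in> carrier_mat n n \<Longrightarrow> B \<in> carrier_mat n n \<Longrightarrow> tr_mat (A + B) = tr_mat A + tr_mat B"
  by (simp add: tr_mat_def sum.distrib)

section \<open>Coboundary matrices and traces\<close>

context finite_group
begin

abbreviation "r n \<equiv> card (X n)"

definition en :: "nat \<Rightarrow> nat \<Rightarrow> 'g list" where
  "en n = (SOME f. bij_betw f {..<r n} (X n))"

lemma en: "bij_betw (en n) {..<r n} (X n)"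
  unfolding en_def
  using someI_ex[OF ex_bij_betw_nat_finite[OF finite_X[of n]]] by (simp add: atLeast0LessThan)

lemma en_X: "i < r n \<Longrightarrow> en n i \<in> X n"
  using bij_betwE[OF en] by auto

lemma en_eq_iff: "i < r n \<Longrightarrow> j < r n \<Longrightarrow> en n i = en n j \<longleftrightarrow> i = j"
  using bij_betw_imp_inj_on[OF en[of n]] by (auto simp: inj_on_def)

lemma ex_en: "l \<in> X n \<Longrightarrow> \<exists>i<r n. l = en n i"
  using bij_betw_imp_surj_on[OF en[of n]] by auto

lemma sum_en: "(\<Sum>i<r n. f (en n i)) = (\<Sum>l\<in>X n. f l)"
  by (rule sum.reindex_bij_betw[OF en])

text \<open>Rows belong to degree \<open>Suc n\<close> and columns to degree \<open>n\<close>: the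
  matrix acts on cochains. At the trivial character its transpose is the boundary on
  coinvariants.\<close>

definition Bmat :: "('g \<Rightarrow> 'a::comm_ring_1) \<Rightarrow> nat \<Rightarrow> 'a mat" where
  "Bmat \<chi> n = mat (r (Suc n)) (r n) (\<lambda>(i, j). cob \<chi> (en (Suc n) i) (en n j))"

definition Hmat :: "('g \<Rightarrow> 'a::comm_ring_1) \<Rightarrow> nat \<Rightarrow> 'a mat" where
  "Hmat \<chi> n = mat (r n) (r (Suc n)) (\<lambda>(i, j). hty \<chi> (en n i) (en (Suc n) j))"

lemma Bmat_carrier: "Bmat \<chi> n \<in> carrier_mat (r (Suc n)) (r n)"
  and Hmat_carrier: "Hmat \<chi> n \<in> carrier_mat (r n) (r (Suc n))"
  by (simp_all add: Bmat_def Hmat_def)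

lemma Bmat_index: "i < r (Suc n) \<Longrightarrow> j < r n \<Longrightarrow> Bmat \<chi> n $$ (i, j) = cob \<chi> (en (Suc n) i) (en n j)"
  and Hmat_index: "i < r n \<Longrightarrow> j < r (Suc n) \<Longrightarrow> Hmat \<chi> n $$ (i, j) = hty \<chi> (en n i) (en (Suc n) j)"
  by (simp_all add: Bmat_def Hmat_def)

context
  fixes \<chi> :: "'g \<Rightarrow> 'a::comm_ring_1"
  assumes chi_one: "\<chi> \<one> = 1" and chi_mult: "\<And>g h. g \<in> carrier G \<Longrightarrow> h \<in> carrier G \<Longrightarrow> \<chi> (g \<otimes> h) = \<chi> g * \<chi> h"
begin

lemma Bmat_Bmat: "Bmat \<chi> (Suc n) * Bmat \<chi> n = 0\<^sub>m (r (Suc (Suc n))) (r n)"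
proof (rule eq_matI)
  fix i j assume "i < dim_row (0\<^sub>m (r (Suc (Suc n))) (r n))" "j < dim_col (0\<^sub>m (r (Suc (Suc n))) (r n))"
  then have ij: "i < r (Suc (Suc n))" "j < r n" by auto
  let ?l = "en (Suc (Suc n)) i" and ?l' = "en n j"
  have "(Bmat \<chi> (Suc n) * Bmat \<chi> n) $$ (i, j) = (\<Sum>k<r (Suc n). cob \<chi> ?l (en (Suc n) k) * cob \<chi> (en (Suc n) k) ?l')"
    using ij by (simp add: index_mult_mat_sum[OF Bmat_carrier Bmat_carrier] Bmat_index)
  also have "\<dots> = (\<Sum>s\<in>X (Suc n). cob \<chi> ?l s * cob \<chi> s ?l')" by (rule sum_en)
  also have "\<dots> = (\<Sum>s\<in>X (Suc n). cob \<chi> ?l s * (\<Sum>q\<in>X n. cob \<chi> s q * ind ?l' q))"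
    using ij by (simp add: sum_ind finite_X en_X)
  also have "\<dots> = 0" by (rule cob_cob[OF chi_one chi_mult en_X[OF ij(1)]])
  finally show "(Bmat \<chi> (Suc n) * Bmat \<chi> n) $$ (i, j) = 0\<^sub>m (r (Suc (Suc n))) (r n) $$ (i, j)"
    using ij by simp
qed (simp_all add: Bmat_def)

lemma Bmat_Hmat:
  "Bmat \<chi> n * Hmat \<chi> n + Hmat \<chi> (Suc n) * Bmat \<chi> (Suc n) = of_nat (card (carrier G)) \<cdot>\<^sub>m 1\<^sub>m (r (Suc n))"
proof (rule eq_matI)
  fix i j assume "i < dim_row (of_nat (card (carrier G)) \<cdot>\<^sub>m 1\<^sub>m (r (Suc n)))"
    "j < dim_col (of_nat (card (carrier G)) \<cdot>\<^sub>m 1\<^sub>m (r (Suc n)))"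
  then have ij: "i < r (Suc n)" "j < r (Suc n)" by auto
  let ?l = "en (Suc n) i" and ?l' = "en (Suc n) j"
  have "(Bmat \<chi> n * Hmat \<chi> n) $$ (i, j) = (\<Sum>k<r n. cob \<chi> ?l (en n k) * hty \<chi> (en n k) ?l')"
    using ij by (simp add: index_mult_mat_sum[OF Bmat_carrier Hmat_carrier] Bmat_index Hmat_index)
  also have "\<dots> = (\<Sum>s\<in>X n. cob \<chi> ?l s * hty \<chi> s ?l')" by (rule sum_en)
  also have "\<dots> = (\<Sum>s\<in>X n. cob \<chi> ?l s * (\<Sum>q\<in>X (Suc n). hty \<chi> s q * ind ?l' q))"
    using ij by (simp add: sum_ind finite_X en_X)
  finally have 1: "(Bmat \<chi> n * Hmat \<chi> n) $$ (i, j) = \<dots>" .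
  have "(Hmat \<chi> (Suc n) * Bmat \<chi> (Suc n)) $$ (i, j)
    = (\<Sum>k<r (Suc (Suc n)). hty \<chi> ?l (en (Suc (Suc n)) k) * cob \<chi> (en (Suc (Suc n)) k) ?l')"
    using ij by (simp add: index_mult_mat_sum[OF Hmat_carrier Bmat_carrier] Bmat_index Hmat_index)
  also have "\<dots> = (\<Sum>s\<in>X (Suc (Suc n)). hty \<chi> ?l s * cob \<chi> s ?l')" by (rule sum_en)
  also have "\<dots> = (\<Sum>s\<in>X (Suc (Suc n)). hty \<chi> ?l s * (\<Sum>q\<in>X (Suc n). cob \<chi> s q * ind ?l' q))"
    using ij by (simp add: sum_ind finite_X en_X)
  finally have 2: "(Hmat \<chi> (Suc n) * Bmat \<chi> (Suc n)) $$ (i, j) = \<dots>" .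
  have "(Bmat \<chi> n * Hmat \<chi> n) $$ (i, j) + (Hmat \<chi> (Suc n) * Bmat \<chi> (Suc n)) $$ (i, j)
    = of_nat (card (carrier G)) * ind ?l' ?l"
    unfolding 1 2 by (rule cob_hty[OF chi_one chi_mult en_X[OF ij(1)]])
  then show "(Bmat \<chi> n * Hmat \<chi> n + Hmat \<chi> (Suc n) * Bmat \<chi> (Suc n)) $$ (i, j)
    = (of_nat (card (carrier G)) \<cdot>\<^sub>m 1\<^sub>m (r (Suc n))) $$ (i, j)"
    using ij mult_carrier_mat[OF Hmat_carrier Bmat_carrier, of \<chi> "Suc n" \<chi>]
    by (subst index_add_mat) (auto simp: ind_def en_eq_iff Hmat_def simp del: index_mult_mat(1))
qed (simp_all add: Bmat_def Hmat_def)

lemma tr_Hmat_Bmat_0: "tr_mat (Hmat \<chi> 0 * Bmat \<chi> 0) = of_nat (card (carrier G)) - (\<Sum>g\<in>carrier G. \<chi> g)"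
proof -
  have r0: "r 0 = 1" by (simp add: X_0)
  have en0: "en 0 0 = []" using en_X[of 0 0] r0 by (simp add: X_0)
  have "tr_mat (Hmat \<chi> 0 * Bmat \<chi> 0) = (Hmat \<chi> 0 * Bmat \<chi> 0) $$ (0, 0)"
    using r0 by (simp add: tr_mat_def Hmat_def del: index_mult_mat(1))
  also have "\<dots> = (\<Sum>k<r (Suc 0). hty \<chi> [] (en (Suc 0) k) * cob \<chi> (en (Suc 0) k) [])"
    using r0 by (simp add: index_mult_mat_sum[OF Hmat_carrier Bmat_carrier] Bmat_index Hmat_index en0)
  also have "\<dots> = (\<Sum>s\<in>X (Suc 0). hty \<chi> [] s * cob \<chi> s [])" by (rule sum_en)
  also have "\<dots> = (\<Sum>s\<in>X 1. hty \<chi> [] s * (\<Sum>q\<in>X 0. cob \<chi> s q * 1))" by (simp add: X_0)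
  also have "\<dots> = (of_nat (card (carrier G)) - (\<Sum>g\<in>carrier G. \<chi> g)) * 1"
    using hty_cob_0[OF chi_one chi_mult, of "\<lambda>_. 1"] by simp
  finally show ?thesis by simp
qed

text \<open>Multiplying the homotopy identity by the coboundary on the left, the first term contains
  two consecutive coboundaries and vanishes. This is the generalised inverse required by
  \<open>rank_eq_trace\<close>, with factor |G|.\<close>

lemma Bmat_Hmat_Bmat:
  "Bmat \<chi> (Suc n) * Hmat \<chi> (Suc n) * Bmat \<chi> (Suc n) = of_nat (card (carrier G)) \<cdot>\<^sub>m Bmat \<chi> (Suc n)"
proof -
  let ?B = "Bmat \<chi> (Suc n)" and ?H = "Hmat \<chi> (Suc n)" and ?A = "Bmat \<chi> n" and ?K = "Hmat \<chi> n"
  let ?c = "of_nat (card (carrier G)) :: 'a"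
  note B = Bmat_carrier[of \<chi> "Suc n"] and H = Hmat_carrier[of \<chi> "Suc n"]
    and A = Bmat_carrier[of \<chi> n] and K = Hmat_carrier[of \<chi> n]
  have "?B * (?c \<cdot>\<^sub>m 1\<^sub>m (r (Suc n))) = ?B * (?A * ?K) + ?B * (?H * ?B)"
    unfolding Bmat_Hmat[symmetric]
    by (rule mult_add_distrib_mat[OF B mult_carrier_mat[OF A K] mult_carrier_mat[OF H B]])
  also have "?B * (?A * ?K) = 0\<^sub>m (r (Suc (Suc n))) (r (Suc n))"
    unfolding assoc_mult_mat[OF B A K, symmetric] Bmat_Bmat by (rule left_mult_zero_mat[OF K])
  also have "?B * (?H * ?B) = ?B * ?H * ?B" by (rule assoc_mult_mat[OF B H B, symmetric])
  also have "0\<^sub>m (r (Suc (Suc n))) (r (Suc n)) + ?B * ?H * ?B = ?B * ?H * ?B"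
    by (rule left_add_zero_mat[OF mult_carrier_mat[OF mult_carrier_mat[OF B H] B]])
  also have "?B * (?c \<cdot>\<^sub>m 1\<^sub>m (r (Suc n))) = ?c \<cdot>\<^sub>m ?B"
    unfolding mult_smult_distrib[OF B one_carrier_mat] right_mult_one_mat[OF B] ..
  finally show ?thesis ..
qed

text \<open>The trace of the homotopy identity, after exchanging the factors of its second term. In
  positive degrees it says that the ranks of consecutive coboundaries add up to the number of basis
  elements, which is exactness.\<close>

lemma tr_Bmat_Hmat_Suc:
  "tr_mat (Bmat \<chi> (Suc n) * Hmat \<chi> (Suc n)) = of_nat (card (carrier G)) * of_nat (r (Suc n)) - tr_mat (Bmat \<chi> n * Hmat \<chi> n)"
proof -
  have "tr_mat (Bmat \<chi> n * Hmat \<chi> n + Hmat \<chi> (Suc n) * Bmat \<chi> (Suc n))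
    = tr_mat (Bmat \<chi> n * Hmat \<chi> n) + tr_mat (Hmat \<chi> (Suc n) * Bmat \<chi> (Suc n))"
    by (rule tr_mat_add[OF mult_carrier_mat[OF Bmat_carrier Hmat_carrier] mult_carrier_mat[OF Hmat_carrier Bmat_carrier]])
  moreover have "tr_mat (Hmat \<chi> (Suc n) * Bmat \<chi> (Suc n)) = tr_mat (Bmat \<chi> (Suc n) * Hmat \<chi> (Suc n))"
    by (rule tr_mat_comm[OF Hmat_carrier Bmat_carrier])
  ultimately show ?thesis
    unfolding Bmat_Hmat by (simp add: tr_mat_def mult.commute)
qed

end

section \<open>The integral matrices of the trivial character\<close>

abbreviation "B n \<equiv> Bmat (\<lambda>_. 1 :: int) n"
abbreviation "H n \<equiv> Hmat (\<lambda>_. 1 :: int) n"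

lemma order_pos: "int (card (carrier G)) \<noteq> 0"
  using fin one_closed by (auto simp: card_eq_0_iff)

text \<open>A vector with a nonzero multiple in the image is a cocycle because the integers have no
  torsion; conversely the homotopy writes |G| times a cocycle as a coboundary. Thus all of the
  cohomology is torsion, and the transposed homotopy gives the same for homology.\<close>

lemma saturation_iff:
  assumes v: "v \<in> carrier_vec (r (Suc n))"
  shows "v \<in> saturation (B n) \<longleftrightarrow> B (Suc n) *\<^sub>v v = 0\<^sub>v (r (Suc (Suc n)))"
    and "v \<in> saturation (transpose_mat (B (Suc n))) \<longleftrightarrow> transpose_mat (B n) *\<^sub>v v = 0\<^sub>v (r n)"
proof -
  note Bc = Bmat_carrier[of "\<lambda>_. 1 :: int"] and Hc = Hmat_carrier[of "\<lambda>_. 1 :: int"]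
  let ?c = "int (card (carrier G))"
  have T: "transpose_mat A \<in> carrier_mat m k" if "A \<in> carrier_mat k m" for A :: "int mat" and k m
    using that by simp
  \<comment> \<open>One fact about consecutive maps \<open>A\<close>, \<open>A'\<close> with a
    homotopy serves both claims; transposition reverses the order of the maps.\<close>
  have main: "x \<in> saturation A \<longleftrightarrow> A' *\<^sub>v x = 0\<^sub>v k"
    if A: "A \<in> carrier_mat m j" "A' \<in> carrier_mat k m" "K \<in> carrier_mat j m" "K' \<in> carrier_mat m k"
      and zero: "A' * A = 0\<^sub>m k j" and hom: "A * K + K' * A' = ?c \<cdot>\<^sub>m 1\<^sub>m m" and x: "x \<in> carrier_vec m"
    for A A' K K' :: "int mat" and k m j x
  proof
    assume "x \<in> saturation A"
    then obtain q w where w: "q \<noteq> 0" "w \<in> carrier_vec j" "q \<cdot>\<^sub>v x = A *\<^sub>v w"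
      using A by (auto simp: saturation_def)
    have "q \<cdot>\<^sub>v (A' *\<^sub>v x) = A' *\<^sub>v (A *\<^sub>v w)"
      by (simp only: mat_mult_smult_vec[OF A(2) x, symmetric] w(3))
    also have "\<dots> = 0\<^sub>v k"
      unfolding assoc_mult_mat_vec[OF A(2,1) w(2), symmetric] zero using w(2) by (intro eq_vecI) (auto simp: scalar_prod_def)
    finally have *: "q \<cdot>\<^sub>v (A' *\<^sub>v x) = 0\<^sub>v k" .
    show "A' *\<^sub>v x = 0\<^sub>v k"
    proof (rule eq_vecI)
      show "dim_vec (A' *\<^sub>v x) = dim_vec (0\<^sub>v k)" using A(2) by simp
      fix i assume i: "i < dim_vec (0\<^sub>v k :: int vec)"
      then have "q * (A' *\<^sub>v x) $ i = 0"
        using arg_cong[OF *, of "\<lambda>v. v $ i"] carrier_matD(1)[OF A(2)] by (simp del: index_mult_mat_vec)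
      then show "(A' *\<^sub>v x) $ i = 0\<^sub>v k $ i" using w(1) i by (simp del: index_mult_mat_vec)
    qed
  next
    assume A'x: "A' *\<^sub>v x = 0\<^sub>v k"
    have "?c \<cdot>\<^sub>v x = (?c \<cdot>\<^sub>m 1\<^sub>m m) *\<^sub>v x"
      using x by (intro eq_vecI) (auto simp: scalar_prod_def if_distrib[of "\<lambda>t. _ * t * _"] cong: if_cong)
    also have "\<dots> = A * K *\<^sub>v x + K' * A' *\<^sub>v x"
      unfolding hom[symmetric]
      by (rule add_mult_distrib_mat_vec[OF mult_carrier_mat[OF A(1,3)] mult_carrier_mat[OF A(4,2)] x])
    also have "K' * A' *\<^sub>v x = 0\<^sub>v m"
      unfolding assoc_mult_mat_vec[OF A(4,2) x] A'x by (rule mat_mult_zero_vec[OF A(4)])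
    also have "A * K *\<^sub>v x + 0\<^sub>v m = A * K *\<^sub>v x"
      by (rule right_zero_vec[OF mult_mat_vec_carrier[OF mult_carrier_mat[OF A(1,3)] x]])
    also have "\<dots> = A *\<^sub>v (K *\<^sub>v x)" by (rule assoc_mult_mat_vec[OF A(1,3) x])
    finally have "?c \<cdot>\<^sub>v x = A *\<^sub>v (K *\<^sub>v x)" .
    then show "x \<in> saturation A"
      unfolding saturation_def carrier_matD[OF A(1)] using x order_pos mult_mat_vec_carrier[OF A(3) x] by blast
  qed
  have BB: "B (Suc n) * B n = 0\<^sub>m (r (Suc (Suc n))) (r n)" by (rule Bmat_Bmat) auto
  have BH: "B n * H n + H (Suc n) * B (Suc n) = ?c \<cdot>\<^sub>m 1\<^sub>m (r (Suc n))"
    using Bmat_Hmat[of "\<lambda>_. 1 :: int" n] by simp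
  show "v \<in> saturation (B n) \<longleftrightarrow> B (Suc n) *\<^sub>v v = 0\<^sub>v (r (Suc (Suc n)))"
    by (rule main[OF Bc Bc Hc Hc BB BH v])
  have BBt: "transpose_mat (B n) * transpose_mat (B (Suc n)) = 0\<^sub>m (r n) (r (Suc (Suc n)))"
    unfolding transpose_mult[OF Bc Bc, symmetric] BB by simp
  have "transpose_mat (B (Suc n)) * transpose_mat (H (Suc n)) + transpose_mat (H n) * transpose_mat (B n)
    = transpose_mat (H (Suc n) * B (Suc n)) + transpose_mat (B n * H n)"
    by (simp only: transpose_mult[OF Hc Bc] transpose_mult[OF Bc Hc])
  also have "\<dots> = transpose_mat (H (Suc n) * B (Suc n) + B n * H n)"
    by (rule transpose_add[OF mult_carrier_mat[OF Hc Bc] mult_carrier_mat[OF Bc Hc], symmetric])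
  also have "H (Suc n) * B (Suc n) + B n * H n = ?c \<cdot>\<^sub>m 1\<^sub>m (r (Suc n))"
    using comm_add_mat[OF mult_carrier_mat[OF Hc Bc, of "Suc n"] mult_carrier_mat[OF Bc Hc, of n]] BH by simp
  also have "transpose_mat (?c \<cdot>\<^sub>m 1\<^sub>m (r (Suc n))) = ?c \<cdot>\<^sub>m 1\<^sub>m (r (Suc n))"
    by (rule eq_matI) auto
  finally show "v \<in> saturation (transpose_mat (B (Suc n))) \<longleftrightarrow> transpose_mat (B n) *\<^sub>v v = 0\<^sub>v (r n)"
    by (intro main[OF T[OF Bc] T[OF Bc] T[OF Hc] T[OF Hc] BBt _ v])
qed

text \<open>The augmentation sums the coefficients over the orbit of \<open>\<one> # s\<close>, and
  the indicators of this orbit add up to the extension of \<open>ind s\<close> by the trivial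
  character.\<close>

lemma aug_coord_bar_d:
  assumes l: "l \<in> X (Suc n)" and s: "s \<in> X n"
  shows "aug (coord s (bar_d n (bas l))) = cob (\<lambda>_. 1) l s"
proof -
  have bl: "bas l \<in> carrier (bar (Suc n))" using l by (auto simp: bas_def bar_simps ind_def Cons_X)
  have l1: "\<one> # l \<in> X (Suc (Suc n))" using l by (simp add: Cons_X)
  have "aug (coord s (bar_d n (bas l))) = (\<Sum>g\<in>carrier G. coord s (bar_d n (bas l)) g)"
    by (rule aug_eq) (simp add: group_ring_simps coord_def)
  also have "\<dots> = (\<Sum>g\<in>carrier G. del (ind (tr (\<one> # s) g)) (\<one> # l))"
  proof (rule sum.cong[OF refl])
    fix g assume g: "g \<in> carrier G"
    then have "tr (\<one> # s) g \<in> X (Suc n)" using s by (intro tr_X) (auto simp: Cons_X)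
    then have "coord s (bar_d n (bas l)) g = (\<Sum>t\<in>X (Suc (Suc n)). del (ind (tr (\<one> # s) g)) t * ind (\<one> # l) t)"
      using g bl by (simp add: coord_def bar_d_def bd_def bas_def mult.commute)
    then show "coord s (bar_d n (bas l)) g = del (ind (tr (\<one> # s) g)) (\<one> # l)"
      using l1 by (simp only: sum_ind(1)[OF finite_X] if_True)
  qed
  also have "\<dots> = del (\<lambda>t. \<Sum>g\<in>carrier G. ind (tr (\<one> # s) g) t) (\<one> # l)" by (rule del_sum[symmetric])
  also have "\<dots> = del (ext (\<lambda>_. 1) (ind s)) (\<one> # l)"
  proof (rule del_cong_X[OF l1])
    fix t assume "t \<in> X (Suc n)"
    then obtain h q where t: "t = h # q" "h \<in> carrier G" "q \<in> X n" by (cases t) (auto simp: Cons_X)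
    have "t = tr (\<one> # s) g \<longleftrightarrow> h = g \<and> nrm t = s" if g: "g \<in> carrier G" for g
      using t s g by (auto simp: tr_one_Cons nrm_def tr_inv)
    then have "(\<Sum>g\<in>carrier G. ind (tr (\<one> # s) g) t) = (\<Sum>g\<in>carrier G. if h = g then ind s (nrm t) else (0 :: int))"
      by (intro sum.cong refl) (auto simp: ind_def)
    then show "(\<Sum>g\<in>carrier G. ind (tr (\<one> # s) g) t :: int) = ext (\<lambda>_. 1) (ind s) t"
      using t fin by (simp add: ext_def)
  qed
  finally show ?thesis by (simp only: cob_def)
qed

definition xvec :: "nat \<Rightarrow> ('g list \<Rightarrow> int) \<Rightarrow> int vec" where
  "xvec n x = vec (r n) (\<lambda>i. aug (coord (en n i) x))"

definition fvec :: "nat \<Rightarrow> (('g list \<Rightarrow> int) \<Rightarrow> int) \<Rightarrow> int vec" where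
  "fvec n f = vec (r n) (\<lambda>i. f (bas (en n i)))"

lemma bar_d_hom: "bar_d n \<in> mod_hom (group_ring G) (bar (Suc n)) (bar n)"
  unfolding bar_d_def by (rule bd_hom)

lemma xvec_bar_d:
  assumes x: "x \<in> carrier (bar (Suc n))"
  shows "xvec n (bar_d n x) = transpose_mat (B n) *\<^sub>v xvec (Suc n) x"
proof (rule eq_vecI)
  fix i assume "i < dim_vec (transpose_mat (B n) *\<^sub>v xvec (Suc n) x)"
  then have i: "i < r n" by (simp add: Bmat_def)
  have "aug (coord (en n i) (bar_d n x)) = (\<Sum>l\<in>X (Suc n). aug (coord l x) * cob (\<lambda>_. 1) l (en n i))"
    unfolding based_module_map[OF based_module_bar based_module_bar bar_d_hom x en_X[OF i]]
    by (rule sum.cong) (simp_all add: aug_coord_bar_d en_X[OF i])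
  also have "\<dots> = (\<Sum>k<r (Suc n). aug (coord (en (Suc n) k) x) * cob (\<lambda>_. 1) (en (Suc n) k) (en n i))"
    by (rule sum_en[symmetric])
  finally show "xvec n (bar_d n x) $ i = (transpose_mat (B n) *\<^sub>v xvec (Suc n) x) $ i"
    using i by (simp add: xvec_def scalar_prod_def Bmat_def atLeast0LessThan mult.commute)
qed (simp add: xvec_def Bmat_def)

lemma pure_eq_iff_xvec:
  assumes "x \<in> carrier (bar n)" "y \<in> carrier (bar n)"
  shows "coinvariants.pure G (bar n) x = coinvariants.pure G (bar n) y \<longleftrightarrow> xvec n x = xvec n y"
proof -
  have "xvec n x = xvec n y \<longleftrightarrow> (\<forall>l\<in>X n. aug (coord l x) = aug (coord l y))"
    using ex_en[of _ n] en_X[of _ n] by (auto simp: xvec_def vec_eq_iff)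
  then show ?thesis using based_module.pure_eq_iff_cbar[OF based_module_bar assms] by simp
qed

lemma xvec_add:
  assumes "x \<in> carrier (bar n)" "y \<in> carrier (bar n)"
  shows "xvec n (x \<oplus>\<^bsub>bar n\<^esub> y) = xvec n x + xvec n y"
  by (rule eq_vecI) (simp_all add: xvec_def based_module.cbar_add[OF based_module_bar] assms en_X)

lemma ex_xvec:
  assumes "w \<in> carrier_vec (r n)"
  shows "\<exists>x \<in> carrier (bar n). xvec n x = w"
proof -
  obtain x where x: "x \<in> carrier (bar n)"
    "\<forall>l\<in>X n. aug (coord l x) = w $ (the_inv_into {..<r n} (en n) l)"
    using based_module.ex_cbar[OF based_module_bar[of n], of "\<lambda>l. w $ (the_inv_into {..<r n} (en n) l)"] by blast
  have "xvec n x = w"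
    using assms x(2) by (intro eq_vecI)
      (auto simp: xvec_def en_X the_inv_into_f_f[OF bij_betw_imp_inj_on[OF en]])
  with x(1) show ?thesis by blast
qed

text \<open>In degree \<open>Suc n\<close>, cycles are the kernel of the transpose of
  \<open>B n\<close> and boundaries the image of that of \<open>B (Suc n)\<close>; by
  \<open>saturation_iff\<close> the kernel is the saturation of this image.\<close>

lemma bij_betw_homology_saturation:
  "\<exists>h. bij_betw h (cycles G bar bar_d n // homologous G bar bar_d n)
    (saturation (transpose_mat (B (Suc n))) // mod_image (transpose_mat (B (Suc n))))"
proof (rule bij_betw_quotients_surj[where phi = "xvec (Suc n)"])
  note R = projective_resolution_bar
  have zz: "\<forall>n. \<forall>x \<in> carrier (bar (Suc (Suc n))). bar_d n (bar_d (Suc n) x) = \<zero>\<^bsub>bar n\<^esub>"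
    using projective_resolution_zero(2)[OF R] by blast
  show "equiv (cycles G bar bar_d n) (homologous G bar bar_d n)"
    by (rule equiv_homologous[OF is_group right_module_bar bar_d_hom zz])
  show "equiv (saturation (transpose_mat (B (Suc n)))) (mod_image (transpose_mat (B (Suc n))))"
    by (rule equiv_mod_image)
  have vc: "xvec (Suc n) x \<in> carrier_vec (r (Suc n))" for x by (simp add: xvec_def)
  have z: "\<zero>\<^bsub>bar n\<^esub> \<in> carrier (bar n)" "xvec n \<zero>\<^bsub>bar n\<^esub> = 0\<^sub>v (r n)"
    by (auto simp: bar_simps xvec_def coord_def)
  have cyc: "x \<in> cycles G bar bar_d n \<longleftrightarrow> x \<in> carrier (bar (Suc n)) \<and> xvec (Suc n) x \<in> saturation (transpose_mat (B (Suc n)))" for x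
  proof (cases "x \<in> carrier (bar (Suc n))")
    case True
    then show ?thesis
      unfolding cycles_def saturation_iff(2)[OF vc]
      using pure_eq_iff_xvec[OF mod_homD(1)[OF bar_d_hom True] z(1)] z(2) by (simp add: xvec_bar_d)
  qed (simp add: cycles_def)
  have sub: "v \<in> carrier_vec (r (Suc n))" if "v \<in> saturation (transpose_mat (B (Suc n)))" for v
    using that by (simp add: saturation_def Bmat_def)
  show "xvec (Suc n) ` cycles G bar bar_d n = saturation (transpose_mat (B (Suc n)))"
  proof (intro equalityI subsetI)
    fix w assume w: "w \<in> saturation (transpose_mat (B (Suc n)))"
    obtain x where "x \<in> carrier (bar (Suc n))" "xvec (Suc n) x = w" using ex_xvec[OF sub[OF w]] by blast
    with w show "w \<in> xvec (Suc n) ` cycles G bar bar_d n" by (intro image_eqI[of _ _ x]) (auto simp: cyc)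
  qed (auto simp: cyc)
  fix x x' assume x: "x \<in> cycles G bar bar_d n" "x' \<in> cycles G bar bar_d n"
  then have xc: "x \<in> carrier (bar (Suc n))" "x' \<in> carrier (bar (Suc n))" by (auto simp: cyc)
  interpret M: right_module "group_ring G" "bar (Suc n)" by (rule right_module_bar)
  have eq: "coinvariants.pure G (bar (Suc n)) x' = coinvariants.pure G (bar (Suc n)) (bar_d (Suc n) y \<oplus>\<^bsub>bar (Suc n)\<^esub> x)
      \<longleftrightarrow> xvec (Suc n) x' = transpose_mat (B (Suc n)) *\<^sub>v xvec (Suc (Suc n)) y + xvec (Suc n) x"
    if y: "y \<in> carrier (bar (Suc (Suc n)))" for y
    using xc mod_homD(1)[OF bar_d_hom y] y by (simp add: pure_eq_iff_xvec xvec_add xvec_bar_d)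
  have "(x, x') \<in> homologous G bar bar_d n \<longleftrightarrow> (\<exists>y \<in> carrier (bar (Suc (Suc n))).
      xvec (Suc n) x' = transpose_mat (B (Suc n)) *\<^sub>v xvec (Suc (Suc n)) y + xvec (Suc n) x)"
    using x by (simp add: homologous_def eq cong: bex_cong)
  also have "\<dots> \<longleftrightarrow> (\<exists>w \<in> carrier_vec (r (Suc (Suc n))).
      xvec (Suc n) x' = transpose_mat (B (Suc n)) *\<^sub>v w + xvec (Suc n) x)"
    (is "?l \<longleftrightarrow> ?r")
  proof
    assume ?l
    then obtain y where "xvec (Suc n) x' = transpose_mat (B (Suc n)) *\<^sub>v xvec (Suc (Suc n)) y + xvec (Suc n) x"
      by blast
    then show ?r by (rule bexI) (simp add: xvec_def)
  next
    assume ?r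
    then obtain w where w: "w \<in> carrier_vec (r (Suc (Suc n)))"
      "xvec (Suc n) x' = transpose_mat (B (Suc n)) *\<^sub>v w + xvec (Suc n) x" by blast
    obtain y where y: "y \<in> carrier (bar (Suc (Suc n)))" "xvec (Suc (Suc n)) y = w" using ex_xvec[OF w(1)] by blast
    show ?l by (rule bexI[OF _ y(1)]) (simp only: y(2) w(2))
  qed
  also have "\<dots> \<longleftrightarrow> (xvec (Suc n) x, xvec (Suc n) x') \<in> mod_image (transpose_mat (B (Suc n)))"
    using x by (simp add: mod_image_def cyc carrier_matD[OF Bmat_carrier])
  finally show "(x, x') \<in> homologous G bar bar_d n \<longleftrightarrow>
    (xvec (Suc n) x, xvec (Suc n) x') \<in> mod_image (transpose_mat (B (Suc n)))" .
qed

lemma hom_bar_d: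
  assumes f: "f \<in> mod_hom (group_ring G) (bar n) (trivial_module G)" and l: "l \<in> X (Suc n)"
  shows "f (bar_d n (bas l)) = (\<Sum>s\<in>X n. cob (\<lambda>_. 1) l s * f (bas s))"
proof -
  have "bas l \<in> carrier (bar (Suc n))" by (rule based_module.e_closed[OF based_module_bar l])
  then have "f (bar_d n (bas l)) = (\<Sum>s\<in>X n. aug (coord s (bar_d n (bas l))) * f (bas s))"
    by (rule based_module.hom_expansion[OF based_module_bar f mod_homD(1)[OF bar_d_hom]])
  then show ?thesis by (simp add: aug_coord_bar_d l cong: sum.cong)
qed

lemma Bmat_fvec:
  assumes f: "f \<in> mod_hom (group_ring G) (bar n) (trivial_module G)"
  shows "B n *\<^sub>v fvec n f = vec (r (Suc n)) (\<lambda>i. f (bar_d n (bas (en (Suc n) i))))"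
proof (rule eq_vecI)
  fix i assume "i < dim_vec (vec (r (Suc n)) (\<lambda>i. f (bar_d n (bas (en (Suc n) i)))))"
  then have i: "i < r (Suc n)" by simp
  have "(B n *\<^sub>v fvec n f) $ i = (\<Sum>j<r n. cob (\<lambda>_. 1) (en (Suc n) i) (en n j) * f (bas (en n j)))"
    using i by (simp add: fvec_def scalar_prod_def Bmat_def atLeast0LessThan)
  also have "\<dots> = (\<Sum>s\<in>X n. cob (\<lambda>_. 1) (en (Suc n) i) s * f (bas s))" by (rule sum_en)
  finally show "(B n *\<^sub>v fvec n f) $ i = vec (r (Suc n)) (\<lambda>i. f (bar_d n (bas (en (Suc n) i)))) $ i"
    using i by (simp add: hom_bar_d[OF f en_X])
qed (simp add: Bmat_def)

lemma hom_eq_iff_bas: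
  assumes "f \<in> mod_hom (group_ring G) (bar n) (trivial_module G)"
    "f' \<in> mod_hom (group_ring G) (bar n) (trivial_module G)"
  shows "(\<forall>x \<in> carrier (bar n). f x = f' x) \<longleftrightarrow> (\<forall>i<r n. f (bas (en n i)) = f' (bas (en n i)))"
proof
  assume "\<forall>x \<in> carrier (bar n). f x = f' x"
  then show "\<forall>i<r n. f (bas (en n i)) = f' (bas (en n i))"
    using based_module.e_closed[OF based_module_bar] en_X by blast
next
  assume "\<forall>i<r n. f (bas (en n i)) = f' (bas (en n i))"
  then have "f (bas l) = f' (bas l)" if "l \<in> X n" for l using ex_en[OF that] by auto
  then show "\<forall>x \<in> carrier (bar n). f x = f' x"
    by (simp add: based_module.hom_expansion[OF based_module_bar assms(1)]
        based_module.hom_expansion[OF based_module_bar assms(2)] cong: sum.cong)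
qed

lemma ex_fvec:
  assumes "v \<in> carrier_vec (r n)"
  shows "\<exists>f \<in> mod_hom (group_ring G) (bar n) (trivial_module G). fvec n f = v"
proof -
  let ?v = "\<lambda>l. v $ (the_inv_into {..<r n} (en n) l)"
  let ?f = "\<lambda>x\<in>carrier (bar n). \<Sum>l\<in>X n. aug (coord l x) * ?v l"
  have "?f (bas (en n i)) = v $ i" if i: "i < r n" for i
  proof -
    have "bas (en n i) \<in> carrier (bar n)" by (rule based_module.e_closed[OF based_module_bar en_X[OF i]])
    then have "?f (bas (en n i)) = (\<Sum>l\<in>X n. aug (coord l (bas (en n i))) * ?v l)" by simp
    also have "\<dots> = ?v (en n i)" by (rule based_module.hom_of_values_e[OF based_module_bar en_X[OF i]])
    finally show ?thesis using i by (simp add: the_inv_into_f_f[OF bij_betw_imp_inj_on[OF en]])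
  qed
  then have "fvec n ?f = v"
    unfolding fvec_def by (intro eq_vecI) (use assms in \<open>simp_all del: restrict_apply\<close>)
  then show ?thesis using based_module.hom_of_values[OF based_module_bar[of n], of ?v] by blast
qed

text \<open>In degree \<open>Suc n\<close> cocycles are the saturation of the image of
  \<open>B n\<close>, whereas homology in that degree uses \<open>B (Suc n)\<close>. So one matrix
  governs homology in some degree and cohomology in the next.\<close>

lemma bij_betw_cohomology_saturation:
  "\<exists>h. bij_betw h (cocycles G bar bar_d (Suc n) // cohomologous G bar bar_d n) (saturation (B n) // mod_image (B n))"
proof (rule bij_betw_quotients_surj[where phi = "fvec (Suc n)"])
  let ?T = "trivial_module G" and ?R = "group_ring G"
  have zz: "\<forall>n. \<forall>x \<in> carrier (bar (Suc (Suc n))). bar_d n (bar_d (Suc n) x) = \<zero>\<^bsub>bar n\<^esub>"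
    using projective_resolution_zero(2)[OF projective_resolution_bar] by blast
  show "equiv (cocycles G bar bar_d (Suc n)) (cohomologous G bar bar_d n)"
    by (rule equiv_cohomologous[OF right_module_bar bar_d_hom zz])
  show "equiv (saturation (B n)) (mod_image (B n))" by (rule equiv_mod_image)
  have vc: "fvec k f \<in> carrier_vec (r k)" for k f by (simp add: fvec_def)
  have comp: "compose (carrier (bar (Suc k))) f (bar_d k) \<in> mod_hom ?R (bar (Suc k)) ?T"
    if "f \<in> mod_hom ?R (bar k) ?T" for f k
    by (rule mod_hom_compose[OF right_module_bar bar_d_hom that])
  have bc: "bas (en k i) \<in> carrier (bar k)" if "i < r k" for k i
    by (rule based_module.e_closed[OF based_module_bar en_X[OF that]])
  have coc: "f \<in> cocycles G bar bar_d (Suc n) \<longleftrightarrow> f \<in> mod_hom ?R (bar (Suc n)) ?T \<and> fvec (Suc n) f \<in> saturation (B n)" for f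
  proof (cases "f \<in> mod_hom ?R (bar (Suc n)) ?T")
    case f: True
    have zero: "(\<lambda>x\<in>carrier (bar (Suc (Suc n))). 0) \<in> mod_hom ?R (bar (Suc (Suc n))) ?T"
      by (rule mod_hom_intI[OF right_module_bar]) auto
    have "(\<forall>x \<in> carrier (bar (Suc (Suc n))). f (bar_d (Suc n) x) = 0)
      \<longleftrightarrow> (\<forall>i<r (Suc (Suc n)). f (bar_d (Suc n) (bas (en (Suc (Suc n)) i))) = 0)"
      using hom_eq_iff_bas[OF comp[OF f] zero] bc by (simp add: compose_eq)
    also have "\<dots> \<longleftrightarrow> B (Suc n) *\<^sub>v fvec (Suc n) f = 0\<^sub>v (r (Suc (Suc n)))"
      unfolding Bmat_fvec[OF f] by (auto simp: vec_eq_iff)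
    also have "\<dots> \<longleftrightarrow> fvec (Suc n) f \<in> saturation (B n)" by (rule saturation_iff(1)[OF vc, symmetric])
    finally show ?thesis using f by (simp add: cocycles_def)
  qed (simp add: cocycles_def)
  have sub: "v \<in> carrier_vec (r (Suc n))" if "v \<in> saturation (B n)" for v
    using that by (simp add: saturation_def Bmat_def)
  show "fvec (Suc n) ` cocycles G bar bar_d (Suc n) = saturation (B n)"
  proof (intro equalityI subsetI)
    fix w assume w: "w \<in> saturation (B n)"
    obtain f where "f \<in> mod_hom ?R (bar (Suc n)) ?T" "fvec (Suc n) f = w" using ex_fvec[OF sub[OF w]] by blast
    with w show "w \<in> fvec (Suc n) ` cocycles G bar bar_d (Suc n)" by (intro image_eqI[of _ _ f]) (auto simp: coc)
  qed (auto simp: coc)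
  fix f f' assume f: "f \<in> cocycles G bar bar_d (Suc n)" "f' \<in> cocycles G bar bar_d (Suc n)"
  then have fh: "f \<in> mod_hom ?R (bar (Suc n)) ?T" "f' \<in> mod_hom ?R (bar (Suc n)) ?T" by (auto simp: coc)
  have eq: "(\<forall>x \<in> carrier (bar (Suc n)). f' x = g (bar_d n x) + f x) \<longleftrightarrow> fvec (Suc n) f' = B n *\<^sub>v fvec n g + fvec (Suc n) f"
    if g: "g \<in> mod_hom ?R (bar n) ?T" for g
  proof -
    have "(\<forall>x \<in> carrier (bar (Suc n)). f' x = g (bar_d n x) + f x) \<longleftrightarrow>
      (\<forall>i<r (Suc n). f' (bas (en (Suc n) i)) = g (bar_d n (bas (en (Suc n) i))) + f (bas (en (Suc n) i)))"
      using hom_eq_iff_bas[OF fh(2) mod_hom_int_add(1)[OF right_module_bar comp[OF g] fh(1)]] bc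
      by (simp add: compose_eq)
    also have "\<dots> \<longleftrightarrow> fvec (Suc n) f' = B n *\<^sub>v fvec n g + fvec (Suc n) f"
      unfolding Bmat_fvec[OF g] by (auto simp: fvec_def vec_eq_iff)
    finally show ?thesis .
  qed
  have "(f, f') \<in> cohomologous G bar bar_d n \<longleftrightarrow>
    (\<exists>g \<in> mod_hom ?R (bar n) ?T. fvec (Suc n) f' = B n *\<^sub>v fvec n g + fvec (Suc n) f)"
    using f by (simp add: cohomologous_def eq cong: bex_cong)
  also have "\<dots> \<longleftrightarrow> (\<exists>w \<in> carrier_vec (r n). fvec (Suc n) f' = B n *\<^sub>v w + fvec (Suc n) f)"
    (is "?l \<longleftrightarrow> ?r")
  proof
    assume ?l
    then obtain g where "fvec (Suc n) f' = B n *\<^sub>v fvec n g + fvec (Suc n) f" by blast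
    then show ?r by (rule bexI) (rule vc)
  next
    assume ?r
    then obtain w where w: "w \<in> carrier_vec (r n)" "fvec (Suc n) f' = B n *\<^sub>v w + fvec (Suc n) f" by blast
    obtain g where g: "g \<in> mod_hom ?R (bar n) ?T" "fvec n g = w" using ex_fvec[OF w(1)] by blast
    show ?l by (rule bexI[OF _ g(1)]) (simp only: g(2) w(2))
  qed
  also have "\<dots> \<longleftrightarrow> (fvec (Suc n) f, fvec (Suc n) f') \<in> mod_image (B n)"
    using f by (simp add: mod_image_def coc carrier_matD[OF Bmat_carrier])
  finally show "(f, f') \<in> cohomologous G bar bar_d n \<longleftrightarrow> (fvec (Suc n) f, fvec (Suc n) f') \<in> mod_image (B n)" .
qed

section \<open>Ranks of the twisted coboundary matrices\<close>

lemma sum_character: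
  assumes chi: "\<chi> \<in> chars" "\<chi> \<noteq> triv"
  shows "(\<Sum>g\<in>carrier G. \<chi> g) = 0"
proof -
  obtain h where h: "h \<in> carrier G" "\<chi> h \<noteq> 1"
  proof -
    have "\<exists>h\<in>carrier G. \<chi> h \<noteq> 1"
    proof (rule ccontr)
      assume "\<not> (\<exists>h\<in>carrier G. \<chi> h \<noteq> 1)"
      then have "\<chi> = triv" using charsD(3)[OF chi(1)] by (auto simp: triv_def extensional_def fun_eq_iff)
      with chi(2) show False ..
    qed
    with that show ?thesis by blast
  qed
  have "(\<Sum>g\<in>carrier G. \<chi> g) = (\<Sum>g\<in>carrier G. \<chi> (h \<otimes> g))" by (rule sum_left_translate[OF h(1), symmetric])
  also have "\<dots> = \<chi> h * (\<Sum>g\<in>carrier G. \<chi> g)"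
    using h(1) by (simp add: charsD(2)[OF chi(1)] sum_distrib_left cong: sum.cong)
  finally have "(\<chi> h - 1) * (\<Sum>g\<in>carrier G. \<chi> g) = 0" by (simp add: algebra_simps)
  with h(2) show ?thesis by simp
qed

text \<open>In degree 0 the character sums are 0 and |G|, so the traces differ by |G|; the recursion
  for traces reverses the sign of the difference at each step.\<close>

lemma tr_twisted:
  assumes chi: "\<chi> \<in> chars" "\<chi> \<noteq> triv"
  shows "tr_mat (Bmat \<chi> n * Hmat \<chi> n) = tr_mat (Bmat triv n * Hmat triv n) + (- 1) ^ n * of_nat (card (carrier G))"
proof (induction n)
  case 0
  have "tr_mat (Bmat \<psi> 0 * Hmat \<psi> 0) = of_nat (card (carrier G)) - (\<Sum>g\<in>carrier G. \<psi> g)" if "\<psi> \<in> chars" for \<psi>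
    using tr_mat_comm[OF Bmat_carrier Hmat_carrier, of \<psi> 0 \<psi>] tr_Hmat_Bmat_0[OF charsD(1,2)[OF that]] by simp
  moreover have "(\<Sum>g\<in>carrier G. triv g) = of_nat (card (carrier G))" by (simp add: triv_def)
  ultimately show ?case using chi(1) triv_chars sum_character[OF chi] by simp
next
  case (Suc n)
  then show ?case
    by (simp add: tr_Bmat_Hmat_Suc[OF charsD(1,2)[OF chi(1)]] tr_Bmat_Hmat_Suc[OF charsD(1,2)[OF triv_chars]])
qed

lemma hd_X: "t \<in> X (Suc n) \<Longrightarrow> hd t \<in> carrier G"
  by (cases t) (auto simp: Cons_X)

text \<open>\<open>triv\<close> is known to be 1 on the group only, so agreement with the constant
  character rests on the heads of all lists involved being group elements.\<close>

lemma cob_triv: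
  assumes "l \<in> X (Suc n)"
  shows "cob triv l s = of_int (cob (\<lambda>_. 1) l s)"
proof -
  have "cob triv l s = del (\<lambda>t. of_int (ext (\<lambda>_. 1) (ind s) t)) (\<one> # l)"
    unfolding cob_def
    by (rule del_cong_X[of _ "Suc n"]) (use assms in \<open>simp_all add: Cons_X ext_def ind_def triv_def hd_X\<close>)
  then show ?thesis by (simp only: del_of_int cob_def)
qed

lemma Bmat_triv: "Bmat triv n = map_mat of_int (B n)"
  by (rule eq_matI) (auto simp: Bmat_def intro!: cob_triv en_X)

lemma integral_span_del:
  assumes "\<And>s. set s \<subseteq> set t \<Longrightarrow> length t = Suc (length s) \<Longrightarrow> (\<lambda>\<chi>. u \<chi> s) \<in> integral_span"
  shows "(\<lambda>\<chi>. del (u \<chi>) t) \<in> integral_span"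
  using assms
proof (induction t arbitrary: u)
  case Nil
  show ?case using integral_span_of_int[of 0] by simp
next
  case (Cons g t)
  have 1: "(\<lambda>\<chi>. u \<chi> t) \<in> integral_span" by (rule Cons.prems) auto
  have 2: "(\<lambda>\<chi>. del (\<lambda>s. u \<chi> (g # s)) t) \<in> integral_span"
    by (rule Cons.IH, rule Cons.prems) auto
  \<comment> \<open>The difference is written as a sum over the two Booleans with a factor -1, to
    which closure under sums and products applies.\<close>
  have "(\<lambda>\<chi>. \<Sum>b\<in>UNIV. if b then u \<chi> t else of_int (- 1) * del (\<lambda>s. u \<chi> (g # s)) t) \<in> integral_span"
  proof (rule integral_span_sum)
    fix b
    show "(\<lambda>\<chi>. if b then u \<chi> t else of_int (- 1) * del (\<lambda>s. u \<chi> (g # s)) t) \<in> integral_span"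
      by (cases b) (simp_all only: if_True if_False simp_thms 1 integral_span_mult[OF integral_span_of_int[of "- 1"] 2])
  qed
  then show ?case by (simp add: UNIV_bool)
qed

lemma integral_span_cob:
  assumes l: "l \<in> X (Suc n)"
  shows "(\<lambda>\<chi>. cob \<chi> l s) \<in> integral_span"
  unfolding cob_def
proof (rule integral_span_del)
  fix t assume t: "set t \<subseteq> set (\<one> # l)" "length (\<one> # l) = Suc (length t)"
  then have "hd t \<in> carrier G" using l by (cases t) (auto simp: X_def)
  then have "(\<lambda>\<chi>. \<chi> (hd t) * of_int (ind s (nrm t))) \<in> integral_span"
    by (intro integral_span_mult integral_span_ev integral_span_of_int)
  then show "(\<lambda>\<chi>. ext \<chi> (ind s) t) \<in> integral_span" by (simp add: ext_def ind_def if_distrib cong: if_cong)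
qed

lemma order_quotient_dvd_prod:
  assumes D: "mequiv (B n) D" "diagonal_form \<rho> \<delta> D" and n: "odd n"
  shows "int (order (G Mod derived G (carrier G))) dvd (\<Prod>i<\<rho>. \<delta> i)"
proof -
  let ?N = "r (Suc n)" and ?M = "r n" and ?h = "of_int :: int \<Rightarrow> complex"
  let ?c = "of_nat (card (carrier G)) :: complex"
  obtain k where k: "n = Suc k" using n by (cases n) auto
  have c: "?c \<noteq> 0" using order_pos by simp
  obtain U U' V V' where U: "U \<in> carrier_mat ?N ?N" "U' \<in> carrier_mat ?N ?N" "V \<in> carrier_mat ?M ?M" "V' \<in> carrier_mat ?M ?M"
    "U * U' = 1\<^sub>m ?N" "U' * U = 1\<^sub>m ?N" "V * V' = 1\<^sub>m ?M" "V' * V = 1\<^sub>m ?M" "D = U * B n * V" and Dc: "D \<in> carrier_mat ?N ?M"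
    by (rule mequivE[OF D(1) Bmat_carrier]) blast
  have "semiring_hom ?h" by unfold_locales auto
  note hom_mult = semiring_hom.mat_hom_mult[OF this] and hom_one = semiring_hom.mat_hom_one[OF this]
  let ?m = "map_mat ?h"
  have hU: "?m U * ?m U' = 1\<^sub>m ?N" "?m U' * ?m U = 1\<^sub>m ?N" "?m V * ?m V' = 1\<^sub>m ?M" "?m V' * ?m V = 1\<^sub>m ?M"
    using hom_mult[OF U(1,2)] hom_mult[OF U(2,1)] hom_mult[OF U(3,4)] hom_mult[OF U(4,3)]
    by (simp_all add: U(5-8) hom_one)
  have hD: "?m D = ?m U * Bmat triv n * ?m V"
    unfolding U(9) Bmat_triv using hom_mult[OF mult_carrier_mat[OF U(1) Bmat_carrier] U(3)]
      hom_mult[OF U(1) Bmat_carrier] by metis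
  have "mequiv (Bmat triv n) (?m D)"
    unfolding mequiv_def hD carrier_matD[OF Bmat_carrier]
    by (intro bexI[of _ "?m U"] bexI[of _ "?m V"] refl GL_I[OF _ _ hU(1,2)] GL_I[OF _ _ hU(3,4)]) (use U in auto)
  moreover have hdiag: "diagonal_form \<rho> (\<lambda>i. ?h (\<delta> i)) (?m D)"
    using D(2) unfolding diagonal_form_def by auto
  ultimately have tau: "tr_mat (Bmat triv n * Hmat triv n) = ?c * of_nat \<rho>"
    unfolding k by (rule rank_eq_trace[OF _ Bmat_carrier Hmat_carrier])
      (rule Bmat_Hmat_Bmat[OF charsD(1,2)[OF triv_chars]])
  have rho: "\<rho> \<le> ?N" "\<rho> \<le> ?M" using D(2) Dc by (auto simp: diagonal_form_def)
  \<comment> \<open>Only the middle factor varies with \<chi>; \<open>U\<close>, \<open>V\<close>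
    and the size \<rho> come from the trivial character.\<close>
  define F where "F \<chi> = det (minor \<rho> (?m U * Bmat \<chi> n * ?m V))" for \<chi>
  have vanish: "F \<chi> = 0" if chi: "\<chi> \<in> chars" "\<chi> \<noteq> triv" for \<chi>
  proof -
    \<comment> \<open>Complex division is exact, so a constant size function satisfies the Euclidean
      hypothesis.\<close>
    obtain E \<sigma> \<epsilon> where E: "mequiv (Bmat \<chi> n) E" "diagonal_form \<sigma> \<epsilon> E"
      using ex_diagonal_form[of "\<lambda>_. 0" "Bmat \<chi> n"]
      by (metis diff_self nonzero_eq_divide_eq)
    have "tr_mat (Bmat \<chi> n * Hmat \<chi> n) = ?c * of_nat \<sigma>"
      using E unfolding k
      by (rule rank_eq_trace[OF _ Bmat_carrier Hmat_carrier]) (rule Bmat_Hmat_Bmat[OF charsD(1,2)[OF chi(1)]])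
    \<comment> \<open>In odd degree the sign in \<open>tr_twisted\<close> is -1, so the rank
      \<sigma> at \<chi> is \<rho> - 1.\<close>
    then have "?c * of_nat \<sigma> = ?c * of_nat \<rho> - ?c"
      using tr_twisted[OF chi, of n] n by (simp add: tau)
    then have "?c * of_nat (Suc \<sigma>) = ?c * of_nat \<rho>" by (simp add: algebra_simps)
    then have "of_nat (Suc \<sigma>) = (of_nat \<rho> :: complex)" using c by (simp only: mult_cancel_left simp_thms)
    then have "Suc \<sigma> = \<rho>" by (simp only: of_nat_eq_iff)
    then show ?thesis
      unfolding F_def by (intro det_minor_eq_0[OF E(1) Bmat_carrier E(2) _ rho]) (use U in auto)
  qed
  have entry: "(?m U * Bmat \<chi> n * ?m V) $$ (i, j) = (\<Sum>b<?M. (\<Sum>a<?N. ?h (U $$ (i, a)) * cob \<chi> (en (Suc n) a) (en n b)) * ?h (V $$ (b, j)))"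
    if "i < \<rho>" "j < \<rho>" for i j \<chi>
  proof -
    have ij: "i < ?N" "j < ?M" using that rho by auto
    have mU: "?m U \<in> carrier_mat ?N ?N" "?m V \<in> carrier_mat ?M ?M" using U by auto
    have "(?m U * Bmat \<chi> n * ?m V) $$ (i, j) = (\<Sum>b<?M. (?m U * Bmat \<chi> n) $$ (i, b) * ?m V $$ (b, j))"
      by (rule index_mult_mat_sum[OF mult_carrier_mat[OF mU(1) Bmat_carrier] mU(2) ij])
    also have "\<dots> = (\<Sum>b<?M. (\<Sum>a<?N. ?m U $$ (i, a) * Bmat \<chi> n $$ (a, b)) * ?m V $$ (b, j))"
      by (rule sum.cong[OF refl]) (simp only: index_mult_mat_sum[OF mU(1) Bmat_carrier ij(1)] lessThan_iff)
    also have "\<dots> = (\<Sum>b<?M. (\<Sum>a<?N. ?h (U $$ (i, a)) * cob \<chi> (en (Suc n) a) (en n b)) * ?h (V $$ (b, j)))"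
      using U ij by (intro sum.cong refl arg_cong2[of _ _ _ _ "(*)"]) (auto simp: Bmat_index)
    finally show ?thesis .
  qed
  have "F \<in> integral_span"
  proof (rule integral_span_cong)
    show "(\<lambda>\<chi>. det (mat \<rho> \<rho> (\<lambda>(i, j). \<Sum>b<?M. (\<Sum>a<?N. ?h (U $$ (i, a)) * cob \<chi> (en (Suc n) a) (en n b)) * ?h (V $$ (b, j))))) \<in> integral_span"
      by (intro integral_span_det integral_span_sum integral_span_mult integral_span_of_int integral_span_cob en_X)
        (auto intro: en_X)
    show "det (mat \<rho> \<rho> (\<lambda>(i, j). \<Sum>b<?M. (\<Sum>a<?N. ?h (U $$ (i, a)) * cob \<chi> (en (Suc n) a) (en n b)) * ?h (V $$ (b, j)))) = F \<chi>" for \<chi>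
      unfolding F_def minor_def by (rule arg_cong[of _ _ det], rule eq_matI) (simp_all add: entry del: index_mult_mat(1))
  qed
  \<comment> \<open>The function \<open>a\<close> lists the coefficients of a group ring element
    representing the minor; evaluation at \<open>triv\<close> sums them up.\<close>
  then obtain a where a: "\<And>\<chi>. \<chi> \<in> chars \<Longrightarrow> F \<chi> = (\<Sum>g\<in>carrier G. of_int (a g) * \<chi> g)"
    by (auto simp: integral_span_def)
  have "int (order (G Mod derived G (carrier G))) dvd (\<Sum>g\<in>carrier G. a g)"
    by (rule card_quotient_dvd) (use vanish a in metis)
  moreover have "(\<Sum>g\<in>carrier G. a g) = (\<Prod>i<\<rho>. \<delta> i)"
  proof -
    have "?h (\<Sum>g\<in>carrier G. a g) = F triv" by (simp add: a[OF triv_chars]) (simp add: triv_def)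
    also have "\<dots> = ?h (\<Prod>i<\<rho>. \<delta> i)"
      unfolding F_def hD[symmetric] det_minor_diagonal[OF hdiag] by simp
    finally show ?thesis by (simp only: of_int_eq_iff)
  qed
  ultimately show ?thesis by simp
qed

end

theorem theorem1:
  fixes G :: "('g, 'c) monoid_scheme" and m :: nat
    and P :: "nat \<Rightarrow> ('g \<Rightarrow> int, 'p) module" and d :: "nat \<Rightarrow> 'p \<Rightarrow> 'p" and e :: "'p \<Rightarrow> int"
    and Q :: "nat \<Rightarrow> ('g \<Rightarrow> int, 'q) module" and d' :: "nat \<Rightarrow> 'q \<Rightarrow> 'q" and e' :: "'q \<Rightarrow> int"
  assumes "group G" and "finite (carrier G)" and "m \<ge> 1"
    and "projective_resolution (group_ring G) (trivial_module G) P d e"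
    and "projective_resolution (group_ring G) (trivial_module G) Q d' e'"
  shows "finite (carrier (group_cohomology G P d (2 * m)))
    \<and> finite (carrier (group_homology G Q d' (2 * m - 1)))
    \<and> order (G Mod derived G (carrier G)) dvd order (group_cohomology G P d (2 * m))
    \<and> order (group_cohomology G P d (2 * m)) = order (group_homology G Q d' (2 * m - 1))"
proof -
  interpret finite_group G using assms(1,2) by (intro finite_group.intro finite_group_axioms.intro)
  obtain j where j: "m = Suc j" using assms(3) by (cases m) auto
  let ?k = "2 * j"
  have k: "2 * m = Suc (Suc ?k)" "2 * m - 1 = Suc ?k" "odd (Suc ?k)" using j by auto
  \<comment> \<open>The coboundary from degree 2m - 1 to 2m: it yields cohomology in degree 2m and,
    transposed, homology in degree 2m - 1.\<close>
  let ?B = "B (Suc ?k)"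
  have "\<exists>q. a - q * b = 0 \<or> nat \<bar>a - q * b\<bar> < nat \<bar>b\<bar>" if "b \<noteq> 0" for a b :: int
    using that abs_mod_less[of b a] by (intro exI[of _ "a div b"]) (auto simp: minus_div_mult_eq_mod)
  then obtain D \<rho> \<delta> where D: "mequiv ?B D" "diagonal_form \<rho> \<delta> D"
    using ex_diagonal_form[of "\<lambda>a. nat \<bar>a\<bar>" ?B] by blast
  let ?p = "nat (\<Prod>i<\<rho>. \<bar>\<delta> i\<bar>)"
  note BAR = projective_resolution_bar
  have zz: "\<forall>n. \<forall>x \<in> carrier (bar (Suc (Suc n))). bar_d n (bar_d (Suc n) x) = \<zero>\<^bsub>bar n\<^esub>"
    using projective_resolution_zero(2)[OF BAR] by blast
  note QD = projective_resolutionD[OF assms(5)]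
  have Qz: "\<forall>n. \<forall>x \<in> carrier (Q (Suc (Suc n))). d' n (d' (Suc n) x) = \<zero>\<^bsub>Q n\<^esub>"
    using projective_resolution_zero(2)[OF assms(5)] by blast
  obtain h1 where h1: "bij_betw h1 (carrier (group_cohomology G P d (Suc (Suc ?k)))) (carrier (group_cohomology G bar bar_d (Suc (Suc ?k))))"
    using bij_betw_group_cohomology[OF assms(4) BAR] by blast
  have "carrier (group_cohomology G bar bar_d (Suc (Suc ?k))) = cocycles G bar bar_d (Suc (Suc ?k)) // cohomologous G bar bar_d (Suc ?k)"
    by (rule carrier_group_cohomology[OF right_module_bar bar_d_hom zz])
  with bij_betw_cohomology_saturation obtain h2
    where h2: "bij_betw h2 (carrier (group_cohomology G bar bar_d (Suc (Suc ?k)))) (saturation ?B // mod_image ?B)"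
    by metis
  obtain h3 where h3: "bij_betw h3 (cycles G Q d' ?k // homologous G Q d' ?k) (carrier (group_homology G Q d' (Suc ?k)))"
    using bij_betw_group_homology[where P = Q and d = d', OF assms(1) QD(3,4) Qz] by blast
  obtain h4 where h4: "bij_betw h4 (cycles G Q d' ?k // homologous G Q d' ?k) (cycles G bar bar_d ?k // homologous G bar bar_d ?k)"
    using bij_betw_homology_classes[OF assms(1,5) BAR] by blast
  let ?C = "transpose_mat ?B"
  obtain h5 where h5: "bij_betw h5 (cycles G bar bar_d ?k // homologous G bar bar_d ?k) (saturation ?C // mod_image ?C)"
    using bij_betw_homology_saturation by blast
  note c1 = card_saturation_quotient[OF D]
  \<comment> \<open>Transposition keeps the diagonal entries, so both orders are the same number
    \<open>?p\<close>.\<close>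
  note c2 = card_saturation_quotient[OF mequiv_transpose[OF D(1)] diagonal_form_transpose[OF D(2)]]
  have coh: "finite (carrier (group_cohomology G P d (2 * m)))" "order (group_cohomology G P d (2 * m)) = ?p"
    unfolding k(1) Coset.order_def
    using bij_betw_finite[OF h1] bij_betw_finite[OF h2] bij_betw_same_card[OF h1] bij_betw_same_card[OF h2] c1
    by simp_all
  have hom: "finite (carrier (group_homology G Q d' (2 * m - 1)))" "order (group_homology G Q d' (2 * m - 1)) = ?p"
    unfolding k(2) Coset.order_def
    using bij_betw_finite[OF h3] bij_betw_finite[OF h4] bij_betw_finite[OF h5]
      bij_betw_same_card[OF h3] bij_betw_same_card[OF h4] bij_betw_same_card[OF h5] c2
    by simp_all
  have "int (order (G Mod derived G (carrier G))) dvd \<bar>\<Prod>i<\<rho>. \<delta> i\<bar>"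
    using order_quotient_dvd_prod[OF D k(3)] by simp
  also have "\<bar>\<Prod>i<\<rho>. \<delta> i\<bar> = int ?p" by (simp add: abs_prod prod_nonneg)
  finally have "order (G Mod derived G (carrier G)) dvd ?p" by (simp only: int_dvd_int_iff)
  with coh hom show ?thesis by simp
qed

end
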